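(* There exist a compact, connected, smooth Riemannian manifold $(M,g)$ of dimension $n\ge2$, a number $s\in(0,n)$, and an $s$-Ahlfors--David regular finite Borel measure $\mu$ on $M$ for which the quantity $N_\mu(\lambda)/\lambda^{n-s}$ fails to converge as $\lambda\to\infty$.
   Context: Let $\{e_j\}_{j\ge 0}$ be a complete orthonormal basis of $L^2(M)$ consisting of real Laplace eigenfunctions, $-\Delta_g e_j=\lambda_j^2 e_j$, with $0=\lambda_0<\lambda_1\le\lambda_2\le\cdots$. For a finite Borel measure $\mu$ on $M$ the Kuznecov sum is $$N_\mu(\lambda):=\sum_{\lambda_j\le\lambda}\Bigl|\int_M e_j\,d\mu\Bigr|^2,\qquad \lambda\ge1.$$ A finite Borel measure $\mu$ on $M$ is $s$-Ahlfors--David regular if there exist constants $c,C>0$ and $r_0>0$ such that $c\,r^s\le\mu(B(x,r))\le C\,r^s$ for all $x\in\operatorname{supp}\mu$ and $0<r\le r_0$, where $B(x,r)$ is the geodesic ball of radius $r$ centered at $x$ with respect to the Riemannian distance. *)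

theory Defs
  imports
    "Jordan_Normal_Form.Determinant"
    "Jordan_Normal_Form.Gauss_Jordan_Elimination"
    "HOL-Analysis.Analysis"
begin

section \<open>Calculus on open subsets of \<open>R\<^sup>n\<close>\<close>

text \<open>
  The dimension has to be an existentially quantified natural number, so \<open>R\<^sup>n\<close> is the set of
  functions in \<open>{..<n} \<rightarrow>\<^sub>E UNIV\<close>, the common carrier of the library's product topology
  \<open>powertop_real {..<n}\<close> and of the product measure \<open>Pi\<^sub>M {..<n} (\<lambda>_. lborel)\<close>.
\<close>

definition pdiff :: "nat \<Rightarrow> ((nat \<Rightarrow> real) \<Rightarrow> real) \<Rightarrow> (nat \<Rightarrow> real) \<Rightarrow> real" where
  "pdiff i f x = deriv (\<lambda>t. f (x(i := t))) (x i)"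

text \<open>
  Smoothness on an open set \<open>V\<close>: all iterated partial derivatives, of every order including 0,
  exist and are continuous on \<open>V\<close>.
\<close>

definition smooth_on :: "nat \<Rightarrow> (nat \<Rightarrow> real) set \<Rightarrow> ((nat \<Rightarrow> real) \<Rightarrow> real) \<Rightarrow> bool" where
  "smooth_on n V f \<longleftrightarrow>
     (\<forall>is. set is \<subseteq> {..<n} \<longrightarrow>
        continuous_map (subtopology (powertop_real {..<n}) V) euclideanreal (fold pdiff is f) \<and>
        (\<forall>i<n. \<forall>x\<in>V. (\<lambda>t. fold pdiff is f (x(i := t))) differentiable (at (x i))))"


section \<open>Smooth Riemannian manifolds\<close>

text \<open>
  A chart is a pair \<open>(U, \<phi>)\<close>; the values of \<open>\<phi>\<close> outside \<open>U\<close> are irrelevant. The metric is given by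
  its components: \<open>metr M c p i j\<close> is \<open>g\<^sub>i\<^sub>j\<close> at the point \<open>p\<close> in the coordinates of the chart \<open>c\<close>.
  The atlas is not required to be maximal.
\<close>

type_synonym 'a chart = "'a set \<times> ('a \<Rightarrow> nat \<Rightarrow> real)"

record 'a riem_data =
  mtop :: "'a topology"
  mdim :: nat
  atlas :: "'a chart set"
  metr :: "'a chart \<Rightarrow> 'a \<Rightarrow> nat \<Rightarrow> nat \<Rightarrow> real"

definition is_chart :: "'a topology \<Rightarrow> nat \<Rightarrow> 'a chart \<Rightarrow> bool" where
  "is_chart X n = (\<lambda>(U, \<phi>).
     openin X U \<and> openin (powertop_real {..<n}) (\<phi> ` U) \<and>
     homeomorphic_map (subtopology X U) (subtopology (powertop_real {..<n}) (\<phi> ` U)) \<phi>)"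

definition transition :: "'a chart \<Rightarrow> 'a chart \<Rightarrow> (nat \<Rightarrow> real) \<Rightarrow> nat \<Rightarrow> real" where
  "transition c d = (\<lambda>x. snd d (inv_into (fst c) (snd c) x))"

definition smooth_manifold :: "('a, 'b) riem_data_scheme \<Rightarrow> bool" where
  "smooth_manifold M \<longleftrightarrow>
     Hausdorff_space (mtop M) \<and> second_countable (mtop M) \<and>
     (\<forall>c\<in>atlas M. is_chart (mtop M) (mdim M) c) \<and>
     (\<Union>c\<in>atlas M. fst c) = topspace (mtop M) \<and>
     (\<forall>c\<in>atlas M. \<forall>d\<in>atlas M. \<forall>k<mdim M.
        smooth_on (mdim M) (snd c ` (fst c \<inter> fst d)) (\<lambda>x. transition c d x k))"

definition smooth_fun :: "('a, 'b) riem_data_scheme \<Rightarrow> ('a \<Rightarrow> real) \<Rightarrow> bool" where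
  "smooth_fun M f \<longleftrightarrow>
     (\<forall>(U, \<phi>)\<in>atlas M. smooth_on (mdim M) (\<phi> ` U) (\<lambda>x. f (inv_into U \<phi> x)))"

text \<open>
  A Riemannian metric is a smooth, symmetric, positive definite covariant 2-tensor field; the last
  conjunct is the transformation law between the components in two charts.
\<close>

definition riemannian_metric :: "('a, 'b) riem_data_scheme \<Rightarrow> bool" where
  "riemannian_metric M \<longleftrightarrow>
     (\<forall>(U, \<phi>)\<in>atlas M. \<forall>i<mdim M. \<forall>j<mdim M.
        smooth_on (mdim M) (\<phi> ` U) (\<lambda>x. metr M (U, \<phi>) (inv_into U \<phi> x) i j)) \<and>
     (\<forall>c\<in>atlas M. \<forall>p\<in>fst c. \<forall>i<mdim M. \<forall>j<mdim M. metr M c p i j = metr M c p j i) \<and>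
     (\<forall>c\<in>atlas M. \<forall>p\<in>fst c. \<forall>v :: nat \<Rightarrow> real. (\<exists>i<mdim M. v i \<noteq> 0) \<longrightarrow>
        (\<Sum>i<mdim M. \<Sum>j<mdim M. metr M c p i j * v i * v j) > 0) \<and>
     (\<forall>c\<in>atlas M. \<forall>d\<in>atlas M. \<forall>p\<in>fst c \<inter> fst d. \<forall>i<mdim M. \<forall>j<mdim M.
        metr M c p i j =
          (\<Sum>k<mdim M. \<Sum>l<mdim M. metr M d p k l *
             pdiff i (\<lambda>x. transition c d x k) (snd c p) *
             pdiff j (\<lambda>x. transition c d x l) (snd c p)))"

definition riemannian_manifold :: "('a, 'b) riem_data_scheme \<Rightarrow> bool" where
  "riemannian_manifold M \<longleftrightarrow> smooth_manifold M \<and> riemannian_metric M"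

abbreviation metr_mat :: "('a, 'b) riem_data_scheme \<Rightarrow> 'a chart \<Rightarrow> 'a \<Rightarrow> real mat" where
  "metr_mat M c p \<equiv> Matrix.mat (mdim M) (mdim M) (\<lambda>(i, j). metr M c p i j)"

definition vol_density :: "('a, 'b) riem_data_scheme \<Rightarrow> 'a chart \<Rightarrow> 'a \<Rightarrow> real" where
  "vol_density M c p = sqrt (Determinant.det (metr_mat M c p))"

definition inv_metr :: "('a, 'b) riem_data_scheme \<Rightarrow> 'a chart \<Rightarrow> 'a \<Rightarrow> nat \<Rightarrow> nat \<Rightarrow> real" where
  "inv_metr M c p i j = the (mat_inverse (metr_mat M c p)) $$ (i, j)"


section \<open>Riemannian distance\<close>

text \<open>
  \<open>C1_arc M c \<gamma> v\<close>: the curve \<open>\<gamma>\<close> on \<open>[0,1]\<close> stays in the domain of the chart \<open>c\<close> and is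
  continuously differentiable there (one-sidedly at the end points), with velocity \<open>v\<close>
  in the coordinates of \<open>c\<close>.
\<close>

definition C1_arc ::
  "('a, 'b) riem_data_scheme \<Rightarrow> 'a chart \<Rightarrow> (real \<Rightarrow> 'a) \<Rightarrow> (real \<Rightarrow> nat \<Rightarrow> real) \<Rightarrow> bool" where
  "C1_arc M c \<gamma> v \<longleftrightarrow>
     c \<in> atlas M \<and> \<gamma> ` {0..1} \<subseteq> fst c \<and>
     (\<forall>i<mdim M. continuous_on {0..1} (\<lambda>t. v t i) \<and>
        (\<forall>t\<in>{0..1}. ((\<lambda>\<tau>. snd c (\<gamma> \<tau>) i) has_real_derivative v t i) (at t within {0..1})))"

definition arc_length ::
  "('a, 'b) riem_data_scheme \<Rightarrow> 'a chart \<Rightarrow> (real \<Rightarrow> 'a) \<Rightarrow> (real \<Rightarrow> nat \<Rightarrow> real) \<Rightarrow> real" where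
  "arc_length M c \<gamma> v =
     integral {0..1} (\<lambda>t. sqrt (\<Sum>i<mdim M. \<Sum>j<mdim M. metr M c (\<gamma> t) i j * v t i * v t j))"

text \<open>
  \<open>curve_length M x y l\<close>: some piecewise \<open>C\<^sup>1\<close> curve from \<open>x\<close> to \<open>y\<close> has length \<open>l\<close>. Such a curve is
  a finite concatenation of \<open>C\<^sup>1\<close> arcs, each inside one chart domain (subdivide further if necessary).
\<close>

inductive curve_length :: "('a, 'b) riem_data_scheme \<Rightarrow> 'a \<Rightarrow> 'a \<Rightarrow> real \<Rightarrow> bool"
  for M :: "('a, 'b) riem_data_scheme" where
  const: "x \<in> topspace (mtop M) \<Longrightarrow> curve_length M x x 0"
| arc: "C1_arc M c \<gamma> v \<Longrightarrow> curve_length M (\<gamma> 1) y l \<Longrightarrow>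
          curve_length M (\<gamma> 0) y (arc_length M c \<gamma> v + l)"

definition riem_dist :: "('a, 'b) riem_data_scheme \<Rightarrow> 'a \<Rightarrow> 'a \<Rightarrow> real" where
  "riem_dist M x y = Inf {l. curve_length M x y l}"

definition geod_ball :: "('a, 'b) riem_data_scheme \<Rightarrow> 'a \<Rightarrow> real \<Rightarrow> 'a set" where
  "geod_ball M x r = {y \<in> topspace (mtop M). riem_dist M x y < r}"


section \<open>Borel measures and the Riemannian volume\<close>

definition borel_algebra :: "'a topology \<Rightarrow> 'a measure" where
  "borel_algebra X = sigma (topspace X) {U. openin X U}"

text \<open>The volume measure is the unique Borel measure with density \<open>\<surd>(det g)\<close> in every chart.\<close>

definition riem_vol :: "('a, 'b) riem_data_scheme \<Rightarrow> 'a measure" where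
  "riem_vol M = (THE \<nu>. sets \<nu> = sets (borel_algebra (mtop M)) \<and>
     (\<forall>(U, \<phi>)\<in>atlas M. \<forall>A\<in>sets (borel_algebra (mtop M)). A \<subseteq> U \<longrightarrow>
        emeasure \<nu> A =
          (\<integral>\<^sup>+x\<in>\<phi> ` A. ennreal (vol_density M (U, \<phi>) (inv_into U \<phi> x)) \<partial>(Pi\<^sub>M {..<mdim M} (\<lambda>_. lborel)))))"

definition finite_borel_measure :: "('a, 'b) riem_data_scheme \<Rightarrow> 'a measure \<Rightarrow> bool" where
  "finite_borel_measure M \<mu> \<longleftrightarrow> sets \<mu> = sets (borel_algebra (mtop M)) \<and> finite_measure \<mu>"

definition msupp :: "('a, 'b) riem_data_scheme \<Rightarrow> 'a measure \<Rightarrow> 'a set" where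
  "msupp M \<mu> = {x \<in> topspace (mtop M). \<forall>U. openin (mtop M) U \<and> x \<in> U \<longrightarrow> emeasure \<mu> U > 0}"

definition AD_regular :: "('a, 'b) riem_data_scheme \<Rightarrow> real \<Rightarrow> 'a measure \<Rightarrow> bool" where
  "AD_regular M s \<mu> \<longleftrightarrow>
     (\<exists>c C r0. c > 0 \<and> C > 0 \<and> r0 > 0 \<and>
        (\<forall>x\<in>msupp M \<mu>. \<forall>r. 0 < r \<and> r \<le> r0 \<longrightarrow>
           c * r powr s \<le> measure \<mu> (geod_ball M x r) \<and>
           measure \<mu> (geod_ball M x r) \<le> C * r powr s))"


section \<open>Laplace eigenfunctions and the Kuznecov sum\<close>

text \<open>
  The Laplace--Beltrami operator in the coordinates of the chart \<open>c = (U, \<phi>)\<close>: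
  \<open>\<Delta>f = (1/\<surd>det g) \<Sum>\<^sub>i \<partial>\<^sub>i (\<surd>det g \<Sum>\<^sub>j g\<^sup>i\<^sup>j \<partial>\<^sub>j f)\<close>.
\<close>

definition laplacian ::
  "('a, 'b) riem_data_scheme \<Rightarrow> 'a chart \<Rightarrow> ('a \<Rightarrow> real) \<Rightarrow> 'a \<Rightarrow> real" where
  "laplacian M c f p =
     (let \<phi>inv = inv_into (fst c) (snd c) in
      1 / vol_density M c p *
      (\<Sum>i<mdim M. pdiff i
         (\<lambda>x. vol_density M c (\<phi>inv x) *
            (\<Sum>j<mdim M. inv_metr M c (\<phi>inv x) i j * pdiff j (\<lambda>y. f (\<phi>inv y)) x))
         (snd c p)))"

definition laplace_eigenfunction ::
  "('a, 'b) riem_data_scheme \<Rightarrow> real \<Rightarrow> ('a \<Rightarrow> real) \<Rightarrow> bool" where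
  "laplace_eigenfunction M l f \<longleftrightarrow>
     smooth_fun M f \<and> (\<forall>c\<in>atlas M. \<forall>p\<in>fst c. - laplacian M c f p = l\<^sup>2 * f p)"

text \<open>
  Completeness of the orthonormal system \<open>e\<close> means that its linear span is dense in \<open>L\<^sup>2\<close>.
\<close>

definition laplace_eigenbasis ::
  "('a, 'b) riem_data_scheme \<Rightarrow> (nat \<Rightarrow> 'a \<Rightarrow> real) \<Rightarrow> (nat \<Rightarrow> real) \<Rightarrow> bool" where
  "laplace_eigenbasis M e lam \<longleftrightarrow>
     (\<forall>j. laplace_eigenfunction M (lam j) (e j)) \<and>
     lam 0 = 0 \<and> 0 < lam 1 \<and> (\<forall>j\<ge>1. lam j \<le> lam (Suc j)) \<and>
     (\<forall>j k. integrable (riem_vol M) (\<lambda>x. e j x * e k x) \<and>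
        (\<integral>x. e j x * e k x \<partial>riem_vol M) = (if j = k then 1 else 0)) \<and>
     (\<forall>f\<in>borel_measurable (riem_vol M). integrable (riem_vol M) (\<lambda>x. (f x)\<^sup>2) \<longrightarrow>
        (\<forall>\<epsilon>>0. \<exists>N (a :: nat \<Rightarrow> real).
           (\<integral>x. (f x - (\<Sum>j<N. a j * e j x))\<^sup>2 \<partial>riem_vol M) < \<epsilon>))"

definition kuznecov_sum ::
  "(nat \<Rightarrow> 'a \<Rightarrow> real) \<Rightarrow> (nat \<Rightarrow> real) \<Rightarrow> 'a measure \<Rightarrow> real \<Rightarrow> real" where
  "kuznecov_sum e lam \<mu> l = (\<Sum>j | lam j \<le> l. \<bar>\<integral>x. e j x \<partial>\<mu>\<bar>\<^sup>2)"

end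

theory Submission
  imports Defs
begin

text \<open>
  The manifold is the flat torus \<open>R\<^sup>2/Z\<^sup>2\<close> and the measure is \<open>\<nu> \<times> Lebesgue\<close>, where \<open>\<nu>\<close> is the
  self-similar measure of dimension \<open>1/2\<close> on the numbers whose base-4 digits are 0 or 1. Integrating
  out the second variable, the Kuznecov sum at \<open>2\<pi>K\<close> is \<open>A(K) = \<Sum> |\<nu>^(k)|\<^sup>2\<close> over \<open>|k| \<le> K\<close>, where
  \<open>|\<nu>^(\<xi>)|\<^sup>2 = \<Prod>\<^sub>j cos\<^sup>2(\<pi>\<xi>/4\<^sup>j)\<close>, and \<open>A(K)\<close> has order \<open>K\<^sup>1\<^sup>/\<^sup>2\<close>. At \<open>K = 2 * 4\<^sup>m\<close> one factor of the
  product vanishes to second order, so that \<open>A\<close> grows on \<open>[K, K + \<delta> 4\<^sup>m]\<close> by only \<open>O(\<delta>\<^sup>2 2\<^sup>m)\<close>,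
  whereas a positive limit of \<open>A(K)/K\<^sup>1\<^sup>/\<^sup>2\<close> would force growth of order \<open>\<delta> 2\<^sup>m\<close>.
\<close>

section \<open>The Cantor map and its Fourier transform\<close>

text \<open>Lebesgue measure in the second variable leaves only the frequencies
  \<open>(k, 0)\<close>, so the lattice points of a disc reduce to an interval of integers and no
  averaging over directions smooths out the oscillation. It also raises the dimension to 3/2, which
  makes n - s = 1/2 the growth exponent of \<open>A\<close>. The first m factors of the cosine
  product have period \<open>4 ^ m\<close> and sum to \<open>2 ^ m\<close> over a period. This
  identity serves both sides: with the transform bounded below on [-1, 1] it gives
  \<open>A(4 ^ m)\<close> at least \<open>2 ^ m / 4\<close>, which excludes the limit 0, and it
  controls the growth behind the double zero. The other obstacle is that the claim concerns every
  eigenbasis, while eigenspaces of the torus are multiple and a basis need not be trigonometric. The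
  Kuznecov sum must be shown independent of the basis, and since the measure is singular, identities
  almost everywhere do not suffice: the two systems have to be expanded in each other at every
  point.\<close>

definition bindigit :: "nat \<Rightarrow> real \<Rightarrow> real" where
  "bindigit n x = of_int (\<lfloor>2 ^ Suc n * x\<rfloor> mod 2)"

text \<open>\<open>cantor\<close> reads binary digits as base-4 digits, so it maps the Lebesgue measure of the unit
  interval to the measure \<open>\<nu>\<close>.\<close>

definition cantor :: "real \<Rightarrow> real" where
  "cantor x = (\<Sum>n. bindigit n x / 4 ^ Suc n)"

lemma bindigit_bounds: "0 \<le> bindigit n x" "bindigit n x \<le> 1"
proof -
  have "\<lfloor>2 ^ Suc n * x\<rfloor> mod 2 \<in> {0, 1}" by (auto simp: mod2_eq_if)
  then show "0 \<le> bindigit n x" "bindigit n x \<le> 1" by (auto simp: bindigit_def)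
qed

lemma sums_quarter: "(\<lambda>n. (1 / 4 ^ Suc n :: real)) sums (1 / 3)"
proof -
  have "(\<lambda>n. (1/4::real) * (1 / 4) ^ n) sums (1/4 * (1 / (1 - 1 / 4)))"
    by (intro sums_mult geometric_sums) auto
  then show ?thesis by (simp add: power_one_over)
qed

lemma bindigit_summable: "summable (\<lambda>n. bindigit n x / 4 ^ Suc n)"
proof (rule summable_comparison_test'[where N = 0, OF sums_summable[OF sums_quarter]])
  fix n :: nat
  show "norm (bindigit n x / 4 ^ Suc n) \<le> 1 / 4 ^ Suc n"
    using bindigit_bounds[of n x] by (simp add: divide_right_mono)
qed

lemma cantor_bounds: "0 \<le> cantor x" "cantor x \<le> 1 / 3"
proof -
  show "0 \<le> cantor x" unfolding cantor_def
    using bindigit_bounds by (intro suminf_nonneg bindigit_summable) auto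
  have "cantor x \<le> (\<Sum>n. 1 / 4 ^ Suc n)" unfolding cantor_def
    using bindigit_bounds sums_summable[OF sums_quarter]
    by (intro suminf_le bindigit_summable) (auto intro!: divide_right_mono)
  then show "cantor x \<le> 1 / 3" using sums_unique[OF sums_quarter] by simp
qed

lemma cantor_measurable [measurable]: "cantor \<in> borel_measurable borel"
  unfolding cantor_def[abs_def] bindigit_def by measurable

text \<open>Doubling the argument drops the first binary digit, and division by 4 restores the
  base-4 places. No reduction modulo 1 enters, since \<open>bindigit\<close> reads parities on the
  whole line.\<close>

lemma cantor_step: "cantor x = bindigit 0 x / 4 + cantor (2 * x) / 4"
proof -
  have "bindigit (Suc n) x = bindigit n (2 * x)" for n
    by (simp add: bindigit_def mult.assoc mult.left_commute)
  then have "(\<Sum>n. bindigit (Suc n) x / 4 ^ Suc (Suc n)) = cantor (2 * x) / 4"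
    unfolding cantor_def using suminf_divide[OF bindigit_summable[of "2 * x"], of 4]
    by (simp add: field_simps)
  moreover have "cantor x = (\<Sum>n. bindigit (Suc n) x / 4 ^ Suc (Suc n)) + bindigit 0 x / 4"
    unfolding cantor_def using suminf_split_head[OF bindigit_summable[of x]] by simp
  ultimately show ?thesis by simp
qed

lemma cantor_periodic: "cantor (x - 1) = cantor x"
proof -
  have "bindigit n (x - 1) = bindigit n x" for n
  proof -
    have "2 ^ Suc n * (x - 1) = 2 ^ Suc n * x - of_int (2 ^ Suc n)" by (simp add: algebra_simps)
    then have "\<lfloor>2 ^ Suc n * (x - 1)\<rfloor> = \<lfloor>2 ^ Suc n * x\<rfloor> - 2 ^ Suc n"
      by (metis floor_diff_of_int)
    then show ?thesis by (simp add: bindigit_def mod_diff_eq[symmetric])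
  qed
  then show ?thesis by (simp add: cantor_def)
qed

lemma cantor_lower_half: "0 \<le> x \<Longrightarrow> x < 1 / 2 \<Longrightarrow> cantor x = cantor (2 * x) / 4"
proof -
  assume "0 \<le> x" "x < 1 / 2"
  then have "\<lfloor>2 * x\<rfloor> = 0" by linarith
  then show ?thesis using cantor_step[of x] by (simp add: bindigit_def)
qed

lemma cantor_upper_half: "1 / 2 \<le> x \<Longrightarrow> x < 1 \<Longrightarrow> cantor x = 1 / 4 + cantor (2 * x - 1) / 4"
proof -
  assume "1 / 2 \<le> x" "x < 1"
  then have "\<lfloor>2 * x\<rfloor> = 1" by linarith
  then show ?thesis using cantor_step[of x] cantor_periodic[of "2 * x"] by (simp add: bindigit_def)
qed

text \<open>Points of one dyadic interval of level \<open>m\<close> share their first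
  \<open>m\<close> binary digits, so their images lie in one Cantor interval of level
  \<open>m\<close>, a copy of the hull [0, 1/3] shrunk by the factor \<open>4 ^ m\<close>.\<close>

lemma cantor_close: "\<lfloor>2 ^ m * x\<rfloor> = \<lfloor>2 ^ m * y\<rfloor> \<Longrightarrow> \<bar>cantor x - cantor y\<bar> \<le> 1 / (3 * 4 ^ m)"
proof (induction m arbitrary: x y)
  case 0
  have "\<bar>cantor x - cantor y\<bar> \<le> 1 / 3"
    using cantor_bounds[of x] cantor_bounds[of y] by linarith
  then show ?case by simp
next
  case (Suc m)
  \<comment> \<open>Integer division recovers the coarse floor from the fine one, so equal floors at
    level \<open>Suc m\<close> force equal leading digits.\<close>
  have fl: "\<lfloor>2 * t\<rfloor> = \<lfloor>2 ^ Suc m * t\<rfloor> div 2 ^ m" for t :: real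
    using floor_divide_real_eq_div[of "2 ^ m" "2 ^ Suc m * t"] by simp
  have "\<lfloor>2 * x\<rfloor> = \<lfloor>2 * y\<rfloor>" using fl[of x] fl[of y] Suc.prems by simp
  then have "bindigit 0 x = bindigit 0 y" by (simp add: bindigit_def)
  moreover have "\<bar>cantor (2 * x) - cantor (2 * y)\<bar> \<le> 1 / (3 * 4 ^ m)"
    using Suc.prems by (intro Suc.IH) (simp add: mult.assoc mult.left_commute)
  moreover have "cantor x - cantor y = (cantor (2 * x) - cantor (2 * y)) / 4"
    using cantor_step[of x] cantor_step[of y] \<open>bindigit 0 x = bindigit 0 y\<close> by simp
  then have "\<bar>cantor x - cantor y\<bar> = \<bar>cantor (2 * x) - cantor (2 * y)\<bar> / 4"
      by (simp only: abs_divide abs_numeral)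
  moreover have "1 / (3 * 4 ^ Suc m) = 1 / (3 * 4 ^ m) / (4::real)" by simp
  ultimately show ?case by (metis divide_right_mono zero_le_numeral)
qed

text \<open>At the first digit where x and y differ, the images fall on two sides of a gap of the
  Cantor set; gaps of level \<open>m\<close> have length \<open>2 / (3 * 4 ^ m)\<close> and those of
  earlier levels are longer. Both points are confined to one period because \<open>cantor\<close> is
  1-periodic while the floors are not.\<close>

lemma cantor_apart:
  "\<lfloor>2 ^ m * x\<rfloor> \<noteq> \<lfloor>2 ^ m * y\<rfloor> \<Longrightarrow> x \<in> {0..<1} \<Longrightarrow> y \<in> {0..<1} \<Longrightarrow>
    2 / (3 * 4 ^ m) \<le> \<bar>cantor x - cantor y\<bar>"
proof (induction m arbitrary: x y)
  case 0
  then have "\<lfloor>x\<rfloor> = 0" "\<lfloor>y\<rfloor> = 0" by (auto simp: floor_eq_iff)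
  then show ?case using 0 by simp
next
  case (Suc m)
  have one: "(1::real) \<le> 4 ^ m" by simp
  have quarter: "2 / (3 * 4 ^ Suc m) = 2 / (3 * 4 ^ m) / (4::real)" by simp
  \<comment> \<open>The lower half is mapped below (1/3)/4 = 1/12 and the upper half above 1/4; the
    gap 1/6 between them is exactly the bound at level 1.\<close>
  have mixed: "2 / (3 * 4 ^ Suc m) \<le> \<bar>cantor u - cantor v\<bar>"
    if "0 \<le> u" "u < 1 / 2" "1 / 2 \<le> v" "v < 1" for u v
  proof -
    have "cantor u \<le> 1 / 12" using cantor_lower_half[of u] cantor_bounds[of "2 * u"] that by simp
    moreover have "1 / 4 \<le> cantor v" using cantor_upper_half[of v] cantor_bounds[of "2 * v
        - 1"] that by simp
    moreover have "2 / (3 * 4 ^ Suc m) \<le> (1 / 6 :: real)" using one by (simp add: field_simps)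
    ultimately show ?thesis by linarith
  qed
  have lower: "\<lfloor>2 ^ m * (2 * t)\<rfloor> = \<lfloor>2 ^ Suc m * t\<rfloor>" for t :: real
    by (simp add: mult.assoc mult.left_commute)
  have upper: "\<lfloor>2 ^ m * (2 * t - 1)\<rfloor> = \<lfloor>2 ^ Suc m * t\<rfloor> - 2 ^ m" for t :: real
  proof -
    have "2 ^ m * (2 * t - 1) = 2 ^ Suc m * t - of_int (2 ^ m)" by (simp add: algebra_simps)
    then show ?thesis by (metis floor_diff_of_int)
  qed
  consider "x < 1 / 2" "y < 1 / 2" | "1 / 2 \<le> x" "1 / 2 \<le> y"
    | "x < 1 / 2" "1 / 2 \<le> y" | "1 / 2 \<le> x" "y < 1 / 2" by linarith
  then show ?case
  proof cases
    case 1
    then have "2 / (3 * 4 ^ m) \<le> \<bar>cantor (2 * x) - cantor (2 * y)\<bar>"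
      using Suc.prems by (intro Suc.IH) (auto simp: lower)
    moreover have "cantor x - cantor y = (cantor (2 * x) - cantor (2 * y)) / 4"
      using 1 Suc.prems cantor_lower_half[of x] cantor_lower_half[of y] by auto
    then have "\<bar>cantor x - cantor y\<bar> = \<bar>cantor (2 * x) - cantor (2 * y)\<bar> / 4"
        by (simp only: abs_divide abs_numeral)
    ultimately show ?thesis using quarter by (metis divide_right_mono zero_le_numeral)
  next
    case 2
    then have "2 / (3 * 4 ^ m) \<le> \<bar>cantor (2 * x - 1) - cantor (2 * y - 1)\<bar>"
      using Suc.prems by (intro Suc.IH) (auto simp: upper)
    moreover have "cantor x - cantor y = (cantor (2 * x - 1) - cantor (2 * y - 1)) / 4"
      using 2 Suc.prems cantor_upper_half[of x] cantor_upper_half[of y] by auto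
    then have "\<bar>cantor x - cantor y\<bar> = \<bar>cantor (2 * x - 1) - cantor (2 * y - 1)\<bar> / 4"
        by (simp only: abs_divide abs_numeral)
    ultimately show ?thesis using quarter by (metis divide_right_mono zero_le_numeral)
  next
    case 3
    then show ?thesis using mixed[of x y] Suc.prems by auto
  next
    case 4
    then show ?thesis using mixed[of y x] Suc.prems by (auto simp: abs_minus_commute)
  qed
qed

text \<open>Kept as a measure on the whole line, so that measurability is plain Borel measurability.
  The half-open interval fits both the dyadic intervals cut out by \<open>floor\<close> and the
  representatives of the circle R/Z.\<close>

definition unit_leb :: "real measure" where
  "unit_leb = density lborel (indicator {0..<1})"

lemma space_unit_leb [simp]: "space unit_leb = UNIV"
  and sets_unit_leb [simp, measurable_cong]: "sets unit_leb = sets borel"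
  by (simp_all add: unit_leb_def)

lemma emeasure_unit_leb:
  "A \<in> sets borel \<Longrightarrow> emeasure unit_leb A = emeasure lborel (A \<inter> {0..<1})"
  by (simp add: unit_leb_def emeasure_density indicator_inter_arith[symmetric] Int_commute)

interpretation unit_leb: finite_measure unit_leb
  by standard (simp add: emeasure_unit_leb)

lemma integral_unit_leb:
  fixes f :: "real \<Rightarrow> 'b :: {banach, second_countable_topology}"
  assumes [measurable]: "f \<in> borel_measurable borel"
  shows "(\<integral>x. f x \<partial>unit_leb) = (\<integral>x. indicator {0..<1} x *\<^sub>R f x \<partial>lborel)"
proof -
  have "unit_leb = density lborel (\<lambda>x. ennreal (indicator {0..<1} x))"
    by (simp add: unit_leb_def ennreal_indicator)
  then have "(\<integral>x. f x \<partial>unit_leb) = (\<integral>x. f x \<partial>density lborel (\<lambda>x. ennreal (indicator {0..<1} x)))"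
    by simp
  also have "\<dots> = (\<integral>x. indicator {0..<1} x *\<^sub>R f x \<partial>lborel)"
    by (rule integral_density) auto
  finally show ?thesis .
qed

lemma AE_unit_leb: "AE x in unit_leb. x \<in> {0..<1}"
  unfolding unit_leb_def by (subst AE_density) (auto simp: indicator_def)

lemma measure_unit_leb_UNIV: "measure unit_leb UNIV = 1"
  by (simp add: measure_def emeasure_unit_leb)

lemma integrable_unit_leb_bounded:
  fixes f :: "real \<Rightarrow> 'b :: {banach, second_countable_topology}"
  assumes "f \<in> borel_measurable borel" "\<And>x. norm (f x) \<le> B"
  shows "integrable unit_leb f"
  using assms by (intro unit_leb.integrable_const_bound[where B = B]) auto

section \<open>Masses of dyadic intervals and of arcs\<close>

lemma measure_dyadic:
  assumes "x \<in> {0..<1}"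
  shows "measure unit_leb {y::real. \<lfloor>2 ^ m * y\<rfloor> = \<lfloor>2 ^ m * (x::real)\<rfloor>} = 1 / 2 ^ m"
proof -
  let ?j = "\<lfloor>2 ^ m * x\<rfloor>"
  have j0: "0 \<le> ?j" using assms by auto
  have "2 ^ m * x < 2 ^ m" using assms by simp
  then have "?j < 2 ^ m" by (simp add: floor_less_iff)
  then have j1: "?j + 1 \<le> 2 ^ m" by simp
  have j1': "real_of_int ?j + 1 \<le> 2 ^ m"
  proof -
    have "real_of_int (?j + 1) \<le> real_of_int (2 ^ m)" using j1 by (simp only: of_int_le_iff)
    then show ?thesis by simp
  qed
  have eq: "{y::real. \<lfloor>2 ^ m * y\<rfloor> = ?j} \<inter> {0..<1}
      = {real_of_int ?j / 2 ^ m..<(real_of_int ?j + 1) / 2 ^ m}"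
  proof (intro Set.set_eqI iffI)
    fix y :: real assume "y \<in> {of_int ?j / 2 ^ m..<(of_int ?j + 1) / 2 ^ m}"
    then have y: "of_int ?j \<le> 2 ^ m * y" "2 ^ m * y < of_int ?j + 1"
      by (simp_all add: pos_divide_le_eq pos_less_divide_eq mult.commute)
    have "2 ^ m * 0 \<le> 2 ^ m * y" using y j0 by linarith
    moreover have "2 ^ m * y < 2 ^ m * 1" using y j1' by linarith
    ultimately have "0 \<le> y" "y < 1" by (simp_all only: mult_less_cancel_left_pos
        mult_le_cancel_left_pos zero_less_power zero_less_numeral)
    moreover have "\<lfloor>2 ^ m * y\<rfloor> = ?j" using y by (intro floor_unique)
    ultimately show "y \<in> {y. \<lfloor>2 ^ m * y\<rfloor> = ?j} \<inter> {0..<1}" by simp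
  next
    fix y :: real assume "y \<in> {y. \<lfloor>2 ^ m * y\<rfloor> = ?j} \<inter> {0..<1}"
    then have "\<lfloor>2 ^ m * y\<rfloor> = ?j" by simp
    then have "of_int ?j \<le> 2 ^ m * y" "2 ^ m * y < of_int ?j + 1" by linarith+
    then show "y \<in> {of_int ?j / 2 ^ m..<(of_int ?j + 1) / 2 ^ m}"
      by (simp add: pos_divide_le_eq pos_less_divide_eq mult.commute)
  qed
  have "{y::real. \<lfloor>2 ^ m * y\<rfloor> = ?j} \<in> sets borel" by measurable
  then show ?thesis
    by (simp add: measure_def emeasure_unit_leb eq diff_divide_distrib[symmetric] divide_right_mono)
qed

text \<open>The lift to the line of an open arc of R/Z; being 1-periodic in both arguments, it can
  be tested on any representative.\<close>

definition circ_arc :: "real \<Rightarrow> real \<Rightarrow> real set" where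
  "circ_arc t r = {s. \<exists>k::int. \<bar>s - t - of_int k\<bar> < r}"

lemma circ_arc_measurable [measurable]: "circ_arc t r \<in> sets borel"
proof -
  have "circ_arc t r = (\<Union>k::int. ball (t + of_int k) r)"
    by (auto simp: circ_arc_def dist_real_def abs_minus_commute algebra_simps)
  then show ?thesis by auto
qed

lemma cantor_arc_measurable [measurable]: "{x. cantor x \<in> circ_arc t r} \<in> sets borel"
  by measurable

text \<open>Selects the level at which Cantor intervals have the size of r: the left bound is the
  diameter in \<open>cantor_close\<close> at level \<open>Suc m\<close>, the right bound is half the
  gap in \<open>cantor_apart\<close> at level \<open>m\<close>.\<close>

lemma scale_exists:
  assumes "0 < (r::real)" "r \<le> 1 / 3"
  obtains m where "1 / (3 * 4 ^ Suc m) < r" "r \<le> 1 / (3 * 4 ^ m)"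
proof -
  obtain n where "1 / (3 * r) < 4 ^ n" using real_arch_pow[of 4 "1 / (3 * r)"] by auto
  then have n: "1 / (3 * 4 ^ n) < r" using assms by (simp add: field_simps)
  define k where "k = (LEAST k. 1 / (3 * 4 ^ k) < r)"
  have k: "1 / (3 * 4 ^ k) < r" unfolding k_def using n by (rule LeastI)
  then have "k \<noteq> 0" using assms by (intro notI) simp
  then obtain m where m: "k = Suc m" using not0_implies_Suc by blast
  have "\<not> 1 / (3 * 4 ^ m) < r" using not_less_Least[of m "\<lambda>k. 1 / (3 * 4 ^ k) < r"] m
    unfolding k_def by simp
  then show ?thesis using that[of m] k m by simp
qed

lemma sqrt_four_power: "sqrt (4 ^ m) = 2 ^ m"
  by (simp add: real_sqrt_power)

text \<open>Two image points in the arc are less than 2r apart, hence not separated by a gap of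
  level \<open>m\<close>, so all parameters hitting the arc lie in a single dyadic interval of mass
  \<open>1 / 2 ^ m\<close>, which is at most 2 * sqrt 3 * sqrt r.\<close>

lemma cantor_arc_upper:
  assumes "0 < r" "r \<le> 1 / 3"
  shows "measure unit_leb {x. cantor x \<in> circ_arc t r} \<le> 4 * sqrt r"
proof -
  obtain m where m: "1 / (3 * 4 ^ Suc m) < r" "r \<le> 1 / (3 * 4 ^ m)"
    using scale_exists[OF assms] .
  have "1 / 4 ^ Suc m < 3 * r" using m(1) by (simp add: field_simps)
  then have "sqrt (1 / 4 ^ Suc m) < sqrt (3 * r)" by simp
  then have lt: "1 / 2 ^ Suc m < sqrt 3 * sqrt r"
    by (simp add: real_sqrt_divide real_sqrt_mult sqrt_four_power)
  have "sqrt 3 \<le> 2" by (simp add: real_le_lsqrt)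
  have s: "1 / 2 ^ m \<le> 4 * sqrt r"
  proof -
    have "1 / 2 ^ Suc m \<le> 2 * sqrt r"
      using mult_right_mono[of "sqrt 3" 2 "sqrt r"] assms
        \<open>sqrt 3 \<le> 2\<close> lt real_sqrt_ge_zero[of r] by linarith
    then show ?thesis by simp
  qed
  show ?thesis
  proof (cases "\<exists>x\<in>{0..<1}. cantor x \<in> circ_arc t r")
    case True
    then obtain x where x: "x \<in> {0..<1}" "cantor x \<in> circ_arc t r" by blast
    have "y \<in> {y. \<lfloor>2 ^ m * y\<rfloor> = \<lfloor>2 ^ m * x\<rfloor>}" if y: "cantor y \<in> circ_arc t r" "y \<in> {0..<1}" for y
    proof -
      obtain k1 k2 :: int where k: "\<bar>cantor x - t - k1\<bar> < r" "\<bar>cantor y - t - k2\<bar> < r"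
        using x y by (auto simp: circ_arc_def)
      \<comment> \<open>The image of \<open>cantor\<close> lies in [0, 1/3], so the two shifts
        differ by less than 1/3 + 2r, which is at most 1: the arc cannot catch image points through
        two different windings.\<close>
      have "\<bar>real_of_int (k1 - k2)\<bar> < 1"
        using k assms cantor_bounds[of x] cantor_bounds[of y] by simp
      then have "k1 = k2" by linarith
      then have "\<bar>cantor y - cantor x\<bar> < 2 * r" using k by linarith
      also have "\<dots> \<le> 2 / (3 * 4 ^ m)" using m by simp
      finally show ?thesis using cantor_apart[of m y x] x y by fastforce
    qed
    then have "AE y in unit_leb. y \<in> {x. cantor x \<in> circ_arc t r} \<longrightarrow> y \<in> {y. \<lfloor>2 ^ m * y\<rfloor> = \<lfloor>2 ^ m * x\<rfloor>}"
      using AE_unit_leb by auto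
    then have "measure unit_leb {x. cantor x \<in> circ_arc t r}
      \<le> measure unit_leb {y. \<lfloor>2 ^ m * y\<rfloor> = \<lfloor>2 ^ m * x\<rfloor>}"
      by (rule unit_leb.finite_measure_mono_AE) measurable
    then show ?thesis using measure_dyadic[OF x(1), of m] s by simp
  next
    case False
    then have "AE y in unit_leb. y \<in> {x. cantor x \<in> circ_arc t r} \<longrightarrow> y \<in> {}"
      using AE_unit_leb by auto
    then have "measure unit_leb {x. cantor x \<in> circ_arc t r} \<le> measure unit_leb {}"
      by (rule unit_leb.finite_measure_mono_AE) simp
    also have "\<dots> \<le> 4 * sqrt r" using assms by simp
    finally show ?thesis .
  qed
qed

text \<open>The whole dyadic interval of level \<open>Suc m\<close> around x is mapped into the arc,
  because its image has diameter below r.\<close>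

lemma cantor_arc_lower:
  assumes "0 < r" "r \<le> 1 / 3" "x \<in> {0..<1}"
  shows "sqrt r / 2 \<le> measure unit_leb {y. cantor y \<in> circ_arc (cantor x) r}"
proof -
  obtain m where m: "1 / (3 * 4 ^ Suc m) < r" "r \<le> 1 / (3 * 4 ^ m)"
    using scale_exists[OF assms(1,2)] .
  have "r \<le> 1 / 4 ^ m" using m(2) assms by (simp add: field_simps)
  then have "sqrt r \<le> sqrt (1 / 4 ^ m)" by simp
  then have "sqrt r / 2 \<le> 1 / 2 ^ Suc m" by (simp add: real_sqrt_divide sqrt_four_power)
  also have "\<dots> = measure unit_leb {y::real. \<lfloor>2 ^ Suc m * y\<rfloor> = \<lfloor>2 ^ Suc m * x\<rfloor>}"
    using measure_dyadic[OF assms(3), of "Suc m"] by simp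
  also have "\<dots> \<le> measure unit_leb {y. cantor y \<in> circ_arc (cantor x) r}"
  proof (rule unit_leb.finite_measure_mono)
    show "{y::real. \<lfloor>2 ^ Suc m * y\<rfloor> = \<lfloor>2 ^ Suc m * x\<rfloor>} \<subseteq> {y. cantor y \<in> circ_arc (cantor x) r}"
    proof safe
      fix y :: real assume "\<lfloor>2 ^ Suc m * y\<rfloor> = \<lfloor>2 ^ Suc m * x\<rfloor>"
      then have "\<bar>cantor y - cantor x\<bar> < r" using cantor_close[of "Suc m" y x] m(1) by linarith
      then show "cantor y \<in> circ_arc (cantor x) r" unfolding circ_arc_def by (auto intro: exI[of _ 0])
    qed
  qed simp
  finally show ?thesis .
qed

section \<open>The transform of \<nu> and its cosine product\<close>

definition cantor_ft :: "real \<Rightarrow> complex" where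
  "cantor_ft \<xi> = (\<integral>x. cis (2 * pi * \<xi> * cantor x) \<partial>unit_leb)"

lemma integral_unit_leb_halves:
  fixes h :: "real \<Rightarrow> complex"
  assumes [measurable]: "h \<in> borel_measurable borel" and b: "\<And>x. norm (h x) \<le> B"
  shows "(\<integral>x. h x \<partial>unit_leb)
    = ((\<integral>x. h (x / 2) \<partial>unit_leb) + (\<integral>x. h ((x + 1) / 2) \<partial>unit_leb)) / 2"
proof -
  let ?h1 = "\<lambda>x. indicator {0..<1/2} x *\<^sub>R h x" and ?h2 = "\<lambda>x. indicator {1/2..<1} x *\<^sub>R h x"
  have int: "integrable lborel (\<lambda>x. indicator {a..<b} x *\<^sub>R h x)" for a b :: real
    using b by (intro integrableI_bounded_set_indicator[where B
        = B]) (use emeasure_bounded_finite[of "{a..<b}"] in auto)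
  have "(\<integral>x. h x \<partial>unit_leb) = (\<integral>x. ?h1 x + ?h2 x \<partial>lborel)"
    by (subst integral_unit_leb, simp) (rule Bochner_Integration.integral_cong, auto simp: indicator_def)
  also have "\<dots> = (\<integral>x. ?h1 x \<partial>lborel) + (\<integral>x. ?h2 x \<partial>lborel)"
    using int by (intro Bochner_Integration.integral_add)
  also have "(\<integral>x. ?h1 x \<partial>lborel) = (\<integral>x. h (x / 2) \<partial>unit_leb) / 2"
    by (subst lborel_integral_real_affine[of "1/2" _ 0], simp, subst integral_unit_leb, simp)
      (simp add: scaleR_conv_of_real, rule Bochner_Integration.integral_cong, auto simp: indicator_def)
  also have "(\<integral>x. ?h2 x \<partial>lborel) = (\<integral>x. h ((x + 1) / 2) \<partial>unit_leb) / 2"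
    by (subst lborel_integral_real_affine[of "1/2" _ "1/2"], simp, subst integral_unit_leb, simp)
      (simp add: scaleR_conv_of_real, rule Bochner_Integration.integral_cong, auto simp:
          indicator_def field_simps)
  finally show ?thesis by (simp add: add_divide_distrib)
qed

text \<open>The two halves of the unit interval carry the two similarities y/4 and y/4 + 1/4 of the
  Cantor set; the translation by 1/4 contributes the phase \<pi>\<xi>/2.\<close>

lemma cantor_ft_rec: "cantor_ft \<xi> = (1 + cis (pi * \<xi> / 2)) / 2 * cantor_ft (\<xi> / 4)"
proof -
  let ?h = "\<lambda>x. cis (2 * pi * \<xi> * cantor x)"
  have meas: "?h \<in> borel_measurable borel" by (simp add: cis_conv_exp)
  have i1: "(\<integral>x. ?h (x / 2) \<partial>unit_leb) = cantor_ft (\<xi> / 4)" unfolding cantor_ft_def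
  proof (rule integral_cong_AE)
    show "AE x in unit_leb. ?h (x / 2) = cis (2 * pi * (\<xi> / 4) * cantor x)"
      using AE_unit_leb by eventually_elim (auto simp: cantor_lower_half mult_ac)
  qed (simp_all add: cis_conv_exp)
  have "(\<integral>x. ?h ((x + 1) / 2) \<partial>unit_leb)
      = (\<integral>x. cis (pi * \<xi> / 2) * cis (2 * pi * (\<xi> / 4) * cantor x) \<partial>unit_leb)"
  proof (rule integral_cong_AE)
    show "AE x in unit_leb. ?h ((x + 1) / 2)
        = cis (pi * \<xi> / 2) * cis (2 * pi * (\<xi> / 4) * cantor x)"
      using AE_unit_leb
      by eventually_elim (auto simp: cantor_upper_half cis_mult algebra_simps add_divide_distrib)
  qed (simp_all add: cis_conv_exp)
  then have i2: "(\<integral>x. ?h ((x + 1) / 2) \<partial>unit_leb) = cis (pi * \<xi> / 2) * cantor_ft (\<xi> / 4)"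
    by (simp add: cantor_ft_def)
  show ?thesis
    using integral_unit_leb_halves[of ?h 1, OF meas] i1 i2 by (simp add: cantor_ft_def algebra_simps)
qed

definition cosprod :: "nat \<Rightarrow> real \<Rightarrow> real" where
  "cosprod m \<xi> = (\<Prod>j<m. (cos (pi * \<xi> / 4 ^ Suc j))\<^sup>2)"

lemma cmod_one_plus_cis: "(cmod (1 + cis \<theta>))\<^sup>2 = 4 * (cos (\<theta> / 2))\<^sup>2"
proof -
  have "(cmod (1 + cis \<theta>))\<^sup>2 = (1 + cos \<theta>)\<^sup>2 + (sin \<theta>)\<^sup>2" by (simp add: cmod_power2)
  also have "\<dots> = 2 + 2 * cos \<theta>" using sin_cos_squared_add[of \<theta>]
      by (simp add: power2_eq_square algebra_simps)
  also have "\<dots> = 4 * (cos (\<theta> / 2))\<^sup>2" using cos_double_cos[of "\<theta> / 2"] by simp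
  finally show ?thesis .
qed

lemma cantor_ft_norm_rec: "(cmod (cantor_ft \<xi>))\<^sup>2 = (cos (pi * \<xi> / 4))\<^sup>2 * (cmod (cantor_ft (\<xi> / 4)))\<^sup>2"
  by (subst cantor_ft_rec) (simp add: norm_mult norm_divide power_mult_distrib power_divide
      cmod_one_plus_cis)

lemma cantor_ft_norm_product: "(cmod (cantor_ft \<xi>))\<^sup>2 = cosprod m \<xi> * (cmod (cantor_ft (\<xi> / 4 ^ m)))\<^sup>2"
proof (induction m)
  case (Suc m)
  then show ?case using cantor_ft_norm_rec[of "\<xi> / 4 ^ m"] by (simp add: cosprod_def mult_ac)
qed (simp add: cosprod_def)

lemma cosprod_nonneg: "0 \<le> cosprod m \<xi>"
  by (simp add: cosprod_def prod_nonneg)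

lemma cos_sq_periodic: "(cos (\<theta> + pi * real n))\<^sup>2 = (cos \<theta>)\<^sup>2"
  by (induction n) (auto simp: algebra_simps cos_add sin_add)

text \<open>The square of the cosine has period \<pi>, so the factor of index j has period
  \<open>4 ^ Suc j\<close>, which divides \<open>4 ^ m\<close> for j < m.\<close>

lemma cosprod_periodic: "cosprod m (\<xi> + 4 ^ m * real n) = cosprod m \<xi>"
  unfolding cosprod_def
proof (rule prod.cong[OF refl])
  fix j assume "j \<in> {..<m}"
  then have "Suc j + (m - Suc j) = m" by simp
  then have "(4::real) ^ m = 4 ^ Suc j * 4 ^ (m - Suc j)" by (metis power_add)
  then have "pi * (\<xi> + 4 ^ m * real n) / 4 ^ Suc j
      = pi * \<xi> / 4 ^ Suc j + pi * real (4 ^ (m - Suc j) * n)"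
    by (simp add: field_simps)
  then show "(cos (pi * (\<xi> + 4 ^ m * real n) / 4 ^ Suc j))\<^sup>2 = (cos (pi * \<xi> / 4 ^ Suc j))\<^sup>2"
    using cos_sq_periodic by presburger
qed

text \<open>The four angles pair off at distance \<pi>/2, and each pair contributes cos^2 + sin^2 =
  1.\<close>

lemma sum_four_cos_sq: "(\<Sum>t<4::nat. (cos (\<theta> + pi * real t / 4))\<^sup>2) = 2"
proof -
  have "(cos (\<theta> + pi / 4))\<^sup>2 + (cos (\<theta> + pi * 3 / 4))\<^sup>2 = 1"
  proof -
    have "\<theta> + pi * 3 / 4 = (\<theta> + pi / 4) + pi / 2" by (simp add: field_simps)
    then have "cos (\<theta> + pi * 3 / 4) = - sin (\<theta> + pi / 4)" by (simp only: cos_add) simp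
    then show ?thesis by simp
  qed
  moreover have "(cos \<theta>)\<^sup>2 + (cos (\<theta> + pi * 2 / 4))\<^sup>2 = 1" by (simp add: cos_add)
  ultimately show ?thesis by (simp add: eval_nat_numeral)
qed

text \<open>This is Parseval for \<open>2 ^ m\<close> atoms of mass \<open>1 / 2 ^ m\<close> at
  multiples of \<open>1 / 4 ^ m\<close>. The induction cuts the range into four blocks of length
  \<open>4 ^ m\<close>: the earlier factors repeat from block to block, while the new one runs
  through four equally spaced angles and sums to 2.\<close>

lemma sum_cosprod: "(\<Sum>h<4 ^ m. cosprod m (real h)) = 2 ^ m"
proof (induction m)
  case 0 then show ?case by (simp add: cosprod_def)
next
  case (Suc m)
  have "(\<Sum>h<4 ^ Suc m. cosprod (Suc m) (real h)) = (\<Sum>h<4 * 4 ^ m. cosprod (Suc m) (real h))" by simp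
  also have "\<dots> = (\<Sum>t<4. \<Sum>h<4 ^ m. cosprod (Suc m) (real (h + t * 4 ^ m)))"
    by (subst sum.nat_group[symmetric]) (auto simp: sum.atLeastLessThan_shift_0[of _ "_ * _"]
        lessThan_atLeast0 add.commute)
  also have "\<dots> = (\<Sum>t<4. \<Sum>h<4 ^ m. cosprod m (real h) * (cos (pi * real h / 4 ^ Suc m + pi
      * real t / 4))\<^sup>2)"
  proof (intro sum.cong refl)
    fix t h :: nat
    have "real (h + t * 4 ^ m) = real h + 4 ^ m * real t" by simp
    moreover have "pi * (real h + 4 ^ m * real t) / 4 ^ Suc m
        = pi * real h / 4 ^ Suc m + pi * real t / 4"
      by (simp add: field_simps)
    ultimately show "cosprod (Suc m) (real (h + t * 4 ^ m))
        = cosprod m (real h) * (cos (pi * real h / 4 ^ Suc m + pi * real t / 4))\<^sup>2"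
      using cosprod_periodic[of m "real h" t] unfolding cosprod_def by (simp only: prod.lessThan_Suc)
  qed
  also have "\<dots> = (\<Sum>h<4 ^ m. cosprod m (real h) * (\<Sum>t<4::nat. (cos (pi * real h / 4 ^ Suc m + pi
      * real t / 4))\<^sup>2))"
    by (subst sum.swap) (simp add: sum_distrib_left)
  also have "\<dots> = 2 ^ Suc m" by (simp only: sum_four_cos_sq sum_distrib_right[symmetric] Suc.IH) simp
  finally show ?case .
qed

lemma cantor_ft_norm_le: "cmod (cantor_ft \<xi>) \<le> 1"
proof -
  have "cmod (cantor_ft \<xi>) \<le> (\<integral>x. cmod (cis (2 * pi * \<xi> * cantor x)) \<partial>unit_leb)"
    unfolding cantor_ft_def by (rule integral_norm_bound)
  then show ?thesis by (simp add: measure_unit_leb_UNIV)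
qed

lemma cantor_ft_cnj: "cantor_ft (- \<xi>) = cnj (cantor_ft \<xi>)"
proof -
  have "cnj (cantor_ft \<xi>) = (\<integral>x. cnj (cis (2 * pi * \<xi> * cantor x)) \<partial>unit_leb)"
    unfolding cantor_ft_def by simp
  then show ?thesis by (simp add: cantor_ft_def cis_cnj)
qed

lemma cantor_ft_minus: "cmod (cantor_ft (- \<xi>)) = cmod (cantor_ft \<xi>)"
  by (simp add: cantor_ft_cnj)

text \<open>The values of \<open>cantor\<close> lie within \<open>1/6\<close> of \<open>1/6\<close>, so the phases stay within \<open>\<pi>/3\<close> of their mean.\<close>

lemma cantor_ft_lower:
  assumes "\<bar>\<xi>\<bar> \<le> 1"
  shows "1 / 4 \<le> (cmod (cantor_ft \<xi>))\<^sup>2"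
proof -
  let ?u = "cis (- (2 * pi * \<xi> * (1 / 6)))"
  have meas: "(\<lambda>x. cis (2 * pi * \<xi> * (cantor x - 1 / 6))) \<in> borel_measurable borel"
    by (simp add: cis_conv_exp)
  have int: "integrable unit_leb (\<lambda>x. cis (2 * pi * \<xi> * (cantor x - 1 / 6)))"
    using meas by (rule integrable_unit_leb_bounded[where B = 1]) simp
  have "?u * cantor_ft \<xi> = (\<integral>x. ?u * cis (2 * pi * \<xi> * cantor x) \<partial>unit_leb)"
    by (simp add: cantor_ft_def)
  also have "\<dots> = (\<integral>x. cis (2 * pi * \<xi> * (cantor x - 1 / 6)) \<partial>unit_leb)"
    by (simp add: cis_mult algebra_simps)
  finally have "Re (?u * cantor_ft \<xi>) = (\<integral>x. cos (2 * pi * \<xi> * (cantor x - 1 / 6)) \<partial>unit_leb)"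
    using int by (simp add: integral_Re[symmetric])
  moreover have "(\<integral>x. 1 / 2 \<partial>unit_leb) \<le> (\<integral>x. cos (2 * pi * \<xi> * (cantor x - 1 / 6)) \<partial>unit_leb)"
  proof (rule integral_mono)
    show "integrable unit_leb (\<lambda>x. cos (2 * pi * \<xi> * (cantor x - 1 / 6)))"
      by (rule integrable_unit_leb_bounded[where B = 1]) auto
    fix x
    have "\<bar>cantor x - 1 / 6\<bar> \<le> 1 / 6" using cantor_bounds[of x] by linarith
    then have "\<bar>\<xi>\<bar> * \<bar>cantor x - 1 / 6\<bar> \<le> 1 * (1 / 6)" using assms by (intro mult_mono) auto
    then have "\<bar>2 * pi * \<xi> * (cantor x - 1 / 6)\<bar> \<le> pi / 3"
      by (simp add: abs_mult mult.assoc)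
    then have "cos (pi / 3) \<le> cos \<bar>2 * pi * \<xi> * (cantor x - 1 / 6)\<bar>"
      by (intro cos_monotone_0_pi_le) auto
    then show "1 / 2 \<le> cos (2 * pi * \<xi> * (cantor x - 1 / 6))" by (simp add: cos_60)
  qed simp
  ultimately have "1 / 2 \<le> Re (?u * cantor_ft \<xi>)" by (simp add: measure_unit_leb_UNIV)
  also have "\<dots> \<le> cmod (?u * cantor_ft \<xi>)" by (rule complex_Re_le_cmod)
  finally have "1 / 2 \<le> cmod (cantor_ft \<xi>)" by (simp add: norm_mult)
  then have "(1 / 2)\<^sup>2 \<le> (cmod (cantor_ft \<xi>))\<^sup>2" by (intro power_mono) auto
  then show ?thesis by (simp add: power2_eq_square)
qed

section \<open>Growth of the partial sums of the squared transform\<close>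

definition ft_energy :: "nat \<Rightarrow> real" where
  "ft_energy K = (\<Sum>k\<in>{- int K..int K}. (cmod (cantor_ft (of_int k)))\<^sup>2)"

lemma ft_energy_Suc: "ft_energy (Suc K) = ft_energy K + 2 * (cmod (cantor_ft (real (Suc K))))\<^sup>2"
proof -
  have "{- int (Suc K)..int (Suc K)} = insert (int (Suc K)) (insert (- int (Suc K)) {- int K..int K})"
    by (simp add: set_eq_iff, intro allI, linarith)
  then show ?thesis
    using cantor_ft_minus[of "real (Suc K)"] by (simp add: ft_energy_def)
qed

lemma ft_energy_add: "ft_energy (K + H) = ft_energy K + 2 * (\<Sum>h\<in>{1..H}. (cmod (cantor_ft (real (K
    + h))))\<^sup>2)"
  by (induction H) (simp_all add: ft_energy_Suc algebra_simps)

text \<open>For \<open>h < 4 ^ m\<close> the tail of the product is the squared transform at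
  \<open>h / 4 ^ m\<close>, a point of [0, 1], and so is at least 1/4; the remaining factors sum to
  \<open>2 ^ m\<close>.\<close>

lemma ft_energy_lower: "2 ^ m / 4 \<le> ft_energy (4 ^ m)"
proof -
  have "2 ^ m / 4 = (\<Sum>h<4 ^ m. cosprod m (real h) * (1 / 4))"
    by (simp only: sum_distrib_right[symmetric] sum_cosprod)
  also have "\<dots> \<le> (\<Sum>h<4 ^ m. (cmod (cantor_ft (real h)))\<^sup>2)"
  proof (rule sum_mono)
    fix h :: nat assume "h \<in> {..<4 ^ m}"
    then have "real h \<le> real (4 ^ m)" by (metis lessThan_iff less_imp_le of_nat_mono)
    then have "1 / 4 \<le> (cmod (cantor_ft (real h / 4 ^ m)))\<^sup>2" by (intro cantor_ft_lower) simp
    then show "cosprod m (real h) * (1 / 4) \<le> (cmod (cantor_ft (real h)))\<^sup>2"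
      unfolding cantor_ft_norm_product[of "real h" m] using cosprod_nonneg by (intro mult_left_mono)
  qed
  also have "\<dots> = (\<Sum>k\<in>int ` {..<4 ^ m}. (cmod (cantor_ft (of_int k)))\<^sup>2)"
    by (simp add: sum.reindex)
  also have "\<dots> \<le> ft_energy (4 ^ m)" unfolding ft_energy_def
  proof (rule sum_mono2)
    show "int ` {..<4 ^ m} \<subseteq> {- int (4 ^ m)..int (4 ^ m)}"
    proof
      fix k assume "k \<in> int ` {..<4 ^ m}"
      then obtain h where h: "k = int h" "h < 4 ^ m" by blast
      then have "int h < int (4 ^ m)" by (simp only: of_nat_less_iff)
      then show "k \<in> {- int (4 ^ m)..int (4 ^ m)}" unfolding h atLeastAtMost_iff by linarith
    qed
  qed auto
  finally show ?thesis .
qed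

text \<open>At \<open>2 * 4 ^ m\<close> the factor of index \<open>m + 1\<close> of the transform vanishes to second order,
  while the factors of smaller index are periodic.\<close>

lemma cantor_ft_small:
  assumes "real h \<le> d * 4 ^ m"
  shows "(cmod (cantor_ft (real (2 * 4 ^ m + h))))\<^sup>2 \<le> (pi * d / 4)\<^sup>2 * cosprod m (real h)"
proof -
  let ?\<xi> = "real (2 * 4 ^ m + h)"
  let ?\<theta> = "pi * real h / 4 ^ Suc m"
  have "?\<xi> = real h + 4 ^ m * real 2" by simp
  then have per: "cosprod m ?\<xi> = cosprod m (real h)" by (simp only: cosprod_periodic)
  have "pi * ?\<xi> / 4 ^ Suc m = ?\<theta> + pi / 2" by (simp add: field_simps)
  then have "cosprod (Suc m) ?\<xi> = cosprod m (real h) * (sin ?\<theta>)\<^sup>2"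
    using per by (simp add: cosprod_def cos_add)
  then have "(cmod (cantor_ft ?\<xi>))\<^sup>2 = cosprod m (real h) * (sin ?\<theta>)\<^sup>2
      * (cmod (cantor_ft (?\<xi> / 4 ^ Suc m)))\<^sup>2"
    using cantor_ft_norm_product[of ?\<xi> "Suc m"] by simp
  also have "\<dots> \<le> cosprod m (real h) * (sin ?\<theta>)\<^sup>2 * 1"
    using cantor_ft_norm_le cosprod_nonneg by (intro mult_left_mono power_le_one) auto
  also have "\<dots> \<le> cosprod m (real h) * (pi * d / 4)\<^sup>2 * 1"
  proof -
    have "(sin ?\<theta>)\<^sup>2 \<le> ?\<theta>\<^sup>2"
      using abs_sin_x_le_abs_x[of ?\<theta>] abs_le_square_iff by blast
    also have "\<dots> \<le> (pi * d / 4)\<^sup>2"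
      using assms by (intro power_mono) (auto simp: field_simps)
    finally show ?thesis using cosprod_nonneg by (intro mult_right_mono mult_left_mono) auto
  qed
  finally show ?thesis by (simp only: mult_1_right mult.commute)
qed

text \<open>All h up to \<open>4 ^ (m - r)\<close> satisfy the hypothesis of
  \<open>cantor_ft_small\<close> with \<delta> = \<open>1 / 4 ^ r\<close>. The sum of the periodic
  factors is then extended to a full period, which is generous but keeps the factor
  \<delta>^2.\<close>

lemma ft_energy_gap:
  assumes "r \<le> m"
  shows "ft_energy (2 * 4 ^ m + 4 ^ (m - r)) - ft_energy (2 * 4 ^ m)
      \<le> 2 * (pi / 4 ^ r / 4)\<^sup>2 * 2 ^ m + 2"
proof -
  let ?H = "4 ^ (m - r) :: nat"
  have four: "(4::real) ^ m = 4 ^ r * 4 ^ (m - r)" using assms by (metis le_add_diff_inverse power_add)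
  have sub: "{1..<?H} \<subseteq> {..<4 ^ m}"
  proof
    fix x :: nat assume "x \<in> {1..<4 ^ (m - r)}"
    then have "x < 4 ^ (m - r)" by simp
    also have "(4::nat) ^ (m - r) \<le> 4 ^ m" by (rule power_increasing) auto
    finally show "x \<in> {..<4 ^ m}" by simp
  qed
  \<comment> \<open>The end point is split off and estimated by 1, because for \<open>r = 0\<close>
    it lies outside the period \<open>{..<4 ^ m}\<close>; doubled by the symmetry between k and -k,
    it becomes the summand 2 of the bound.\<close>
  have ins: "{1..?H} = insert ?H {1..<?H}" by auto
  have "(\<Sum>h\<in>{1..?H}. (cmod (cantor_ft (real (2 * 4 ^ m + h))))\<^sup>2)
     = (cmod (cantor_ft (real (2 * 4 ^ m + ?H))))\<^sup>2 + (\<Sum>h\<in>{1..<?H}. (cmod (cantor_ft (real (2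
         * 4 ^ m + h))))\<^sup>2)"
    unfolding ins by simp
  also have "\<dots> \<le> 1 + (\<Sum>h\<in>{1..<?H}. (pi * (1 / 4 ^ r) / 4)\<^sup>2 * cosprod m (real h))"
  proof (rule add_mono)
    show "(cmod (cantor_ft (real (2 * 4 ^ m + ?H))))\<^sup>2 \<le> 1"
      using cantor_ft_norm_le by (intro power_le_one) auto
    show "(\<Sum>h\<in>{1..<?H}. (cmod (cantor_ft (real (2 * 4 ^ m + h))))\<^sup>2)
        \<le> (\<Sum>h\<in>{1..<?H}. (pi * (1 / 4 ^ r) / 4)\<^sup>2 * cosprod m (real h))"
    proof (rule sum_mono)
      fix h assume "h \<in> {1..<?H}"
      then have "real h \<le> real ?H" by (meson atLeastLessThan_iff less_imp_le of_nat_mono)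
      then have "real h \<le> 1 / 4 ^ r * 4 ^ m" by (simp add: four)
      then show "(cmod (cantor_ft (real (2 * 4 ^ m + h))))\<^sup>2
          \<le> (pi * (1 / 4 ^ r) / 4)\<^sup>2 * cosprod m (real h)"
        by (rule cantor_ft_small)
    qed
  qed
  also have "(\<Sum>h\<in>{1..<?H}. (pi * (1 / 4 ^ r) / 4)\<^sup>2 * cosprod m (real h))
      \<le> (\<Sum>h<4 ^ m. (pi * (1 / 4 ^ r) / 4)\<^sup>2 * cosprod m (real h))"
    using sub cosprod_nonneg by (intro sum_mono2) auto
  also have "\<dots> = (pi / 4 ^ r / 4)\<^sup>2 * 2 ^ m"
    by (simp only: sum_distrib_left[symmetric] sum_cosprod) simp
  finally show ?thesis using ft_energy_add[of "2 * 4 ^ m" ?H] by simp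
qed

lemma sqrt_increment:
  assumes "0 \<le> (d::real)" "d \<le> 1"
  shows "d / 4 \<le> sqrt (2 + d) - sqrt 2"
proof -
  have "sqrt 2 \<le> 3 / 2" by (rule real_le_lsqrt) (simp_all add: power2_eq_square)
  then have "sqrt 2 * d \<le> 3 / 2 * d" using assms by (intro mult_right_mono) auto
  moreover have "d * d \<le> 1 * d" using assms by (intro mult_right_mono) auto
  moreover have "(sqrt 2 + d / 4)\<^sup>2 = 2 + (sqrt 2 * d) / 2 + (d * d) / 16"
    by (simp add: power2_eq_square algebra_simps)
  ultimately have "(sqrt 2 + d / 4)\<^sup>2 \<le> 2 + d" using assms by linarith
  then have "sqrt 2 + d / 4 \<le> sqrt (2 + d)" by (rule real_le_rsqrt)
  then show ?thesis by simp
qed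

lemma ft_energy_not_convergent: "\<not> (\<exists>L. (\<lambda>K. ft_energy K / sqrt (real K)) \<longlonglongrightarrow> L)"
proof
  assume "\<exists>L. (\<lambda>K. ft_energy K / sqrt (real K)) \<longlonglongrightarrow> L"
  then obtain L where L: "(\<lambda>K. ft_energy K / sqrt (real K)) \<longlonglongrightarrow> L" by blast
  have pow: "filterlim (\<lambda>m. 4 ^ m :: nat) sequentially sequentially"
    by (intro filterlim_subseq strict_monoI) auto
  have "(\<lambda>m. ft_energy (4 ^ m) / 2 ^ m) \<longlonglongrightarrow> L"
    using filterlim_compose[OF L pow] by (simp add: sqrt_four_power)
  moreover have "1 / 4 \<le> ft_energy (4 ^ m) / 2 ^ m" for m
    using ft_energy_lower[of m] by (simp add: field_simps)
  ultimately have L4: "1 / 4 \<le> L" by (intro LIMSEQ_le_const) auto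
  have scaled: "(\<lambda>m. ft_energy (a * 4 ^ m) / 2 ^ m) \<longlonglongrightarrow> L * sqrt (real a)" if "a > 0" for a :: nat
  proof -
    have "filterlim (\<lambda>m. a * 4 ^ m :: nat) sequentially sequentially"
      using that by (intro filterlim_subseq strict_monoI) auto
    then have "(\<lambda>m. ft_energy (a * 4 ^ m) / sqrt (real (a * 4 ^ m)) * sqrt (real a)) \<longlonglongrightarrow> L * sqrt (real a)"
      by (intro tendsto_mult tendsto_const filterlim_compose[OF L])
    then show ?thesis using that by (simp add: sqrt_four_power real_sqrt_mult)
  qed
  \<comment> \<open>The gap estimate is used at level \<open>m + r\<close> with \<delta> =
    \<open>1 / 4 ^ r\<close>. Divided by \<open>2 ^ (m + r)\<close>, it becomes L (sqrt (2 +
    \<delta>) - sqrt 2) \<le> \<pi>^2 \<delta>^2 / 8 in the limit over m. The left side is at least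
    L \<delta> / 4, so one factor \<delta> cancels and the bound still tends to 0 with r.\<close>
  have key: "L \<le> pi\<^sup>2 / 2 * (1 / 4) ^ r" for r
  proof -
    let ?\<delta> = "1 / 4 ^ r :: real"
    have "(\<lambda>m. ft_energy ((2 * 4 ^ r + 1) * 4 ^ m) / 2 ^ m / 2 ^ r) \<longlonglongrightarrow> L * sqrt (real (2 * 4 ^ r
        + 1)) / 2 ^ r"
      by (intro tendsto_divide scaled) auto
    moreover have "(\<lambda>m. ft_energy ((2 * 4 ^ r) * 4 ^ m) / 2 ^ m / 2 ^ r) \<longlonglongrightarrow> L * sqrt (real (2
        * 4 ^ r)) / 2 ^ r"
      by (intro tendsto_divide scaled) auto
    ultimately have lim: "(\<lambda>m. ft_energy ((2 * 4 ^ r + 1) * 4 ^ m) / 2 ^ m / 2 ^ r - ft_energy ((2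
        * 4 ^ r) * 4 ^ m) / 2 ^ m / 2 ^ r)
      \<longlonglongrightarrow> L * sqrt (real (2 * 4 ^ r + 1)) / 2 ^ r - L * sqrt (real (2 * 4 ^ r)) / 2 ^ r"
      by (rule tendsto_diff)
    have up: "(\<lambda>m. 2 * (pi * ?\<delta> / 4)\<^sup>2 + 2 / 2 ^ r * (1 / 2) ^ m) \<longlonglongrightarrow> 2 * (pi * ?\<delta> / 4)\<^sup>2 + 2 / 2 ^ r * 0"
      by (intro tendsto_intros LIMSEQ_power_zero) auto
    have le: "ft_energy ((2 * 4 ^ r + 1) * 4 ^ m) / 2 ^ m / 2 ^ r - ft_energy ((2 * 4 ^ r)
        * 4 ^ m) / 2 ^ m / 2 ^ r
        \<le> 2 * (pi * ?\<delta> / 4)\<^sup>2 + 2 / 2 ^ r * (1 / 2) ^ m" for m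
    proof -
      have e1: "(2 * 4 ^ r + 1) * 4 ^ m = 2 * 4 ^ (m + r) + (4::nat) ^ (m + r - r)"
        and e2: "(2 * 4 ^ r) * 4 ^ m = 2 * (4::nat) ^ (m + r)"
        by (simp_all add: power_add algebra_simps)
      have "(ft_energy ((2 * 4 ^ r + 1) * 4 ^ m) - ft_energy ((2 * 4 ^ r) * 4 ^ m)) / 2 ^ (m + r)
          \<le> (2 * (pi / 4 ^ r / 4)\<^sup>2 * 2 ^ (m + r) + 2) / 2 ^ (m + r)"
        unfolding e1 e2 by (intro divide_right_mono ft_energy_gap) auto
      then show ?thesis by (simp add: power_add diff_divide_distrib add_divide_distrib
          power_one_over mult.commute)
    qed
    have "L * sqrt (real (2 * 4 ^ r + 1)) / 2 ^ r - L * sqrt (real (2 * 4 ^ r)) / 2 ^ r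
        \<le> 2 * (pi * ?\<delta> / 4)\<^sup>2 + 2 / 2 ^ r * 0"
      by (rule LIMSEQ_le[OF lim up]) (use le in blast)
    moreover have "sqrt (real (2 * 4 ^ r + 1)) / 2 ^ r = sqrt (2 + ?\<delta>)"
      by (simp add: sqrt_four_power[symmetric] real_sqrt_divide[symmetric] add_divide_distrib)
    moreover have "sqrt (real (2 * 4 ^ r)) / 2 ^ r = sqrt 2"
      by (simp add: sqrt_four_power real_sqrt_mult)
    ultimately have lim_le: "L * (sqrt (2 + ?\<delta>) - sqrt 2) \<le> 2 * (pi * ?\<delta> / 4)\<^sup>2"
      by (simp add: right_diff_distrib times_divide_eq_right[symmetric] del: times_divide_eq_right)
    have "?\<delta> / 4 \<le> sqrt (2 + ?\<delta>) - sqrt 2" by (rule sqrt_increment) simp_all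
    then have "L * (?\<delta> / 4) \<le> L * (sqrt (2 + ?\<delta>) - sqrt 2)" using L4 by (intro mult_left_mono) auto
    with lim_le have "L * (?\<delta> / 4) \<le> (pi\<^sup>2 / 2 * ?\<delta>) * (?\<delta> / 4)"
      by (simp add: power2_eq_square algebra_simps)
    then have "L \<le> pi\<^sup>2 / 2 * ?\<delta>" by (rule mult_right_le_imp_le) simp
    then show ?thesis by (simp add: power_one_over)
  qed
  have "(\<lambda>r. pi\<^sup>2 / 2 * (1 / 4) ^ r) \<longlonglongrightarrow> pi\<^sup>2 / 2 * 0"
    by (intro tendsto_intros LIMSEQ_power_zero) auto
  then have "L \<le> pi\<^sup>2 / 2 * 0" by (rule LIMSEQ_le_const) (use key in blast)
  then show False using L4 by simp
qed

section \<open>Trigonometric functions and density in the square-integrable functions\<close>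

text \<open>The Hartley kernel: indexed by all integers, these functions form a real orthonormal basis on the
  circle without separate treatment of sines and cosines.\<close>

definition cas :: "int \<Rightarrow> real \<Rightarrow> real" where
  "cas k x = cos (2 * pi * of_int k * x) + sin (2 * pi * of_int k * x)"

lemma cas_zero [simp]: "cas 0 x = 1"
  by (simp add: cas_def)

lemma cas_bound: "\<bar>cas k x\<bar> \<le> 2"
  unfolding cas_def
  using abs_cos_le_one[of "2 * pi * of_int k * x"] abs_sin_le_one[of "2 * pi * of_int k * x"]
  by linarith

lemma cas_periodic: "cas k (x + of_int n) = cas k x"
proof -
  have "2 * pi * of_int k * (x + of_int n) = 2 * pi * of_int k * x + 2 * pi * of_int (k * n)"
    by (simp add: algebra_simps)
  then show ?thesis unfolding cas_def by
      (simp only: cos_add sin_add cos_int_2pin sin_int_2pin mult_1_right mult_zero_right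
      diff_0_right add_0_right)
qed

lemma cas_frac: "cas k (frac x) = cas k x"
  using cas_periodic[of k "frac x" "\<lfloor>x\<rfloor>"] by (simp add: frac_def)

text \<open>Differentiation only flips the sign of the index, so up to scalars the family is closed
  under derivatives; smoothness of the basis functions and their eigenvalues both follow from
  this.\<close>

lemma cas_has_derivative [derivative_intros]:
  "((\<lambda>t. cas k t) has_real_derivative 2 * pi * of_int k * cas (- k) x) (at x)"
  unfolding cas_def[abs_def] by (auto intro!: derivative_eq_intros simp: algebra_simps)

lemma continuous_on_cas [continuous_intros]:
  fixes f :: "'a::t2_space \<Rightarrow> real"
  shows "continuous_on A f \<Longrightarrow> continuous_on A (\<lambda>x. cas k (f x))"
  unfolding cas_def by (auto intro!: continuous_intros)

lemma cas_measurable [measurable]: "cas k \<in> borel_measurable borel"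
  by (intro borel_measurable_continuous_onI continuous_intros)

text \<open>With a, b the two phases, the product is cos (a - b) + sin (a + b); the cosine is the
  even part of \<open>cas (k - l)\<close> and the sine the odd part of \<open>cas (k + l)\<close>.
  Orthonormality and closure of trigonometric polynomials under products both rest on this
  identity.\<close>

lemma cas_mult:
  "cas k x * cas l x = (cas (k - l) x + cas (l - k) x + cas (k + l) x - cas (- k - l) x) / 2"
proof -
  let ?a = "2 * pi * of_int k * x" and ?b = "2 * pi * of_int l * x"
  have e: "2 * pi * of_int (k - l) * x = ?a - ?b" "2 * pi * of_int (l - k) * x = ?b - ?a"
    "2 * pi * of_int (k + l) * x = ?a + ?b" "2 * pi * of_int (- k - l) * x = - (?a + ?b)"
    by (simp_all add: algebra_simps)
  show ?thesis unfolding cas_def e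
    by (simp add: cos_diff sin_diff cos_add sin_add algebra_simps)
qed

lemma integral_unit_leb_FTC:
  fixes F f :: "real \<Rightarrow> real"
  assumes F: "\<And>x. x \<in> {0..1} \<Longrightarrow> (F has_real_derivative f x) (at x)"
    and f: "continuous_on {0..1} f" "f \<in> borel_measurable borel"
  shows "(\<integral>x. f x \<partial>unit_leb) = F 1 - F 0"
proof -
  have "(\<integral>x. f x \<partial>unit_leb) = (\<integral>x. indicator {0..<1} x *\<^sub>R f x \<partial>lborel)"
    by (rule integral_unit_leb) fact
  also have "\<dots> = (\<integral>x. indicator {0..1} x *\<^sub>R f x \<partial>lborel)"
  proof (rule integral_cong_AE)
    show "AE x in lborel. indicator {0..<1} x *\<^sub>R f x = indicator {0..1} x *\<^sub>R f x"
      using AE_lborel_singleton[of 1] by eventually_elim (auto simp: indicator_def)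
  qed (use f in auto)
  also have "\<dots> = F 1 - F 0"
    using F f(1) by (intro integral_FTC_atLeastAtMost)
      (auto simp: has_real_derivative_iff_has_vector_derivative[symmetric]
        intro: has_field_derivative_at_within)
  finally show ?thesis .
qed

lemma integral_cas: "(\<integral>x. cas k x \<partial>unit_leb) = (if k = 0 then 1 else 0)"
proof (cases "k = 0")
  case False
  have "(\<integral>x. cas k x \<partial>unit_leb) = - cas (- k) 1 / (2 * pi * k) - - cas (- k) 0 / (2 * pi * k)"
    using False
    by (intro integral_unit_leb_FTC) (auto intro!: derivative_eq_intros continuous_intros)
  also have "cas (- k) 1 = cas (- k) 0" using cas_periodic[of "- k" 0 1] by simp
  finally show ?thesis using False by simp
qed (simp add: measure_unit_leb_UNIV)

lemma integrable_cas: "integrable unit_leb (cas k)"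
  by (rule integrable_unit_leb_bounded[where B = 2]) (auto simp: cas_bound)

lemma cas_orthonormal: "(\<integral>x. cas k x * cas l x \<partial>unit_leb) = (if k = l then 1 else 0)"
  unfolding cas_mult by (simp add: integral_cas integrable_cas)

text \<open>A linear space of square-integrable functions on a finite measure space, whose closure
  is studied with functions instead of classes. It will be instantiated with trigonometric
  polynomials on the torus.\<close>

locale l2_subspace = finite_measure M for M :: "'a measure" +
  fixes W :: "('a \<Rightarrow> real) set"
  assumes W_meas: "g \<in> W \<Longrightarrow> g \<in> borel_measurable M"
    and W_sq: "g \<in> W \<Longrightarrow> integrable M (\<lambda>x. (g x)\<^sup>2)"
    and W_zero: "(\<lambda>x. 0) \<in> W"
    and W_add: "g \<in> W \<Longrightarrow> h \<in> W \<Longrightarrow> (\<lambda>x. g x + h x) \<in> W"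
    and W_scale: "g \<in> W \<Longrightarrow> (\<lambda>x. c * g x) \<in> W"
begin

definition sq_int :: "('a \<Rightarrow> real) \<Rightarrow> bool" where
  "sq_int f \<longleftrightarrow> f \<in> borel_measurable M \<and> integrable M (\<lambda>x. (f x)\<^sup>2)"

text \<open>Membership in the closure of \<open>W\<close>. Square integrability is part of it
  because the integral of a non-integrable function is 0 by convention, so smallness of the integral
  alone would mean nothing.\<close>

definition approx :: "('a \<Rightarrow> real) \<Rightarrow> bool" where
  "approx f \<longleftrightarrow> sq_int f \<and> (\<forall>\<epsilon>>0. \<exists>g\<in>W. (\<integral>x. (f x - g x)\<^sup>2 \<partial>M) < \<epsilon>)"

lemma approxE:
  assumes "approx f" "\<epsilon> > 0"
  obtains g where "g \<in> W" "(\<integral>x. (f x - g x)\<^sup>2 \<partial>M) < \<epsilon>"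
  using assms unfolding approx_def by blast

lemma W_sq_int: "g \<in> W \<Longrightarrow> sq_int g"
  by (simp add: sq_int_def W_meas W_sq)

text \<open>Stands in for the triangle inequality of the norm; its factor 2 is why tolerances are
  cut into quarters below.\<close>

lemma sq_add_le: "((a::real) + b)\<^sup>2 \<le> 2 * a\<^sup>2 + 2 * b\<^sup>2"
  using sum_squares_ge_zero[of "a - b" 0] by (simp add: power2_eq_square algebra_simps)

lemma sq_int_scale: "sq_int f \<Longrightarrow> sq_int (\<lambda>x. c * f x)"
  by (auto simp: sq_int_def power_mult_distrib)

lemma sq_int_add:
  assumes "sq_int f" "sq_int g"
  shows "sq_int (\<lambda>x. f x + g x)"
    and "(\<integral>x. (f x + g x)\<^sup>2 \<partial>M) \<le> 2 * (\<integral>x. (f x)\<^sup>2 \<partial>M) + 2 * (\<integral>x. (g x)\<^sup>2 \<partial>M)"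
proof -
  have m [measurable]: "f \<in> borel_measurable M" "g \<in> borel_measurable M"
    and i: "integrable M (\<lambda>x. 2 * (f x)\<^sup>2)" "integrable M (\<lambda>x. 2 * (g x)\<^sup>2)"
    using assms by (auto simp: sq_int_def)
  have s: "integrable M (\<lambda>x. 2 * (f x)\<^sup>2 + 2 * (g x)\<^sup>2)" using i
      by (rule Bochner_Integration.integrable_add)
  have int: "integrable M (\<lambda>x. (f x + g x)\<^sup>2)"
    by (rule Bochner_Integration.integrable_bound[OF s]) (auto simp: sq_add_le)
  then show "sq_int (\<lambda>x. f x + g x)" by (simp add: sq_int_def)
  have "(\<integral>x. (f x + g x)\<^sup>2 \<partial>M) \<le> (\<integral>x. 2 * (f x)\<^sup>2 + 2 * (g x)\<^sup>2 \<partial>M)"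
    by (rule integral_mono[OF int s]) (rule sq_add_le)
  then show "(\<integral>x. (f x + g x)\<^sup>2 \<partial>M) \<le> 2 * (\<integral>x. (f x)\<^sup>2 \<partial>M) + 2 * (\<integral>x. (g x)\<^sup>2 \<partial>M)"
    using i by simp
qed

lemma sq_int_diff: "sq_int f \<Longrightarrow> sq_int g \<Longrightarrow> sq_int (\<lambda>x. f x - g x)"
  using sq_int_add(1)[of f "\<lambda>x. -1 * g x"] sq_int_scale[of g "-1"] by simp

lemma sq_int_bounded:
  assumes "f \<in> borel_measurable M" "\<And>x. x \<in> space M \<Longrightarrow> \<bar>f x\<bar> \<le> B"
  shows "sq_int f"
proof -
  have "(f x)\<^sup>2 \<le> B\<^sup>2" if "x \<in> space M" for x
    using assms(2)[OF that] by (metis abs_ge_zero power2_abs power_mono)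
  then show ?thesis unfolding sq_int_def using assms(1)
    by (intro conjI integrable_const_bound[where B = "B\<^sup>2"]) auto
qed

lemma approx_W: "g \<in> W \<Longrightarrow> approx g"
  by (auto simp: approx_def W_sq_int intro!: bexI[of _ g])

lemma approx_limit:
  assumes f: "sq_int f" and h: "\<And>\<epsilon>. \<epsilon> > 0 \<Longrightarrow> \<exists>h. approx h \<and> (\<integral>x. (f x - h x)\<^sup>2 \<partial>M) < \<epsilon>"
  shows "approx f"
  unfolding approx_def
proof (intro conjI allI impI f)
  fix \<epsilon> :: real assume "\<epsilon> > 0"
  then have e: "\<epsilon> / 4 > 0" by simp
  obtain h where h: "approx h" "(\<integral>x. (f x - h x)\<^sup>2 \<partial>M) < \<epsilon> / 4" using h[OF e] by blast
  obtain g where g: "g \<in> W" "(\<integral>x. (h x - g x)\<^sup>2 \<partial>M) < \<epsilon> / 4" using approxE[OF h(1) e] .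
  have "sq_int h" using h(1) by (simp add: approx_def)
  then have "(\<integral>x. ((f x - h x) + (h x - g x))\<^sup>2 \<partial>M) < \<epsilon>"
    using sq_int_add(2)[OF sq_int_diff[OF f, of h] sq_int_diff[of h g]] W_sq_int[OF g(1)] h(2) g(2)
    by simp
  then show "\<exists>g\<in>W. (\<integral>x. (f x - g x)\<^sup>2 \<partial>M) < \<epsilon>" using g(1) by auto
qed

lemma approx_add:
  assumes "approx f" "approx g"
  shows "approx (\<lambda>x. f x + g x)"
  unfolding approx_def
proof (intro conjI allI impI)
  have s: "sq_int f" "sq_int g" using assms by (auto simp: approx_def)
  then show "sq_int (\<lambda>x. f x + g x)" by (rule sq_int_add)
  fix \<epsilon> :: real assume "\<epsilon> > 0"
  then have e: "\<epsilon> / 4 > 0" by simp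
  obtain u where u: "u \<in> W" "(\<integral>x. (f x - u x)\<^sup>2 \<partial>M) < \<epsilon> / 4" using approxE[OF assms(1) e] .
  obtain v where v: "v \<in> W" "(\<integral>x. (g x - v x)\<^sup>2 \<partial>M) < \<epsilon> / 4" using approxE[OF assms(2) e] .
  have "(\<integral>x. ((f x - u x) + (g x - v x))\<^sup>2 \<partial>M) < \<epsilon>"
    using sq_int_add(2)[OF sq_int_diff[OF s(1), of u] sq_int_diff[OF s(2), of v]] W_sq_int u v by simp
  then show "\<exists>h\<in>W. (\<integral>x. (f x + g x - h x)\<^sup>2 \<partial>M) < \<epsilon>"
    using W_add[OF u(1) v(1)] by (intro bexI[of _ "\<lambda>x. u x + v x"]) (auto simp: algebra_simps)
qed

lemma approx_scale:
  assumes "approx f"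
  shows "approx (\<lambda>x. c * f x)"
  unfolding approx_def
proof (intro conjI allI impI)
  have s: "sq_int f" using assms by (auto simp: approx_def)
  then show "sq_int (\<lambda>x. c * f x)" by (rule sq_int_scale)
  fix \<epsilon> :: real assume "\<epsilon> > 0"
  \<comment> \<open>Dividing by 1 + c^2 instead of c^2 covers c = 0 as well.\<close>
  moreover have c: "1 + c\<^sup>2 > 0" by (simp add: add_pos_nonneg)
  ultimately have e: "\<epsilon> / (1 + c\<^sup>2) > 0" by simp
  obtain u where u: "u \<in> W" "(\<integral>x. (f x - u x)\<^sup>2 \<partial>M) < \<epsilon> / (1 + c\<^sup>2)" using approxE[OF assms e] .
  have "(\<integral>x. (c * f x - c * u x)\<^sup>2 \<partial>M) = c\<^sup>2 * (\<integral>x. (f x - u x)\<^sup>2 \<partial>M)"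
    by (simp add: right_diff_distrib[symmetric] power_mult_distrib)
  also have "\<dots> \<le> (1 + c\<^sup>2) * (\<integral>x. (f x - u x)\<^sup>2 \<partial>M)" by (intro mult_right_mono) auto
  also have "\<dots> < \<epsilon>" using u(2) c by (simp add: pos_less_divide_eq mult.commute)
  finally show "\<exists>h\<in>W. (\<integral>x. (c * f x - h x)\<^sup>2 \<partial>M) < \<epsilon>"
    using W_scale[OF u(1)] by (intro bexI[of _ "\<lambda>x. c * u x"]) auto
qed

lemma approx_sum:
  assumes "finite J" "\<And>j. j \<in> J \<Longrightarrow> approx (f j)"
  shows "approx (\<lambda>x. \<Sum>j\<in>J. f j x)"
  using assms by (induction J rule: finite_induct) (auto intro: approx_add approx_W[OF W_zero])

lemma sq_int_indicator: "A \<in> sets M \<Longrightarrow> sq_int (indicator A)"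
  by (rule sq_int_bounded[where B = 1]) (auto simp: indicator_def)

text \<open>Dominated convergence, with the bound placed on the errors \<open>f - s n\<close>
  themselves, since their squares are what is integrated. Taking a constant sequence and
  \<open>w = 0\<close> transfers \<open>approx\<close> between functions that agree on the
  space.\<close>

lemma approx_dominated:
  assumes s: "\<And>n. approx (s n)" and f: "sq_int f" and w: "sq_int w"
    and lim: "\<And>x. x \<in> space M \<Longrightarrow> (\<lambda>n. s n x) \<longlonglongrightarrow> f x"
    and dom: "\<And>n x. x \<in> space M \<Longrightarrow> \<bar>f x - s n x\<bar> \<le> \<bar>w x\<bar>"
  shows "approx f"
proof (rule approx_limit[OF f])
  fix \<epsilon> :: real assume e: "\<epsilon> > 0"
  have [measurable]: "f \<in> borel_measurable M" "\<And>n. s n \<in> borel_measurable M" "w \<in> borel_measurable M"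
    using s f w by (auto simp: approx_def sq_int_def)
  have "(\<lambda>n. \<integral>x. (f x - s n x)\<^sup>2 \<partial>M) \<longlonglongrightarrow> (\<integral>x. 0 \<partial>M)"
  proof (rule integral_dominated_convergence)
    show "integrable M (\<lambda>x. (w x)\<^sup>2)" using w by (simp add: sq_int_def)
    show "AE x in M. (\<lambda>n. (f x - s n x)\<^sup>2) \<longlonglongrightarrow> 0"
    proof (rule AE_I2)
      fix x assume "x \<in> space M"
      then have "(\<lambda>n. (f x - s n x)\<^sup>2) \<longlonglongrightarrow> (f x - f x)\<^sup>2"
        by (intro tendsto_intros lim)
      then show "(\<lambda>n. (f x - s n x)\<^sup>2) \<longlonglongrightarrow> 0" by simp
    qed
    show "AE x in M. norm ((f x - s n x)\<^sup>2) \<le> (w x)\<^sup>2" for n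
      using dom by (intro AE_I2) (simp add: abs_le_square_iff)
  qed auto
  then have "eventually (\<lambda>n. (\<integral>x. (f x - s n x)\<^sup>2 \<partial>M) < \<epsilon>) sequentially"
    using e by (intro order_tendstoD) auto
  then obtain n where "(\<integral>x. (f x - s n x)\<^sup>2 \<partial>M) < \<epsilon>" by (auto simp: eventually_sequentially)
  then show "\<exists>h. approx h \<and> (\<integral>x. (f x - h x)\<^sup>2 \<partial>M) < \<epsilon>" using s by blast
qed

text \<open>The usual ladder: indicators of an intersection-stable generator, all measurable sets by
  Dynkin induction, simple functions, and finally all square-integrable functions. The indicator of
  the whole space is assumed separately for the complement step.\<close>

theorem approx_dense:
  assumes G: "Int_stable G" "G \<subseteq> Pow (space M)" "sets M = sigma_sets (space M) G"
    and ind: "\<And>A. A \<in> G \<Longrightarrow> approx (indicator A)" and space: "approx (indicator (space M))"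
    and f: "sq_int f"
  shows "approx f"
proof -
  have set: "approx (indicator A)" if "A \<in> sets M" for A
  proof -
    have "A \<in> sigma_sets (space M) G" using that G(3) by simp
    from G(1,2) this show ?thesis
    proof (induction rule: sigma_sets_induct_disjoint)
      case (basic A)
      then show ?case by (rule ind)
    next
      case empty
      have "(\<lambda>x. 0) = (indicator {} :: 'a \<Rightarrow> real)" by auto
      then show ?case using approx_W[OF W_zero] by simp
    next
      case (compl A)
      have A: "A \<in> sets M" using compl G(3) by simp
      have "approx (\<lambda>x. indicator (space M) x + -1 * indicator A x)"
        by (intro approx_add approx_scale compl space)
      moreover have "(\<lambda>x. indicator (space M) x + -1 * indicator A x)
          = (indicator (space M - A) :: 'a \<Rightarrow> real)"
        using sets.sets_into_space[OF A] by (auto simp: indicator_def fun_eq_iff)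
      ultimately show ?case by simp
    next
      case (union A)
      have A: "A n \<in> sets M" for n using union G(3) by auto
      show ?case
      proof (rule approx_dominated)
        show "approx (\<lambda>x. \<Sum>i<n. indicator (A i) x)" for n
          using union by (intro approx_sum) auto
        show "sq_int (indicator (\<Union>i. A i))" "sq_int (indicator (space M))"
          using A by (auto intro: sq_int_indicator)
        have fin: "(\<Sum>i<n. indicator (A i) x) = (indicator (\<Union>i<n. A i) x :: real)" for n x
          using union by (intro indicator_UN_disjoint[symmetric]) (auto intro: disjoint_family_on_mono)
        show "(\<lambda>n. \<Sum>i<n. indicator (A i) x) \<longlonglongrightarrow> (indicator (\<Union>i. A i) x :: real)" for x
          unfolding fin by (rule LIMSEQ_indicator_UN)
        show "\<bar>indicator (\<Union>i. A i) x - (\<Sum>i<n. indicator (A i) x)\<bar> \<le> \<bar>indicator (space M) x :: real\<bar>"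
          if "x \<in> space M" for n x
          unfolding fin using that by (auto simp: indicator_def)
      qed
    qed
  qed
  have simple: "approx s" if s: "simple_function M s" for s
  proof -
    have "approx (\<lambda>x. \<Sum>y\<in>s ` space M. y * indicator (s -` {y} \<inter> space M) x)"
      using s by (intro approx_sum approx_scale set) (auto simp: simple_function_def)
    then have a: "approx (\<lambda>x. \<Sum>y\<in>s ` space M. indicator (s -` {y} \<inter> space M) x *\<^sub>R y)"
      by (simp add: mult.commute)
    have sm: "sq_int s"
    proof (rule sq_int_bounded[where B = "Max ((\<lambda>x. \<bar>s x\<bar>) ` space M)"])
      show "s \<in> borel_measurable M" using s by (rule borel_measurable_simple_function)
      have "finite ((\<lambda>x. \<bar>s x\<bar>) ` space M)"
        using finite_imageI[OF simple_functionD(1)[OF s], of abs] by (simp add: image_image)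
      then show "\<bar>s x\<bar> \<le> Max ((\<lambda>x. \<bar>s x\<bar>) ` space M)" if "x \<in> space M" for x
        using that by (intro Max_ge) auto
    qed
    show ?thesis
    \<comment> \<open>The indicator representation equals \<open>s\<close> only on the space, hence
      the constant sequence with error bound 0.\<close>
    proof (rule approx_dominated[where s = "\<lambda>n x. \<Sum>y\<in>s ` space M. indicator (s -` {y} \<inter> space M) x *\<^sub>R y"
          and w = "\<lambda>x. 0"])
      show "sq_int (\<lambda>x. 0)" by (rule sq_int_bounded[where B = 0]) auto
      fix n :: nat and x assume "x \<in> space M"
      from simple_function_indicator_representation_banach[OF s this]
      show "(\<lambda>n. \<Sum>y\<in>s ` space M. indicator (s -` {y} \<inter> space M) x *\<^sub>R y) \<longlonglongrightarrow> s x"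
        and "\<bar>s x - (\<Sum>y\<in>s ` space M. indicator (s -` {y} \<inter> space M) x *\<^sub>R y)\<bar> \<le> \<bar>0\<bar>"
        by (metis tendsto_const, metis abs_zero diff_self order_refl)
    qed (fact a sm)+
  qed
  have [measurable]: "f \<in> borel_measurable M" using f by (simp add: sq_int_def)
  obtain s where s: "\<And>i. simple_function M (s i)" "\<And>x. x \<in> space M \<Longrightarrow> (\<lambda>i. s i x) \<longlonglongrightarrow> f x"
    "\<And>i x. x \<in> space M \<Longrightarrow> dist (s i x) 0 \<le> 2 * dist (f x) 0"
    using borel_measurable_implies_sequence_metric[of f M 0] by (metis \<open>f \<in> borel_measurable M\<close>)
  show ?thesis
  \<comment> \<open>The simple functions satisfy |s n| \<le> 2 |f|, so the errors are at most 3
    |f|.\<close>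
  proof (rule approx_dominated[where s = s and w = "\<lambda>x. 3 * f x"])
    show "\<bar>f x - s n x\<bar> \<le> \<bar>3 * f x\<bar>" if "x \<in> space M" for n x
      using s(3)[OF that, of n] by (simp add: dist_real_def)
  qed (use s simple f sq_int_scale in auto)
qed

end

section \<open>The flat torus\<close>

text \<open>Points of the torus are represented in \<open>[0,1)\<^sup>2\<close>, with the topology pulled back from the embedding
  into the product of two unit circles. All unit boxes serve as charts, so that a short
  straight segment lies in a single chart.\<close>

definition tq :: "(nat \<Rightarrow> real) \<Rightarrow> nat \<Rightarrow> real" where
  "tq z = (\<lambda>i\<in>{..<2}. frac (z i))"

definition tpts :: "(nat \<Rightarrow> real) set" where
  "tpts = ({..<2} \<rightarrow>\<^sub>E {0..<1})"

definition temb :: "(nat \<Rightarrow> real) \<Rightarrow> complex \<times> complex" where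
  "temb p = (cis (2 * pi * p 0), cis (2 * pi * p 1))"

definition ttop :: "(nat \<Rightarrow> real) topology" where
  "ttop = pullback_topology tpts temb euclidean"

definition tbox :: "(nat \<Rightarrow> real) \<Rightarrow> (nat \<Rightarrow> real) set" where
  "tbox a = (\<Pi>\<^sub>E i\<in>{..<2}. {a i<..<a i + 1})"

text \<open>Coordinatewise the unique lift of \<open>p i\<close> to the half-open interval from
  \<open>a i\<close> to \<open>a i + 1\<close>; on the chart domain the left end is not attained, so
  the value lies in the open box.\<close>

definition tcoord :: "(nat \<Rightarrow> real) \<Rightarrow> (nat \<Rightarrow> real) \<Rightarrow> nat \<Rightarrow> real" where
  "tcoord a p = (\<lambda>i\<in>{..<2}. a i + frac (p i - a i))"

definition tchart :: "(nat \<Rightarrow> real) \<Rightarrow> (nat \<Rightarrow> real) chart" where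
  "tchart a = (tq ` tbox a, tcoord a)"

definition torus :: "(nat \<Rightarrow> real) riem_data" where
  "torus = \<lparr>mtop = ttop, mdim = 2, atlas = range tchart, metr = (\<lambda>c p i j. if i = j then 1 else 0)\<rparr>"

lemma torus_simps [simp]:
  "mtop torus = ttop" "mdim torus = 2" "atlas torus = range tchart"
  "metr torus = (\<lambda>c p i j. if i = j then 1 else 0)"
  by (simp_all add: torus_def)

lemma less_two_cases: "i < (2::nat) \<longleftrightarrow> i = 0 \<or> i = 1"
  by auto

lemma lessThan_two: "{..<2::nat} = {0, 1}"
  by auto

lemma frac_add_int: "frac (x + of_int n) = frac x"
  by (simp add: frac_def)

lemma frac_eq_frac_iff: "frac x = frac y \<longleftrightarrow> x - y \<in> \<int>" for x y :: real
proof
  assume "frac x = frac y"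
  then have "x - y = of_int (\<lfloor>x\<rfloor> - \<lfloor>y\<rfloor>)" by (simp add: frac_def)
  then show "x - y \<in> \<int>" by simp
next
  assume "x - y \<in> \<int>"
  then obtain n where "x - y = of_int n" by (elim Ints_cases)
  then have "x = y + of_int n" by simp
  then show "frac x = frac y" by (simp add: frac_add_int)
qed

lemma frac_frac_diff: "frac (frac x - y) = frac (x - y)"
proof -
  have "frac x - y = (x - y) + of_int (- \<lfloor>x\<rfloor>)" by (simp add: frac_def)
  then show ?thesis by (simp only: frac_add_int)
qed

lemma cis_frac: "cis (2 * pi * frac x) = cis (2 * pi * x)"
proof -
  have "2 * pi * frac x = 2 * pi * x - 2 * pi * of_int \<lfloor>x\<rfloor>" by (simp add: frac_def algebra_simps)
  then show ?thesis
    by (simp only: complex_eq_iff cis.sel cos_diff sin_diff cos_int_2pin sin_int_2pin) simp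
qed

lemma cis_eq_iff_frac: "cis (2 * pi * x) = cis (2 * pi * y) \<longleftrightarrow> frac x = frac y"
proof
  assume "cis (2 * pi * x) = cis (2 * pi * y)"
  then have "sin (2 * pi * x) = sin (2 * pi * y) \<and> cos (2 * pi * x) = cos (2 * pi * y)"
    by (simp add: complex_eq_iff)
  then obtain n :: int where "2 * pi * x = 2 * pi * y + 2 * pi * n" by (auto simp: sin_cos_eq_iff)
  then have "2 * pi * x = 2 * pi * (y + n)" by (simp add: algebra_simps)
  then have "x = y + n" by simp
  then show "frac x = frac y" by (simp add: frac_add_int)
next
  assume "frac x = frac y"
  then show "cis (2 * pi * x) = cis (2 * pi * y)" by (metis cis_frac)
qed

lemma tq_in_tpts [simp]: "tq z \<in> tpts"
  by (auto simp: tq_def tpts_def frac_lt_1)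

lemma temb_tq: "temb (tq z) = (cis (2 * pi * z 0), cis (2 * pi * z 1))"
  by (simp add: temb_def tq_def cis_frac)

lemma tq_id: "p \<in> tpts \<Longrightarrow> tq p = p"
  by (auto simp: tq_def tpts_def fun_eq_iff PiE_iff extensional_def)

lemma frac_chart:
  assumes "a < z" "z < a + 1" shows "a + frac (z - a) = z"
  using assms by (simp add: frac_eq_id)

lemma tcoord_tq: "z \<in> tbox a \<Longrightarrow> tcoord a (tq z) = z"
  by (auto simp: tcoord_def tq_def tbox_def fun_eq_iff PiE_iff extensional_def frac_frac_diff frac_chart)

lemma inj_tcoord: "inj_on (tcoord a) (tq ` tbox a)"
  by (rule inj_on_inverseI[where g = tq]) (auto simp: tcoord_tq)

lemma tcoord_image: "tcoord a ` tq ` tbox a = tbox a"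
  by (force simp: tcoord_tq image_image)

lemma inv_tcoord: "z \<in> tbox a \<Longrightarrow> inv_into (tq ` tbox a) (tcoord a) z = tq z"
  by (rule inv_into_f_eq[OF inj_tcoord]) (auto simp: tcoord_tq)

text \<open>A chart domain is the torus cut open along two circles. In this form openness, overlaps
  and coverings can be read off one coordinate at a time.\<close>

lemma mem_chart_iff:
  "p \<in> tq ` tbox a \<longleftrightarrow> p \<in> tpts \<and> (\<forall>i<2. frac (p i) \<noteq> frac (a i))"
proof safe
  fix z assume z: "z \<in> tbox a" 
  fix i :: nat assume i: "i < 2" "frac (tq z i) = frac (a i)"
  then have "z i - a i \<in> \<int>" by (simp add: tq_def frac_eq_frac_iff)
  then have "frac (z i - a i) = 0" by simp
  moreover have "z i \<in> {a i<..<a i + 1}" using PiE_mem[OF z[unfolded tbox_def], of i] i by simp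
  then have "0 < z i - a i" "z i - a i < 1" by simp_all
  then have "frac (z i - a i) = z i - a i" by (intro frac_eq_id) simp
  ultimately show False using \<open>0 < z i - a i\<close> by simp
next
  assume p: "p \<in> tpts" "\<forall>i<2. frac (p i) \<noteq> frac (a i)"
  have "frac (p i - a i) > 0" if "i < 2" for i
  proof -
    have "p i - a i \<notin> \<int>" using p that by (metis Ints_minus frac_eq_frac_iff minus_diff_eq)
    then show ?thesis by (simp add: frac_gt_0_iff)
  qed
  then have "tcoord a p \<in> tbox a" by (auto simp: tcoord_def tbox_def frac_lt_1)
  moreover have "tq (tcoord a p) = p"
  proof -
    have "frac (a i + frac (p i - a i)) = p i" if "i < 2" for i
    proof -
      have "a i + frac (p i - a i) = p i + of_int (- \<lfloor>p i - a i\<rfloor>)" by (simp add: frac_def)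
      then have "frac (a i + frac (p i - a i)) = frac (p i)" by (simp only: frac_add_int)
      also have "frac (p i) = p i" using p(1) that by (auto simp: tpts_def PiE_iff)
      finally show ?thesis .
    qed
    then show ?thesis using p(1) by (auto simp: tq_def tcoord_def fun_eq_iff tpts_def PiE_iff
        extensional_def)
  qed
  ultimately show "p \<in> tq ` tbox a" by (metis image_eqI)
qed simp

lemma topspace_ttop [simp]: "topspace ttop = tpts"
  by (auto simp: ttop_def topspace_pullback_topology)

lemma openin_tbox: "openin (powertop_real {..<2}) (tbox a)"
  unfolding tbox_def by (subst openin_PiE) auto

lemma continuous_map_coord: "i < 2 \<Longrightarrow> continuous_map (powertop_real {..<2::nat}) euclideanreal (\<lambda>z. z i)"
  by (rule continuous_map_product_projection) simp

lemma continuous_map_complex_pair: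
  assumes "continuous_map X euclidean f" "continuous_map X euclidean g"
  shows "continuous_map X euclidean (\<lambda>x. (f x, g x))"
  using continuous_map_pairedI[OF assms] by simp

lemma continuous_map_cis:
  "continuous_map X euclideanreal f \<Longrightarrow> continuous_map X euclidean (\<lambda>x. cis (2 * pi * f x))"
proof -
  assume f: "continuous_map X euclideanreal f"
  have "continuous_on UNIV (\<lambda>t. cis (2 * pi * t))" by (intro continuous_intros)
  then have "continuous_map euclideanreal euclidean (\<lambda>t. cis (2 * pi * t))" by simp
  from continuous_map_compose[OF f this] show ?thesis by (simp add: o_def)
qed

lemma continuous_map_tq: "continuous_map (powertop_real {..<2}) ttop tq"
  unfolding ttop_def
proof (rule continuous_map_pullback')
  have "temb \<circ> tq = (\<lambda>z. (cis (2 * pi * z 0), cis (2 * pi * z 1)))" by (simp add: fun_eq_iff temb_tq)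
  then show "continuous_map (powertop_real {..<2}) euclidean (temb \<circ> tq)"
    by (simp only:) (intro continuous_map_complex_pair continuous_map_cis continuous_map_coord, auto)
qed auto

lemma continuous_map_temb: "continuous_map ttop euclidean temb"
  using continuous_map_pullback[of euclidean euclidean id tpts temb] by (simp add: ttop_def)

lemma openin_chart: "openin ttop (tq ` tbox a)"
proof -
  let ?T = "{w. fst w \<noteq> cis (2 * pi * a 0) \<and> snd w \<noteq> cis (2 * pi * a 1)} :: (complex \<times> complex) set"
  have "?T = - (({cis (2 * pi * a 0)} \<times> UNIV) \<union> (UNIV \<times> {cis (2 * pi * a 1)}))" by auto
  moreover have "closed (({cis (2 * pi * a 0)} \<times> UNIV) \<union> (UNIV \<times> {cis (2 * pi * a 1)}))"
    by (intro closed_Un closed_Times) auto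
  ultimately have "open ?T" by (simp only: open_Compl)
  moreover have "tq ` tbox a = temb -` ?T \<inter> tpts"
    by (auto simp: set_eq_iff mem_chart_iff less_two_cases temb_def cis_eq_iff_frac)
  ultimately show ?thesis unfolding ttop_def openin_pullback_topology open_openin[symmetric] by blast
qed

lemma Arg2pi_cis: "0 \<le> x \<Longrightarrow> x < 1 \<Longrightarrow> Arg2pi (cis (2 * pi * x)) = 2 * pi * x"
  by (rule Arg2pi_unique[of 1]) (auto simp: cis_conv_exp)

text \<open>After rotation by the angle of \<open>a i\<close>, the coordinate is an argument in the
  range from 0 to 2\<pi>. The cut of \<open>Arg2pi\<close> then falls on the circle that the chart
  omits, so the argument is continuous on the whole chart domain.\<close>

lemma continuous_map_tcoord:
  "continuous_map (subtopology ttop (tq ` tbox a)) (subtopology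
      (powertop_real {..<2}) (tbox a)) (tcoord a)"
proof (rule continuous_map_into_subtopology)
  show "tcoord a \<in> topspace (subtopology ttop (tq ` tbox a)) \<rightarrow> tbox a"
    using tcoord_image[of a] by (auto simp: Pi_iff)
  have comp: "continuous_map (subtopology ttop (tq ` tbox a)) euclideanreal (\<lambda>p. a i + frac (p i - a i))"
    if i: "i < 2" for i
  proof -
    let ?T = "- (\<lambda>w. w * cis (- (2 * pi * a i))) -` (\<real>\<^sub>\<ge>\<^sub>0 :: complex set)"
    let ?g = "\<lambda>w. a i + Arg2pi (w * cis (- (2 * pi * a i))) / (2 * pi)"
    have prod: "cis (2 * pi * x) * cis (- (2 * pi * a i)) = cis (2 * pi * frac (x - a i))" for x
    proof -
      have "2 * pi * x + - (2 * pi * a i) = 2 * pi * (x - a i)" by (simp add: algebra_simps)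
      then show ?thesis by (simp only: cis_mult cis_frac)
    qed
    have "continuous_map ttop euclidean (\<lambda>p. cis (2 * pi * p i))"
    proof (cases "i = 0")
      case True
      have "continuous_map euclidean euclidean (fst :: complex \<times> complex \<Rightarrow> complex)"
        by (simp add: continuous_on_fst)
      from continuous_map_compose[OF continuous_map_temb this] show ?thesis
        using True by (simp add: o_def temb_def)
    next
      case False
      have "continuous_map euclidean euclidean (snd :: complex \<times> complex \<Rightarrow> complex)"
        by (simp add: continuous_on_snd)
      from continuous_map_compose[OF continuous_map_temb this] show ?thesis
        using False i by (simp add: o_def temb_def less_two_cases)
    qed
    moreover have "cis (2 * pi * p i) \<in> ?T" if "p \<in> tq ` tbox a" for p
    proof -
      have ne: "frac (p i - a i) \<noteq> 0" using that i unfolding mem_chart_iff 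
        by (metis frac_eq_0_iff frac_eq_frac_iff)
      have "cis (2 * pi * frac (p i - a i)) \<notin> \<real>\<^sub>\<ge>\<^sub>0"
      proof
        assume "cis (2 * pi * frac (p i - a i)) \<in> \<real>\<^sub>\<ge>\<^sub>0"
        then have "Arg2pi (cis (2 * pi * frac (p i - a i))) = 0"
          by (simp add: Arg2pi_eq_0 complex_nonneg_Reals_iff complex_is_Real_iff)
        then show False using ne by (simp add: Arg2pi_cis frac_lt_1)
      qed
      then show ?thesis by (simp add: prod)
    qed
    ultimately have m: "continuous_map (subtopology ttop (tq ` tbox a)) (top_of_set ?T) (\<lambda>p. cis (2
        * pi * p i))"
      by (intro continuous_map_into_subtopology continuous_map_from_subtopology) auto
    have "continuous_on ?T ?g"
    proof (rule continuous_at_imp_continuous_on, rule ballI)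
      fix w assume w: "w \<in> ?T"
      have "isCont (Arg2pi \<circ> (\<lambda>w. w * cis (- (2 * pi * a i)))) w"
        using w by (intro continuous_at_compose continuous_at_Arg2pi continuous_intros) auto
      then show "isCont ?g w" by (intro continuous_intros) (auto simp: o_def)
    qed
    then have "continuous_map (top_of_set ?T) euclideanreal ?g" by simp
    from continuous_map_compose[OF m this] show ?thesis
      by (simp add: o_def prod Arg2pi_cis frac_lt_1)
  qed
  show "continuous_map (subtopology ttop (tq ` tbox a)) (powertop_real {..<2}) (tcoord a)"
    unfolding continuous_map_componentwise
  proof (intro conjI ballI)
    fix i assume "i \<in> {..<2::nat}"
    then show "continuous_map (subtopology ttop (tq ` tbox a)) euclideanreal (\<lambda>p. tcoord a p i)"
      using comp[of i] by (simp add: tcoord_def)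
  qed (auto simp: tcoord_def)
qed

lemma is_chart_tchart: "is_chart ttop 2 (tchart a)"
proof -
  have "homeomorphic_maps (subtopology ttop (tq ` tbox a)) (subtopology (powertop_real {..<2}) (tbox a))
      (tcoord a) tq"
    unfolding homeomorphic_maps_def
  proof (intro conjI ballI)
    show "continuous_map (subtopology (powertop_real {..<2}) (tbox a))
        (subtopology ttop (tq ` tbox a)) tq"
      by (intro continuous_map_into_subtopology continuous_map_from_subtopology continuous_map_tq) auto
  qed (auto simp: continuous_map_tcoord tcoord_tq)
  then show ?thesis
    unfolding is_chart_def tchart_def
    using openin_chart openin_tbox by (auto simp: tcoord_image homeomorphic_maps_map)
qed

section \<open>Global topology of the torus\<close>

lemma temb_inj: "inj_on temb tpts"
proof (rule inj_onI)
  fix p q assume pq: "p \<in> tpts" "q \<in> tpts" "temb p = temb q"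
  then have "frac (p 0) = frac (q 0)" "frac (p 1) = frac (q 1)" by (auto simp: temb_def cis_eq_iff_frac)
  then have "tq p = tq q" by (auto simp: tq_def less_two_cases fun_eq_iff restrict_def)
  then show "p = q" using pq by (simp add: tq_id)
qed

abbreviation tset :: "(complex \<times> complex) set" where
  "tset \<equiv> sphere 0 1 \<times> sphere 0 1"

lemma temb_image: "temb ` tpts = tset"
proof
  show "temb ` tpts \<subseteq> tset" by (auto simp: temb_def)
  show "tset \<subseteq> temb ` tpts"
  proof
    fix w assume "w \<in> tset"
    then have "cmod (fst w) = 1" "cmod (snd w) = 1" by auto
    then have w: "fst w = cis (Arg2pi (fst w))" "snd w = cis (Arg2pi (snd w))"
      using Arg2pi_eq[of "fst w"] Arg2pi_eq[of "snd w"] by (auto simp: cis_conv_exp)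
    let ?z = "\<lambda>i. if i = 0 then Arg2pi (fst w) / (2 * pi) else Arg2pi (snd w) / (2 * pi) :: real"
    have "temb (tq ?z) = w" unfolding temb_tq using w by (simp add: prod_eq_iff)
    then show "w \<in> temb ` tpts" by (metis imageI tq_in_tpts)
  qed
qed

text \<open>Pulling a topology back along an injection reproduces the subspace topology of the
  image. All global properties of the torus are therefore inherited from a product of two
  circles.\<close>

lemma homeomorphic_temb: "homeomorphic_map ttop (top_of_set tset) temb"
proof (rule bijective_open_imp_homeomorphic_map)
  show "continuous_map ttop (top_of_set tset) temb"
    using temb_image by (intro continuous_map_into_subtopology continuous_map_temb) auto
  show "open_map ttop (top_of_set tset) temb"
    unfolding open_map_def
  proof (intro allI impI)
    fix U assume "openin ttop U"
    then obtain V where V: "open V" "U = temb -` V \<inter> tpts"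
      by (auto simp: ttop_def openin_pullback_topology)
    have "temb ` (temb -` V \<inter> tpts) = temb ` tpts \<inter> V" by auto
    then have "temb ` U = tset \<inter> V" using V(2) temb_image by simp
    then show "openin (top_of_set tset) (temb ` U)" using V(1) by auto
  qed
qed (auto simp: temb_image temb_inj)

lemma homeomorphic_space_torus: "ttop homeomorphic_space top_of_set tset"
  using homeomorphic_temb homeomorphic_map_imp_homeomorphic_space by blast

lemma second_countable_euclidean:
  "second_countable (euclidean :: 'a :: second_countable_topology topology)"
proof -
  obtain B :: "'a set set" where "countable B" "topological_basis B" using ex_countable_basis by blast
  then show ?thesis
    unfolding second_countable_def
  proof (intro exI[of _ B] conjI ballI allI impI)
    show "openin euclidean V" if "V \<in> B" for V
      using topological_basis_open[OF \<open>topological_basis B\<close> that] by simp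
    show "\<exists>V\<in>B. x \<in> V \<and> V \<subseteq> U" if "openin euclidean U \<and> x \<in> U" for U x
      using topological_basisE[OF \<open>topological_basis B\<close>, of U x] that by (metis open_openin)
  qed
qed

lemma ttop_Hausdorff: "Hausdorff_space ttop"
  and ttop_second_countable: "second_countable ttop"
  and ttop_compact: "compact_space ttop"
  and ttop_connected: "connected_space ttop"
proof -
  show "Hausdorff_space ttop"
    using homeomorphic_Hausdorff_space[OF homeomorphic_space_torus]
    by (simp add: Hausdorff_space_subtopology)
  show "second_countable ttop"
    using homeomorphic_space_second_countability[OF homeomorphic_space_torus]
    by (simp add: second_countable_subtopology second_countable_euclidean)
  have "compact tset" by (intro compact_Times compact_sphere)
  then show "compact_space ttop"
    using homeomorphic_compact_space[OF homeomorphic_space_torus]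
    by (simp add: compact_space_subtopology)
  have "connected tset" by (intro connected_Times connected_sphere) auto
  then show "connected_space ttop"
    using homeomorphic_connected_space[OF homeomorphic_space_torus]
    by (simp add: connected_space_subtopology)
qed

section \<open>Smooth structure and Laplacian of the torus\<close>

lemma continuous_map_fun_upd:
  assumes x: "x \<in> topspace (powertop_real {..<n})" and i: "i < n"
  shows "continuous_map euclideanreal (powertop_real {..<n}) (\<lambda>t. x(i := t))"
  unfolding continuous_map_componentwise
proof (intro conjI ballI)
  show "continuous_map euclideanreal euclideanreal (\<lambda>t. (x(i := t)) k)" for k
    by (cases "k = i") auto
qed (use x i in \<open>auto simp: PiE_iff extensional_def\<close>)

lemma eventually_fun_upd:
  assumes V: "openin (powertop_real {..<n}) V" and x: "x \<in> V" and i: "i < n"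
  shows "eventually (\<lambda>t. x(i := t) \<in> V) (nhds (x i))"
proof -
  have "x \<in> topspace (powertop_real {..<n})" using openin_subset[OF V] x by blast
  from openin_continuous_map_preimage[OF continuous_map_fun_upd[OF this i] V]
  have "open {t. x(i := t) \<in> V}" by simp
  then show ?thesis using x by (auto intro: eventually_nhds_in_open[of "{t. x(i := t) \<in> V}", simplified])
qed

lemma pdiff_cong_on:
  assumes "openin (powertop_real {..<n}) V" "\<And>y. y \<in> V \<Longrightarrow> f y = g y" "x \<in> V" "i < n"
  shows "pdiff i f x = pdiff i g x"
  unfolding pdiff_def
  by (rule deriv_cong_ev[OF eventually_mono[OF eventually_fun_upd[OF assms(1,3,4)]]])
    (simp_all add: assms(2))

lemma fold_pdiff_cong_on:
  assumes "openin (powertop_real {..<n}) V" "\<And>y. y \<in> V \<Longrightarrow> f y = g y"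
    and "set is \<subseteq> {..<n}" "x \<in> V"
  shows "fold pdiff is f x = fold pdiff is g x"
  using assms(2-)
proof (induction "is" arbitrary: f g x)
  case (Cons i js)
  have "pdiff i f y = pdiff i g y" if "y \<in> V" for y
    using Cons.prems that by (intro pdiff_cong_on[OF assms(1)]) auto
  then show ?case using Cons.IH[of "pdiff i f" "pdiff i g" x] Cons.prems by simp
qed simp

lemma differentiable_cong_ev:
  fixes f g :: "real \<Rightarrow> real"
  assumes "eventually (\<lambda>t. f t = g t) (nhds x)" "f differentiable (at x)"
  shows "g differentiable (at x)"
  using assms DERIV_cong_ev[OF refl assms(1) refl] by (auto simp: real_differentiable_def)

text \<open>Partial derivatives depend on germs only and \<open>V\<close> is open, so values outside
  \<open>V\<close> are irrelevant. This is what allows \<open>inv_into\<close> of a chart map to be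
  replaced by \<open>tq\<close>.\<close>

lemma smooth_on_cong:
  assumes V: "openin (powertop_real {..<n}) V" and eq: "\<And>y. y \<in> V \<Longrightarrow> f y = g y"
    and f: "smooth_on n V f"
  shows "smooth_on n V g"
  unfolding smooth_on_def
proof (intro allI impI conjI ballI)
  fix js :: "nat list" assume js: "set js \<subseteq> {..<n}"
  have e: "fold pdiff js f y = fold pdiff js g y" if "y \<in> V" for y
    by (rule fold_pdiff_cong_on[OF V eq js that])
  have "continuous_map (subtopology (powertop_real {..<n}) V) euclideanreal (fold pdiff js f)"
    using f js by (simp add: smooth_on_def)
  then show "continuous_map (subtopology (powertop_real {..<n}) V) euclideanreal (fold pdiff js g)"
    by (rule continuous_map_eq) (simp add: e)
  fix i x assume i: "i < n" and x: "x \<in> V"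
  have "(\<lambda>t. fold pdiff js f (x(i := t))) differentiable (at (x i))"
    using f js i x by (simp add: smooth_on_def)
  moreover have "eventually (\<lambda>t. fold pdiff js f (x(i := t)) = fold pdiff js g (x(i := t))) (nhds (x i))"
    using eventually_fun_upd[OF V x i] by eventually_elim (rule e)
  ultimately show "(\<lambda>t. fold pdiff js g (x(i := t))) differentiable (at (x i))"
    using differentiable_cong_ev[of "\<lambda>t. fold pdiff js f (x(i := t))" "\<lambda>t. fold pdiff js g
        (x(i := t))" "x i"]
    by blast
qed

lemma pdiff_const: "pdiff i (\<lambda>x. c) = (\<lambda>x. 0)"
  by (simp add: pdiff_def fun_eq_iff)

lemma smooth_on_const: "smooth_on n V (\<lambda>x. c)"
proof -
  have ex: "\<exists>d. fold pdiff js (\<lambda>x. c) = (\<lambda>x. d)" for js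
    by (induction js arbitrary: c) (auto simp: pdiff_const)
  show ?thesis unfolding smooth_on_def
  proof (intro allI impI conjI ballI)
    fix js :: "nat list"
    obtain d where d: "fold pdiff js (\<lambda>x. c) = (\<lambda>x. d)" using ex by blast
    show "continuous_map (subtopology (powertop_real {..<n}) V) euclideanreal (fold pdiff js (\<lambda>x. c))"
      unfolding d by simp
    show "(\<lambda>t. fold pdiff js (\<lambda>x. c) (x(i := t))) differentiable (at (x i))" for x and i :: nat
      unfolding d by simp
  qed
qed

text \<open>One step of the recursion hidden in \<open>smooth_on\<close>. It suits the transition
  maps, whose first partial derivatives are constant on the overlap.\<close>

lemma smooth_on_of_pdiff:
  assumes V: "openin (powertop_real {..<n}) V"
    and cont: "continuous_map (subtopology (powertop_real {..<n}) V) euclideanreal f"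
    and diff: "\<And>i x. i < n \<Longrightarrow> x \<in> V \<Longrightarrow> (\<lambda>t. f (x(i := t))) differentiable (at (x i))"
    and smooth: "\<And>i. i < n \<Longrightarrow> smooth_on n V (pdiff i f)"
  shows "smooth_on n V f"
  unfolding smooth_on_def
proof (intro allI impI conjI ballI)
  fix js :: "nat list" assume js: "set js \<subseteq> {..<n}"
  show "continuous_map (subtopology (powertop_real {..<n}) V) euclideanreal (fold pdiff js f)"
    using js cont smooth by (cases js) (auto simp: smooth_on_def)
  fix i x assume "i < n" and "x \<in> V"
  then show "(\<lambda>t. fold pdiff js f (x(i := t))) differentiable (at (x i))"
    using js diff smooth by (cases js) (auto simp: smooth_on_def)
qed

section \<open>Product Hartley functions and their smoothness\<close>

definition cas2 :: "int \<times> int \<Rightarrow> (nat \<Rightarrow> real) \<Rightarrow> real" where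
  "cas2 b z = cas (fst b) (z 0) * cas (snd b) (z 1)"

lemma cas2_zero [simp]: "cas2 (0, 0) z = 1"
  by (simp add: cas2_def)

lemma cas2_tq: "cas2 b (tq z) = cas2 b z"
  by (simp add: cas2_def tq_def cas_frac)

lemma pdiff_cas2:
  "pdiff 0 (\<lambda>z. c * cas2 (k, l) z) = (\<lambda>z. (c * (2 * pi * of_int k)) * cas2 (- k, l) z)"
  "pdiff 1 (\<lambda>z. c * cas2 (k, l) z) = (\<lambda>z. (c * (2 * pi * of_int l)) * cas2 (k, - l) z)"
proof -
  have "((\<lambda>t. c * (cas k t * cas l y)) has_real_derivative c * (2 * pi * of_int k) * (cas (- k) x
      * cas l y)) (at x)"
    "((\<lambda>t. c * (cas k y * cas l t)) has_real_derivative c * (2 * pi * of_int l) * (cas k y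
        * cas (- l) x)) (at x)"
    for x y by (auto intro!: derivative_eq_intros)
  from this[THEN DERIV_imp_deriv]
  show "pdiff 0 (\<lambda>z. c * cas2 (k, l) z) = (\<lambda>z. (c * (2 * pi * of_int k)) * cas2 (- k, l) z)"
    "pdiff 1 (\<lambda>z. c * cas2 (k, l) z) = (\<lambda>z. (c * (2 * pi * of_int l)) * cas2 (k, - l) z)"
    by (simp_all add: pdiff_def cas2_def fun_eq_iff)
qed

lemma continuous_map_cas:
  assumes "continuous_map X euclideanreal f"
  shows "continuous_map X euclideanreal (\<lambda>x. cas k (f x))"
proof -
  have "continuous_map euclideanreal euclideanreal (cas k)" by (simp add: continuous_on_cas)
  from continuous_map_compose[OF assms this] show ?thesis by (simp add: o_def)
qed

lemma continuous_map_cas2: "continuous_map (powertop_real {..<2}) euclideanreal (cas2 b)"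
  unfolding cas2_def[abs_def]
  by (intro continuous_map_real_mult continuous_map_cas continuous_map_coord) auto

lemma smooth_on_cas2: "smooth_on 2 V (\<lambda>z. c * cas2 (k, l) z)"
proof -
  have ex: "\<exists>d k' l'. fold pdiff js (\<lambda>z. c * cas2 (k, l) z) = (\<lambda>z. d * cas2 (k', l') z)"
    if "set js \<subseteq> {..<2}" for js
    using that
  proof (induction js arbitrary: c k l)
    case (Cons i js)
    then have "i = 0 \<or> i = 1" by auto
    then show ?case using Cons by (auto simp only: fold_simps o_apply pdiff_cas2 set_simps
        insert_subset fold.simps)
  qed auto
  have c: "continuous_map (subtopology (powertop_real {..<2}) V) euclideanreal (\<lambda>z. d * cas2 b z)"
      for d b
    by (intro continuous_map_real_mult continuous_map_from_subtopology continuous_map_cas2) auto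
  have d: "(\<lambda>t. d * cas2 b (x(i := t))) differentiable (at (x i))" if "i < 2" for d b x i
  proof -
    have "cas k differentiable (at y)" for k y
      using cas_has_derivative unfolding real_differentiable_def by blast
    then show ?thesis using that by (auto simp: cas2_def less_two_cases)
  qed
  show ?thesis unfolding smooth_on_def
  proof (intro allI impI conjI ballI)
    fix js :: "nat list" assume js: "set js \<subseteq> {..<2}"
    obtain e k' l' where e: "fold pdiff js (\<lambda>z. c * cas2 (k, l) z) = (\<lambda>z. e * cas2 (k', l') z)"
      using ex[OF js] by blast
    show "continuous_map (subtopology (powertop_real {..<2}) V) euclideanreal (fold pdiff js (\<lambda>z. c
        * cas2 (k, l) z))"
      unfolding e by (rule c)
    show "(\<lambda>t. fold pdiff js (\<lambda>z. c * cas2 (k, l) z) (x(i := t))) differentiable (at (x i))"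
      if "i < 2" for x i
      unfolding e by (rule d[OF that])
  qed
qed

lemma fold_pdiff_chart:
  assumes "z \<in> tbox a" "set js \<subseteq> {..<2}"
  shows "fold pdiff js (\<lambda>x. f (inv_into (tq ` tbox a) (tcoord a) x)) z = fold pdiff js (\<lambda>x. f (tq x)) z"
  using assms by (intro fold_pdiff_cong_on[OF openin_tbox]) (auto simp: inv_tcoord)

lemma smooth_fun_torus_iff:
  "smooth_fun torus f \<longleftrightarrow> (\<forall>a. smooth_on 2 (tbox a) (\<lambda>z. f (tq z)))"
proof -
  have "smooth_on 2 (tbox a) (\<lambda>x. f (inv_into (tq ` tbox a) (tcoord a) x))
     \<longleftrightarrow> smooth_on 2 (tbox a) (\<lambda>z. f (tq z))" for a
    by (intro iffI; erule smooth_on_cong[OF openin_tbox, rotated]) (auto simp: inv_tcoord)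
  then show ?thesis by (simp add: smooth_fun_def tchart_def tcoord_image)
qed

lemma frac_has_derivative:
  fixes x :: real
  assumes "x \<notin> \<int>"
  shows "(frac has_real_derivative 1) (at x)"
proof -
  have "of_int \<lfloor>x\<rfloor> < x" using assms by (metis Ints_of_int floor_correct order_le_less)
  then have x: "x \<in> {of_int \<lfloor>x\<rfloor><..<of_int \<lfloor>x\<rfloor> + 1}" by simp
  have "eventually (\<lambda>t. t \<in> {of_int \<lfloor>x\<rfloor><..<of_int \<lfloor>x\<rfloor> + 1}) (nhds x)"
    using x by (intro eventually_nhds_in_open) auto
  then have ev: "eventually (\<lambda>t. t - of_int \<lfloor>x\<rfloor> = frac t) (nhds x)"
  proof eventually_elim
    case (elim t)
    then have "\<lfloor>t\<rfloor> = \<lfloor>x\<rfloor>" by (intro floor_unique) auto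
    then show ?case by (simp add: frac_def)
  qed
  have "((\<lambda>t. t - of_int \<lfloor>x\<rfloor>) has_real_derivative 1) (at x)"
    by (auto intro!: derivative_eq_intros)
  then show ?thesis by (rule DERIV_cong_ev[OF refl ev refl, THEN iffD1])
qed

section \<open>Transition maps\<close>

definition toverlap :: "(nat \<Rightarrow> real) \<Rightarrow> (nat \<Rightarrow> real) \<Rightarrow> (nat \<Rightarrow> real) set" where
  "toverlap a b = tcoord a ` (tq ` tbox a \<inter> tq ` tbox b)"

lemma toverlap_iff: "z \<in> toverlap a b \<longleftrightarrow> z \<in> tbox a \<and> tq z \<in> tq ` tbox b"
proof
  assume "z \<in> toverlap a b"
  then obtain x where "x \<in> tbox a" "tq x \<in> tq ` tbox b" "z = tcoord a (tq x)"
    by (auto simp: toverlap_def)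
  then show "z \<in> tbox a \<and> tq z \<in> tq ` tbox b" by (simp add: tcoord_tq)
next
  assume z: "z \<in> tbox a \<and> tq z \<in> tq ` tbox b"
  then have "z = tcoord a (tq z)" by (simp add: tcoord_tq)
  then show "z \<in> toverlap a b" using z unfolding toverlap_def by blast
qed

lemma openin_toverlap: "openin (powertop_real {..<2}) (toverlap a b)"
proof -
  have "toverlap a b = tbox a \<inter> {z \<in> topspace (powertop_real {..<2}). tq z \<in> tq ` tbox b}"
    using openin_subset[OF openin_tbox[of a]] by (auto simp: toverlap_iff)
  then show ?thesis
    using openin_continuous_map_preimage[OF continuous_map_tq openin_chart[of b]] openin_tbox[of a]
    by auto
qed

lemma transition_torus:
  assumes "z \<in> toverlap a b" "k < 2"
  shows "transition (tchart a) (tchart b) z k = b k + frac (z k - b k)"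
proof -
  have "transition (tchart a) (tchart b) z = tcoord b (tq z)"
    using assms by (simp add: transition_def tchart_def toverlap_iff inv_tcoord)
  then show ?thesis using assms by (simp add: tcoord_def tq_def frac_frac_diff)
qed

lemma toverlap_notin_Ints:
  assumes "z \<in> toverlap a b" "k < 2"
  shows "z k - b k \<notin> \<int>"
proof -
  have "frac (tq z k) \<noteq> frac (b k)" using assms by (auto simp: toverlap_iff mem_chart_iff)
  then show ?thesis using assms by (simp add: tq_def frac_eq_frac_iff)
qed

text \<open>A transition map is locally a translation by an integer vector: the overlap leaves out
  the lines where \<open>frac\<close> jumps, and off the integers \<open>frac\<close> has slope
  1.\<close>

lemma transition_has_derivative:
  assumes "z \<in> toverlap a b" "i < 2" "k < 2"
  shows "((\<lambda>t. transition (tchart a) (tchart b) (z(i := t)) k) has_real_derivative (if i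
      = k then 1 else 0))
    (at (z i))"
proof -
  have der: "((\<lambda>t. b k + frac ((z(i := t)) k - b k)) has_real_derivative (if i
      = k then 1 else 0)) (at (z i))"
  proof (cases "i = k")
    case True
    have "((\<lambda>t. b k + frac (t - b k)) has_real_derivative 1) (at (z k))"
      using DERIV_shift[of frac 1 "z k" "- b k"] frac_has_derivative[OF toverlap_notin_Ints[OF
          assms(1,3)]]
      by (auto intro!: derivative_eq_intros)
    then show ?thesis using True by simp
  qed (auto intro!: derivative_eq_intros)
  have ev: "eventually (\<lambda>t. b k + frac ((z(i := t)) k - b k)
      = transition (tchart a) (tchart b) (z(i := t)) k) (nhds (z i))"
    using eventually_fun_upd[OF openin_toverlap assms(1,2)]
    by eventually_elim (simp add: transition_torus assms)
  show ?thesis by (rule DERIV_cong_ev[OF refl ev refl, THEN iffD1, OF der])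
qed

lemma pdiff_transition:
  assumes "z \<in> toverlap a b" "i < 2" "k < 2"
  shows "pdiff i (\<lambda>x. transition (tchart a) (tchart b) x k) z = (if i = k then 1 else 0)"
  unfolding pdiff_def by (rule DERIV_imp_deriv[OF transition_has_derivative[OF assms]])

lemma smooth_on_transition:
  assumes k: "k < 2"
  shows "smooth_on 2 (toverlap a b) (\<lambda>x. transition (tchart a) (tchart b) x k)"
proof (rule smooth_on_of_pdiff[OF openin_toverlap])
  have "continuous_map (subtopology (powertop_real {..<2}) (toverlap a b))
      (subtopology ttop (tq ` tbox b)) tq"
    by (intro continuous_map_into_subtopology continuous_map_from_subtopology continuous_map_tq)
      (auto simp: toverlap_iff)
  from continuous_map_compose[OF this continuous_map_tcoord]
  have "continuous_map (subtopology (powertop_real {..<2}) (toverlap a b))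
      (powertop_real {..<2}) (tcoord b \<circ> tq)"
    by (rule continuous_map_into_fulltopology)
  from continuous_map_compose[OF this continuous_map_coord[OF k]]
  show "continuous_map (subtopology (powertop_real {..<2}) (toverlap a b)) euclideanreal
      (\<lambda>x. transition (tchart a) (tchart b) x k)"
    by (rule continuous_map_eq)
      (use k in \<open>auto simp: transition_torus tcoord_def tq_def frac_frac_diff\<close>)
  show "(\<lambda>t. transition (tchart a) (tchart b) (x(i := t)) k) differentiable (at (x i))"
    if "i < 2" "x \<in> toverlap a b" for i x
    using transition_has_derivative[OF that(2,1) k] by (auto simp: real_differentiable_def)
  show "smooth_on 2 (toverlap a b) (pdiff i (\<lambda>x. transition (tchart a) (tchart b) x k))" if "i < 2" for i
    by (rule smooth_on_cong[OF openin_toverlap _ smooth_on_const[of _ _ "if i = k then 1 else 0"]])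
      (simp add: pdiff_transition that k)
qed

lemma tbox_cover:
  assumes "p \<in> tpts"
  shows "p \<in> tq ` tbox (\<lambda>i. p i - 1 / 2)"
  unfolding mem_chart_iff using assms
proof (intro conjI allI impI)
  fix i
  have "frac (1 / 2 :: real) = 1 / 2" by (intro frac_eq_id) simp
  then have "(1 / 2 :: real) \<notin> \<int>" by (metis frac_eq_0_iff zero_neq_one divide_eq_0_iff zero_neq_numeral)
  then show "frac (p i) \<noteq> frac (p i - 1 / 2)" by (simp add: frac_eq_frac_iff)
qed

lemma smooth_manifold_torus: "smooth_manifold torus"
  unfolding smooth_manifold_def
proof (intro conjI ballI allI impI)
  show "\<Union> (fst ` atlas torus) = topspace (mtop torus)"
    using tbox_cover unfolding torus_simps topspace_ttop tchart_def by fastforce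
  fix c d k assume cd: "c \<in> atlas torus" "d \<in> atlas torus" and "k < mdim torus"
  then obtain a b where "c = tchart a" "d = tchart b" by auto
  then show "smooth_on (mdim torus) (snd c ` (fst c \<inter> fst d)) (\<lambda>x. transition c d x k)"
    using smooth_on_transition[of k a b] \<open>k < mdim torus\<close> by (simp add: tchart_def toverlap_def)
qed (auto simp: ttop_Hausdorff ttop_second_countable is_chart_tchart)

text \<open>The Jacobian matrices of the transition maps are identities, so constant Kronecker
  components obey the transformation law.\<close>

lemma riemannian_manifold_torus: "riemannian_manifold torus"
  unfolding riemannian_manifold_def riemannian_metric_def
proof (intro conjI ballI allI impI smooth_manifold_torus)
  show "case c of (U, \<phi>) \<Rightarrow> \<forall>i<mdim torus. \<forall>j<mdim torus.
      smooth_on (mdim torus) (\<phi> ` U) (\<lambda>x. metr torus (U, \<phi>) (inv_into U \<phi> x) i j)" for c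
    by (auto simp: smooth_on_const)
  fix c d p i j assume c: "c \<in> atlas torus" and d: "d \<in> atlas torus" and p: "p \<in> fst c \<inter> fst d"
    and ij: "i < mdim torus" "j < mdim torus"
  then obtain a b where ab: "c = tchart a" "d = tchart b" by auto
  have z: "snd c p \<in> toverlap a b" using p ab by (auto simp: toverlap_def tchart_def)
  have "i < 2" "j < 2" using ij by auto
  then show "metr torus c p i j = (\<Sum>k<mdim torus. \<Sum>l<mdim torus. metr torus d p k l *
             pdiff i (\<lambda>x. transition c d x k) (snd c p) *
             pdiff j (\<lambda>x. transition c d x l) (snd c p))"
    using pdiff_transition[OF z[unfolded ab]] unfolding ab torus_simps
    by (auto simp: lessThan_two less_two_cases)
next
  fix c p and v :: "nat \<Rightarrow> real"
  assume "\<exists>i<mdim torus. v i \<noteq> 0"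
  then have "v 0 \<noteq> 0 \<or> v 1 \<noteq> 0" by (auto simp: less_two_cases)
  then have "0 < v 0 * v 0 + v 1 * v 1" by
      (metis add_pos_nonneg add_nonneg_pos mult_zero_left not_real_square_gt_zero zero_le_square)
  then show "0 < (\<Sum>i<mdim torus. \<Sum>j<mdim torus. metr torus c p i j * v i * v j)"
    by (simp add: lessThan_two)
qed auto

section \<open>The flat Laplacian\<close>

lemma metr_mat_torus: "metr_mat torus c p = 1\<^sub>m 2"
  by (rule eq_matI) auto

lemma vol_density_torus [simp]: "vol_density torus c p = 1"
  by (simp only: vol_density_def metr_mat_torus det_one real_sqrt_one)

text \<open>\<open>mat_inverse\<close> returns an option, so invertibility of the unit matrix has to
  be established before its value can be read off.\<close>

lemma inv_metr_torus:
  assumes "i < 2" "j < 2"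
  shows "inv_metr torus c p i j = (if i = j then 1 else 0)"
proof -
  have one: "1\<^sub>m 2 \<in> carrier_mat 2 2" by simp
  have "mat_inverse (1\<^sub>m 2 :: real mat) \<noteq> None"
  proof
    assume "mat_inverse (1\<^sub>m 2 :: real mat) = None"
    from mat_inverse(1)[OF one this] have "(1\<^sub>m 2 :: real mat) \<notin> Units (ring_mat TYPE(real) 2 ())" .
    moreover have "\<one>\<^bsub>ring_mat TYPE(real) 2 ()\<^esub> \<in> Units (ring_mat TYPE(real) 2 ())"
      by (rule monoid.Units_one_closed[OF ring.is_monoid[OF ring_mat]])
    ultimately show False by (simp add: ring_mat_simps)
  qed
  then obtain B where B: "mat_inverse (1\<^sub>m 2 :: real mat) = Some B" by blast
  then have "1\<^sub>m 2 * B = 1\<^sub>m 2" "B \<in> carrier_mat 2 2" using mat_inverse(2)[OF one B] by auto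
  then have "B = 1\<^sub>m 2" by simp
  then show ?thesis using assms unfolding inv_metr_def metr_mat_torus B by simp
qed

lemma laplacian_torus:
  assumes "z \<in> tbox a"
  shows "laplacian torus (tchart a) f (tq z)
    = pdiff 0 (pdiff 0 (\<lambda>x. f (tq x))) z + pdiff 1 (pdiff 1 (\<lambda>x. f (tq x))) z"
proof -
  let ?g = "\<lambda>x. f (inv_into (tq ` tbox a) (tcoord a) x)"
  have "laplacian torus (tchart a) f (tq z) = (\<Sum>i<2. pdiff i (pdiff i ?g) z)"
    unfolding laplacian_def
    by (simp add: tchart_def tcoord_tq[OF assms] inv_metr_torus lessThan_two)
  moreover have "pdiff i (pdiff i ?g) z = pdiff i (pdiff i (\<lambda>x. f (tq x))) z" if "i < 2" for i
    using fold_pdiff_chart[OF assms, of "[i, i]" f] that by simp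
  ultimately show ?thesis by (simp add: lessThan_two)
qed

lemma laplace_eigenfunction_torus_iff:
  "laplace_eigenfunction torus r f \<longleftrightarrow> (\<forall>a. smooth_on 2 (tbox a) (\<lambda>z. f (tq z))) \<and>
     (\<forall>a. \<forall>z\<in>tbox a. - (pdiff 0 (pdiff 0 (\<lambda>x. f (tq x))) z + pdiff 1 (pdiff 1 (\<lambda>x. f (tq x))) z)
         = r\<^sup>2 * f (tq z))"
  unfolding laplace_eigenfunction_def smooth_fun_torus_iff
  by (auto simp: laplacian_torus) (auto simp: tchart_def laplacian_torus[unfolded tchart_def])

lemma laplace_eigenfunction_cas2:
  "laplace_eigenfunction torus (2 * pi * sqrt (of_int (k\<^sup>2 + l\<^sup>2))) (cas2 (k, l))"
  unfolding laplace_eigenfunction_torus_iff cas2_tq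
proof (intro conjI allI ballI)
  show "smooth_on 2 (tbox a) (cas2 (k, l))" for a using smooth_on_cas2[of "tbox a" 1 k l] by simp
  fix z
  have "pdiff 0 (cas2 (k, l)) = (\<lambda>z. (2 * pi * of_int k) * cas2 (- k, l) z)"
    "pdiff 1 (cas2 (k, l)) = (\<lambda>z. (2 * pi * of_int l) * cas2 (k, - l) z)"
    using pdiff_cas2[of 1 k l] by simp_all
  then show "- (pdiff 0 (pdiff 0 (cas2 (k, l))) z + pdiff 1 (pdiff 1 (cas2 (k, l))) z)
      = (2 * pi * sqrt (of_int (k\<^sup>2 + l\<^sup>2)))\<^sup>2 * cas2 (k, l) z"
    by (simp only: pdiff_cas2) (simp add: power_mult_distrib power2_eq_square[of pi] algebra_simps
        power2_eq_square)
qed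

section \<open>The volume measure of the torus\<close>

definition vec2 :: "real \<times> real \<Rightarrow> nat \<Rightarrow> real" where
  "vec2 w = (\<lambda>i\<in>{..<2}. if i = 0 then fst w else snd w)"

definition tpair :: "real \<times> real \<Rightarrow> nat \<Rightarrow> real" where
  "tpair w = tq (vec2 w)"

lemma vec2_simps [simp]: "vec2 w 0 = fst w" "vec2 w (Suc 0) = snd w"
  by (simp_all add: vec2_def)

lemma continuous_map_vec2: "continuous_map euclidean (powertop_real {..<2}) vec2"
  unfolding continuous_map_componentwise
proof (intro conjI ballI)
  fix k assume "k \<in> {..<2::nat}"
  then have "(\<lambda>w. vec2 w k) = (if k = 0 then fst else snd)" by (auto simp: vec2_def fun_eq_iff)
  then show "continuous_map euclidean euclideanreal (\<lambda>w. vec2 w k)"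
    by (auto intro: continuous_on_fst continuous_on_snd continuous_on_id)
qed (auto simp: vec2_def)

lemma tpair_eta: "tpair (z 0, z 1) = tq z"
  by (auto simp: tpair_def tq_def vec2_def fun_eq_iff less_two_cases restrict_def)

lemma tpair_shift: "tpair (x + 1, y) = tpair (x, y)" "tpair (x, y + 1) = tpair (x, y)"
  using frac_add_int[of _ 1] by (auto simp: tpair_def tq_def vec2_def fun_eq_iff)

lemma continuous_map_tpair: "continuous_map euclidean ttop tpair"
  using continuous_map_compose[OF continuous_map_vec2 continuous_map_tq]
  by (simp add: o_def tpair_def[abs_def])

lemma cas2_tpair: "cas2 b (tpair w) = cas (fst b) (fst w) * cas (snd b) (snd w)"
  by (simp only: tpair_def cas2_tq) (simp add: cas2_def)

abbreviation tborel :: "(nat \<Rightarrow> real) measure" where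
  "tborel \<equiv> borel_algebra ttop"

lemma opens_subset: "{U. openin ttop U} \<subseteq> Pow tpts"
  using openin_subset[of ttop] by auto

lemma space_tborel [simp]: "space tborel = tpts"
  by (simp add: borel_algebra_def opens_subset)

lemma sets_tborel: "sets tborel = sigma_sets tpts {U. openin ttop U}"
  by (simp add: borel_algebra_def opens_subset)

lemma openin_tborel: "openin ttop U \<Longrightarrow> U \<in> sets tborel"
  by (auto simp: sets_tborel)

lemma tpair_measurable [measurable]: "tpair \<in> borel \<rightarrow>\<^sub>M tborel"
  unfolding borel_algebra_def topspace_ttop
proof (rule measurable_measure_of[OF opens_subset])
  fix U assume "U \<in> {U. openin ttop U}"
  then have "open (tpair -` U)"
    using openin_continuous_map_preimage[OF continuous_map_tpair, of U] by (simp add: vimage_def)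
  then show "tpair -` U \<inter> space borel \<in> sets borel" by simp
qed (simp add: tpair_def)

text \<open>On each chart domain f is its lift to the plane composed with the chart coordinates;
  pasting over the open cover by charts gives continuity on the torus.\<close>

lemma continuous_map_torus_lift:
  assumes "continuous_on UNIV (\<lambda>w. f (tpair w))"
  shows "continuous_map ttop euclideanreal f"
proof (rule pasting_lemma[where I = UNIV and T = "\<lambda>a. tq ` tbox a" and f = "\<lambda>a. f"])
  fix a
  have pair: "continuous_map (powertop_real {..<2::nat}) euclidean (\<lambda>z. (z 0 :: real, z 1 :: real))"
    using continuous_map_pairedI[OF continuous_map_coord[of 0] continuous_map_coord[of 1]] by simp
  have "continuous_map euclidean euclideanreal (\<lambda>w. f (tpair w))" using assms by simp
  from continuous_map_compose[OF pair this]
  have "continuous_map (powertop_real {..<2}) euclideanreal (\<lambda>z. f (tq z))"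
    using tpair_eta by (simp add: o_def)
  from continuous_map_compose[OF continuous_map_into_fulltopology[OF continuous_map_tcoord] this]
  show "continuous_map (subtopology ttop (tq ` tbox a)) euclideanreal f"
    by (rule continuous_map_eq) (auto simp: tcoord_tq)
next
  fix p assume "p \<in> topspace ttop"
  then show "\<exists>a. a \<in> UNIV \<and> p \<in> tq ` tbox a \<and> f p = f p" using tbox_cover[of p]
    by (intro exI[of _ "\<lambda>i. p i - 1 / 2"]) simp
qed (auto simp: openin_chart)

lemma measurable_torus_lift:
  fixes f :: "(nat \<Rightarrow> real) \<Rightarrow> real"
  assumes "continuous_on UNIV (\<lambda>w. f (tpair w))"
  shows "f \<in> borel_measurable tborel"
proof (rule borel_measurableI)
  fix S :: "real set" assume "open S"
  then have "openin ttop {p \<in> topspace ttop. f p \<in> S}"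
    using openin_continuous_map_preimage[OF continuous_map_torus_lift[OF assms]] by auto
  moreover have "{p \<in> topspace ttop. f p \<in> S} = f -` S \<inter> space tborel" by auto
  ultimately show "f -` S \<inter> space tborel \<in> sets tborel" using openin_tborel by simp
qed

section \<open>Lebesgue measure on the unit square and its image on the torus\<close>

definition usquare :: "(real \<times> real) measure" where
  "usquare = unit_leb \<Otimes>\<^sub>M unit_leb"

lemma sets_usquare [simp, measurable_cong]: "sets usquare = sets borel"
  by (metis usquare_def borel_prod sets_pair_measure_cong sets_unit_leb)

lemma space_usquare [simp]: "space usquare = UNIV"
  by (simp add: usquare_def space_pair_measure)

lemma emeasure_unit_leb_UNIV: "emeasure unit_leb UNIV = 1"
  by (simp add: emeasure_unit_leb)

interpretation usquare: finite_measure usquare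
proof
  have "emeasure usquare (UNIV \<times> UNIV) = emeasure unit_leb UNIV * emeasure unit_leb UNIV"
    unfolding usquare_def by (rule unit_leb.emeasure_pair_measure_Times) auto
  then show "emeasure usquare (space usquare) \<noteq> \<infinity>" by (simp add: emeasure_unit_leb_UNIV)
qed

interpretation unit_pair: pair_sigma_finite unit_leb unit_leb ..

lemma measure_usquare_Times:
  assumes "A \<in> sets borel" "B \<in> sets borel"
  shows "measure usquare (A \<times> B) = measure unit_leb A * measure unit_leb B"
  using unit_leb.emeasure_pair_measure_Times[of A unit_leb B] assms
  by (simp add: measure_def usquare_def enn2real_mult)

lemma measure_usquare_UNIV: "measure usquare UNIV = 1"
  using measure_usquare_Times[of UNIV UNIV] by (simp add: measure_unit_leb_UNIV)

lemma integrable_usquare_bounded: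
  fixes f :: "real \<times> real \<Rightarrow> real"
  assumes "f \<in> borel_measurable borel" "\<And>x. \<bar>f x\<bar> \<le> B"
  shows "integrable usquare f"
  using assms by (intro usquare.integrable_const_bound[where B = B]) auto

lemma integral_usquare_iterated:
  fixes f :: "real \<times> real \<Rightarrow> real"
  assumes "integrable usquare f"
  shows "(\<integral>w. f w \<partial>usquare) = (\<integral>x. (\<integral>y. f (x, y) \<partial>unit_leb) \<partial>unit_leb)"
    and "(\<integral>w. f w \<partial>usquare) = (\<integral>y. (\<integral>x. f (x, y) \<partial>unit_leb) \<partial>unit_leb)"
proof -
  have i: "integrable (unit_leb \<Otimes>\<^sub>M unit_leb) f" using assms by (simp add: usquare_def)
  show "(\<integral>w. f w \<partial>usquare) = (\<integral>x. (\<integral>y. f (x, y) \<partial>unit_leb) \<partial>unit_leb)"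
    unfolding usquare_def by (rule unit_pair.integral_fst'[OF i, symmetric])
  show "(\<integral>w. f w \<partial>usquare) = (\<integral>y. (\<integral>x. f (x, y) \<partial>unit_leb) \<partial>unit_leb)"
    unfolding usquare_def using unit_pair.integral_snd[of "\<lambda>x y. f (x, y)"] i by simp
qed

definition tvol :: "(nat \<Rightarrow> real) measure" where
  "tvol = distr usquare tborel tpair"

lemma sets_tvol [simp, measurable_cong]: "sets tvol = sets tborel"
  and space_tvol [simp]: "space tvol = tpts"
  by (simp_all add: tvol_def)

interpretation tvol: finite_measure tvol
  unfolding tvol_def by (rule usquare.finite_measure_distr) simp

lemma integral_tvol:
  fixes f :: "(nat \<Rightarrow> real) \<Rightarrow> real"
  assumes "f \<in> borel_measurable tborel"
  shows "(\<integral>p. f p \<partial>tvol) = (\<integral>w. f (tpair w) \<partial>usquare)"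
  unfolding tvol_def using assms by (intro integral_distr) auto

text \<open>The period starting at a is cut at the integer \<open>n\<close> = ceiling of a. Its left
  piece is translated by n - 1 and its right piece by n, and together they fill the unit
  interval.\<close>

lemma nn_integral_periodic:
  fixes h :: "real \<Rightarrow> ennreal"
  assumes [measurable]: "h \<in> borel_measurable borel" and per: "\<And>x. h (x + 1) = h x"
  shows "(\<integral>\<^sup>+x. indicator {a..<a + 1} x * h x \<partial>lborel) = (\<integral>\<^sup>+x. indicator {0..<1} x * h x \<partial>lborel)"
proof -
  have pern: "h (x + of_int n) = h x" for x and n :: int
  proof (induction n rule: int_induct[where k = 0])
    case (step1 i)
    then show ?case using per[of "x + of_int i"] by (simp add: add.assoc)
  next
    case (step2 i)
    then show ?case using per[of "x + of_int (i - 1)"] by (simp add: add.assoc)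
  qed simp
  have shift: "(\<integral>\<^sup>+x. indicator {u..<v} x * h x \<partial>lborel)
      = (\<integral>\<^sup>+x. indicator {u - of_int n..<v - of_int n} x * h x \<partial>lborel)" for u v :: real and n :: int
    by (subst nn_integral_real_affine[where c = 1 and t = "of_int n"], simp, simp)
      (auto intro!: nn_integral_cong simp: indicator_def pern add.commute[of "of_int n"])
  define n where "n = \<lceil>a\<rceil>"
  have n: "of_int n - 1 < a" "a \<le> of_int n" unfolding n_def by linarith+
  have split: "(\<integral>\<^sup>+x. indicator {u..<w} x * h x \<partial>lborel)
      = (\<integral>\<^sup>+x. indicator {u..<v} x * h x \<partial>lborel) + (\<integral>\<^sup>+x. indicator {v..<w} x * h x \<partial>lborel)"
    if "u \<le> v" "v \<le> w" for u v w :: real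
  proof -
    have "(\<integral>\<^sup>+x. indicator {u..<w} x * h x \<partial>lborel)
        = (\<integral>\<^sup>+x. indicator {u..<v} x * h x + indicator {v..<w} x * h x \<partial>lborel)"
      using that by (intro nn_integral_cong) (auto simp: indicator_def)
    then show ?thesis by (simp add: nn_integral_add)
  qed
  have "(\<integral>\<^sup>+x. indicator {a..<a + 1} x * h x \<partial>lborel)
      = (\<integral>\<^sup>+x. indicator {a..<of_int n} x * h x \<partial>lborel) + (\<integral>\<^sup>+x. indicator {of_int n..<a + 1} x
          * h x \<partial>lborel)"
    using n by (intro split) auto
  also have "(\<integral>\<^sup>+x. indicator {a..<of_int n} x * h x \<partial>lborel)
      = (\<integral>\<^sup>+x. indicator {a + 1 - of_int n..<1} x * h x \<partial>lborel)"
    using shift[of a "of_int n" "n - 1"] by (simp add: algebra_simps)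
  also have "(\<integral>\<^sup>+x. indicator {of_int n..<a + 1} x * h x \<partial>lborel)
      = (\<integral>\<^sup>+x. indicator {0..<a + 1 - of_int n} x * h x \<partial>lborel)"
    using shift[of "of_int n" "a + 1" n] by simp
  finally show ?thesis
    using split[of 0 "a + 1 - of_int n" 1] n by (simp add: add.commute)
qed

lemma nn_integral_unit_leb:
  assumes [measurable]: "f \<in> borel_measurable borel"
  shows "(\<integral>\<^sup>+x. f x \<partial>unit_leb) = (\<integral>\<^sup>+x. indicator {0..<1} x * f x \<partial>lborel)"
  unfolding unit_leb_def by (rule nn_integral_density) auto

abbreviation pleb :: "(nat \<Rightarrow> real) measure" where
  "pleb \<equiv> Pi\<^sub>M {..<2} (\<lambda>_. lborel)"

lemma vec2_measurable [measurable]: "vec2 \<in> borel \<rightarrow>\<^sub>M pleb"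
proof -
  have "vec2 \<in> borel \<Otimes>\<^sub>M borel \<rightarrow>\<^sub>M pleb"
    unfolding vec2_def[abs_def]
  proof (rule measurable_restrict)
    fix i :: nat
    show "(\<lambda>w. if i = 0 then fst w else snd w) \<in> borel \<Otimes>\<^sub>M borel \<rightarrow>\<^sub>M (lborel :: real measure)"
      by (cases "i = 0") auto
  qed
  then show ?thesis by (simp add: borel_prod)
qed

lemma vec2_vimage_PiE: "vec2 -` Pi\<^sub>E {..<2} A = A 0 \<times> A 1"
proof (rule Set.set_eqI)
  fix w :: "real \<times> real"
  have "vec2 w \<in> extensional {..<2}" by (simp add: vec2_def)
  then have "vec2 w \<in> Pi\<^sub>E {..<2} A \<longleftrightarrow> vec2 w 0 \<in> A 0 \<and> vec2 w 1 \<in> A 1"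
    by (simp add: PiE_iff lessThan_two)
  then show "w \<in> vec2 -` Pi\<^sub>E {..<2} A \<longleftrightarrow> w \<in> A 0 \<times> A 1"
    by (simp add: mem_Times_iff)
qed

text \<open>Links the product over the index set, in which the volume is specified, to the binary
  product, in which Fubini is applied.\<close>

lemma pleb_eq: "pleb = distr (lborel \<Otimes>\<^sub>M lborel) pleb vec2"
proof -
  interpret product_sigma_finite "\<lambda>_::nat. lborel :: real measure" ..
  show ?thesis
  proof (rule PiM_eqI[symmetric])
    fix A :: "nat \<Rightarrow> real set" assume A: "\<And>i. i \<in> {..<2} \<Longrightarrow> A i \<in> sets lborel"
    have "Pi\<^sub>E {..<2} A \<in> sets pleb" using A by (intro sets_PiM_I_finite) auto
    then have "emeasure (distr (lborel \<Otimes>\<^sub>M lborel) pleb vec2) (Pi\<^sub>E {..<2} A)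
        = emeasure (lborel \<Otimes>\<^sub>M lborel) (A 0 \<times> A 1)"
      by (subst emeasure_distr) (auto simp: vec2_vimage_PiE lborel_prod space_pair_measure)
    also have "\<dots> = emeasure lborel (A 0) * emeasure lborel (A 1)"
      using A by (intro sigma_finite_measure.emeasure_pair_measure_Times sigma_finite_lborel) auto
    finally show "emeasure (distr (lborel \<Otimes>\<^sub>M lborel) pleb vec2) (Pi\<^sub>E {..<2} A)
        = (\<Prod>i\<in>{..<2}. emeasure lborel (A i))"
      by (simp add: lessThan_two)
  qed auto
qed

lemma tq_measurable [measurable]: "tq \<in> pleb \<rightarrow>\<^sub>M tborel"
proof -
  have "(\<lambda>z. (z 0, z 1)) \<in> pleb \<rightarrow>\<^sub>M lborel \<Otimes>\<^sub>M lborel"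
    by (intro measurable_Pair measurable_component_singleton) auto
  then have "(\<lambda>z. (z 0, z 1)) \<in> pleb \<rightarrow>\<^sub>M (borel :: (real \<times> real) measure)"
    by (simp add: lborel_prod)
  from measurable_compose[OF this tpair_measurable] show ?thesis unfolding tpair_eta .
qed

lemma vec2_mem_tbox: "vec2 (x, y) \<in> tbox a \<longleftrightarrow> x \<in> {a 0<..<a 0 + 1} \<and> y \<in> {a 1<..<a 1 + 1}"
proof -
  have "vec2 (x, y) \<in> extensional {..<2}" by (simp add: vec2_def)
  then show ?thesis by (simp add: tbox_def PiE_iff lessThan_two)
qed

text \<open>Periodicity in each variable moves the unit square to the half-open box with corner
  \<open>a\<close>. The lower edges of that box project to the circles omitted by the chart, so on
  \<open>A\<close> the half-open and the open box agree.\<close>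

lemma emeasure_tvol_chart:
  assumes A: "A \<in> sets tborel" "A \<subseteq> tq ` tbox a"
  shows "emeasure tvol A = emeasure pleb (tcoord a ` A)"
    and "tcoord a ` A \<in> sets pleb"
proof -
  let ?h = "\<lambda>x y. indicator A (tpair (x, y)) :: ennreal"
  have hm: "(\<lambda>w. indicator A (tpair w) :: ennreal) \<in> borel_measurable borel"
    using A(1) by measurable
  have hx [measurable]: "(\<lambda>x. ?h x y) \<in> borel_measurable borel" for y
    by (intro measurable_compose[OF _ hm]) (auto simp: borel_prod[symmetric])
  have hy [measurable]: "(\<lambda>y. ?h x y) \<in> borel_measurable borel" for x
    by (intro measurable_compose[OF _ hm]) (auto simp: borel_prod[symmetric])
  have img: "tcoord a ` A = tq -` A \<inter> tbox a"
    using A(2) by (auto simp: tcoord_tq image_iff) (metis tcoord_tq)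
  have "tbox a \<in> sets pleb" unfolding tbox_def by (intro sets_PiM_I_finite) auto
  moreover have "tq -` A \<inter> space pleb \<in> sets pleb" using A(1) by measurable
  moreover have "tq -` A \<inter> tbox a = (tq -` A \<inter> space pleb) \<inter> tbox a"
    using sets.sets_into_space[OF \<open>tbox a \<in> sets pleb\<close>] by auto
  ultimately show B: "tcoord a ` A \<in> sets pleb" unfolding img by auto
  have "emeasure tvol A = emeasure usquare (tpair -` A)"
    unfolding tvol_def using A(1) by (subst emeasure_distr) auto
  also have "\<dots> = (\<integral>\<^sup>+x. \<integral>\<^sup>+y. indicator (tpair -` A) (x, y) \<partial>unit_leb \<partial>unit_leb)"
    unfolding usquare_def
  proof (rule unit_leb.emeasure_pair_measure)
    have "tpair -` A \<inter> space borel \<in> sets borel" using A(1)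
        by (intro measurable_sets[OF tpair_measurable])
    then show "tpair -` A \<in> sets (unit_leb \<Otimes>\<^sub>M unit_leb)"
      unfolding usquare_def[symmetric] sets_usquare by simp
  qed
  also have "\<dots> = (\<integral>\<^sup>+x. \<integral>\<^sup>+y. ?h x y \<partial>unit_leb \<partial>unit_leb)"
    by (intro nn_integral_cong) (simp add: indicator_def)
  also have "\<dots> = (\<integral>\<^sup>+x. indicator {0..<1} x * (\<integral>\<^sup>+y. indicator {0..<1} y * ?h x y \<partial>lborel) \<partial>lborel)"
  proof -
    have m: "(\<lambda>x. \<integral>\<^sup>+y. ?h x y \<partial>unit_leb) \<in> borel_measurable borel"
      using unit_leb.borel_measurable_nn_integral[of "\<lambda>x y. ?h x y" borel] hm
      by (simp add: borel_prod case_prod_beta' measurable_cong_sets[OF sets_pair_measure_cong[OF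
          refl sets_unit_leb] refl])
    show ?thesis using nn_integral_unit_leb[OF m] by (simp add: nn_integral_unit_leb[OF hy])
  qed
  also have "\<dots> = (\<integral>\<^sup>+x. indicator {0..<1} x * (\<integral>\<^sup>+y. indicator {a 1..<a 1 + 1} y
      * ?h x y \<partial>lborel) \<partial>lborel)"
    by (simp only: nn_integral_periodic[OF hy, of _ "a 1", unfolded tpair_shift, OF refl])
  also have "\<dots> = (\<integral>\<^sup>+x. indicator {a 0..<a 0 + 1} x * (\<integral>\<^sup>+y. indicator {a 1..<a 1 + 1} y
      * ?h x y \<partial>lborel) \<partial>lborel)"
  proof (rule nn_integral_periodic[symmetric])
    have "(\<lambda>w. indicator {a 1..<a 1 + 1} (snd w) * indicator A (tpair w) :: ennreal)
        \<in> borel_measurable (borel \<Otimes>\<^sub>M lborel)"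
      using hm by (intro borel_measurable_times_ennreal measurable_compose[OF measurable_snd])
          (auto simp: borel_prod measurable_cong_sets[OF sets_pair_measure_cong[OF refl sets_lborel]
          refl])
    then show "(\<lambda>x. \<integral>\<^sup>+y. indicator {a 1..<a 1 + 1} y * ?h x y \<partial>lborel) \<in> borel_measurable borel"
      by (intro sigma_finite_measure.borel_measurable_nn_integral[OF sigma_finite_lborel])
          (simp add: case_prod_beta')
  qed (simp add: tpair_shift)
  also have "\<dots> = (\<integral>\<^sup>+x. \<integral>\<^sup>+y. indicator (vec2 -` (tcoord a ` A)) (x, y) \<partial>lborel \<partial>lborel)"
  proof (intro nn_integral_cong)
    fix x
    have "indicator {a 0..<a 0 + 1} x * (indicator {a 1..<a 1 + 1} y * ?h x y)
        = (indicator (vec2 -` (tcoord a ` A)) (x, y) :: ennreal)" for y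
    proof (cases "tpair (x, y) \<in> A")
      case True
      then have "tpair (x, y) \<in> tq ` tbox a" using A(2) by blast
      then have ne: "frac (tpair (x, y) i) \<noteq> frac (a i)" if "i < 2" for i
        unfolding mem_chart_iff using that by blast
      have "x \<noteq> a 0" "y \<noteq> a 1" using ne[of 0] ne[of 1] by (auto simp: tpair_def tq_def)
      then show ?thesis using True unfolding img
        by (auto simp: indicator_def vec2_mem_tbox tpair_def)
    next
      case False
      then show ?thesis unfolding img by (auto simp: indicator_def tpair_def)
    qed
    then show "indicator {a 0..<a 0 + 1} x * (\<integral>\<^sup>+y. indicator {a 1..<a 1 + 1} y * ?h x y \<partial>lborel)
        = (\<integral>\<^sup>+y. indicator (vec2 -` (tcoord a ` A)) (x, y) \<partial>lborel)"
      by (subst nn_integral_cmult[symmetric]) auto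
  qed
  also have "\<dots> = emeasure (lborel \<Otimes>\<^sub>M lborel) (vec2 -` (tcoord a ` A))"
  proof (rule sigma_finite_measure.emeasure_pair_measure[OF sigma_finite_lborel, symmetric])
    have "vec2 -` (tcoord a ` A) \<inter> space borel \<in> sets borel" using B
        by (intro measurable_sets[OF vec2_measurable])
    then show "vec2 -` (tcoord a ` A) \<in> sets (lborel \<Otimes>\<^sub>M lborel)" unfolding lborel_prod by simp
  qed
  also have "\<dots> = emeasure pleb (tcoord a ` A)"
  proof -
    have "vec2 \<in> lborel \<Otimes>\<^sub>M lborel \<rightarrow>\<^sub>M pleb" by (simp add: lborel_prod)
    from emeasure_distr[OF this B]
    have "emeasure (distr (lborel \<Otimes>\<^sub>M lborel) pleb vec2) (tcoord a ` A)
        = emeasure (lborel \<Otimes>\<^sub>M lborel) (vec2 -` (tcoord a ` A))"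
      by (simp add: space_pair_measure)
    then show ?thesis unfolding pleb_eq[symmetric] by simp
  qed
  finally show "emeasure tvol A = emeasure pleb (tcoord a ` A)" .
qed

text \<open>\<open>riem_vol\<close> is a definite description, so both existence and uniqueness are
  needed. For uniqueness a Borel set is cut into disjoint pieces each inside one chart, where the
  measure is prescribed.\<close>

lemma riem_vol_torus: "riem_vol torus = tvol"
proof -
  have dens: "(\<integral>\<^sup>+x\<in>B. ennreal (vol_density torus c (f x)) \<partial>pleb) = emeasure pleb B"
    if "B \<in> sets pleb" for B c f
    using that by simp
  \<comment> \<open>The bits of n choose a corner with coordinates 0 or 1/2. A coordinate of p
    congruent to 0 takes the corner 1/2 and any other takes 0, so four charts cover the torus;
    indexing by all naturals suits \<open>disjointed\<close>.\<close>
  define b :: "nat \<Rightarrow> nat \<Rightarrow> real" where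
    "b n = (\<lambda>i. if i = 0 then of_bool (odd n) / 2 else of_bool (odd (n div 2)) / 2)" for n
  define C where "C n = tq ` tbox (b n)" for n
  have C_sets: "C n \<in> sets tborel" for n unfolding C_def by (intro openin_tborel openin_chart)
  have half: "frac (1 / 2 :: real) = 1 / 2" by (intro frac_eq_id) simp
  have cover: "\<exists>n. p \<in> C n" if "p \<in> tpts" for p
  proof -
    define u where "u = (frac (p 0) = 0)"
    define v where "v = (frac (p 1) = 0)"
    define n where "n = of_bool u + 2 * (of_bool v :: nat)"
    have "odd n \<longleftrightarrow> u" "odd (n div 2) \<longleftrightarrow> v" by (auto simp: n_def)
    then have "p \<in> C n" using that half by
        (auto simp: C_def b_def mem_chart_iff less_two_cases u_def v_def simp del: frac_eq_0_iff)
    then show ?thesis ..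
  qed
  have unique: "\<nu> = tvol" if s: "sets \<nu> = sets tborel"
    and e: "\<And>a A. A \<in> sets tborel \<Longrightarrow> A \<subseteq> tq ` tbox a \<Longrightarrow> emeasure \<nu> A = emeasure pleb (tcoord a ` A)" for \<nu>
  proof (rule measure_eqI)
    fix A assume "A \<in> sets \<nu>"
    then have A: "A \<in> sets tborel" using s by simp
    let ?D = "\<lambda>n. A \<inter> disjointed C n"
    have D: "?D n \<in> sets tborel" for n
      using A sets.range_disjointed_sets[of C tborel] C_sets by auto
    then have rD: "range ?D \<subseteq> sets tborel" by auto
    have sub: "?D n \<subseteq> C n" for n using disjointed_subset[of C n] by auto
    have dis: "disjoint_family ?D"
      using disjoint_family_disjointed[of C] by (auto simp: disjoint_family_on_def)
    have "A \<subseteq> tpts" using sets.sets_into_space[OF A] by simp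
    then have "A \<subseteq> (\<Union>n. C n)" using cover by auto
    then have UN: "(\<Union>n. ?D n) = A" unfolding Int_UN_distrib[symmetric] UN_disjointed_eq
        by (rule Int_absorb2)
    have "emeasure \<nu> A = (\<Sum>n. emeasure \<nu> (?D n))"
      using suminf_emeasure[of ?D \<nu>] rD s dis UN by simp
    also have "\<dots> = (\<Sum>n. emeasure tvol (?D n))"
    proof -
      have "emeasure \<nu> (?D n) = emeasure tvol (?D n)" for n
        using e[OF D[of n], of "b n"] emeasure_tvol_chart(1)[OF D[of n], of "b n"] sub[of n]
        by (simp add: C_def)
      then show ?thesis by simp
    qed
    also have "\<dots> = emeasure tvol A"
      using suminf_emeasure[of ?D tvol] rD dis UN by simp
    finally show "emeasure \<nu> A = emeasure tvol A" .
  qed (simp add: s)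
  show ?thesis unfolding riem_vol_def
  proof (rule the_equality)
    show "sets tvol = sets (borel_algebra (mtop torus)) \<and> (\<forall>(U, \<phi>)\<in>atlas torus. \<forall>A\<in>sets
        (borel_algebra (mtop torus)). A \<subseteq> U \<longrightarrow>
        emeasure tvol A = (\<integral>\<^sup>+x\<in>\<phi> ` A. ennreal (vol_density torus (U, \<phi>)
            (inv_into U \<phi> x)) \<partial>Pi\<^sub>M {..<mdim torus} (\<lambda>_. lborel)))"
      using emeasure_tvol_chart dens by (simp add: tchart_def)
    fix \<nu> assume nu: "sets \<nu> = sets (borel_algebra (mtop torus)) \<and> (\<forall>(U, \<phi>)\<in>atlas torus. \<forall>A\<in>sets
        (borel_algebra (mtop torus)). A \<subseteq> U \<longrightarrow>
        emeasure \<nu> A = (\<integral>\<^sup>+x\<in>\<phi> ` A. ennreal (vol_density torus (U, \<phi>)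
            (inv_into U \<phi> x)) \<partial>Pi\<^sub>M {..<mdim torus} (\<lambda>_. lborel)))"
    show "\<nu> = tvol"
    proof (rule unique)
      fix a A assume A: "A \<in> sets tborel" "A \<subseteq> tq ` tbox a"
      show "emeasure \<nu> A = emeasure pleb (tcoord a ` A)"
        using nu A emeasure_tvol_chart(2)[OF A] dens by (simp add: tchart_def)
    qed (use nu in simp)
  qed
qed

section \<open>Trigonometric polynomials on the torus\<close>

inductive_set trigpoly :: "((nat \<Rightarrow> real) \<Rightarrow> real) set" where
  cas2: "cas2 b \<in> trigpoly"
| add: "f \<in> trigpoly \<Longrightarrow> g \<in> trigpoly \<Longrightarrow> (\<lambda>z. f z + g z) \<in> trigpoly"
| scale: "f \<in> trigpoly \<Longrightarrow> (\<lambda>z. c * f z) \<in> trigpoly"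

lemma trigpoly_const: "(\<lambda>z. c) \<in> trigpoly"
  using trigpoly.scale[OF trigpoly.cas2[of "(0, 0)"], of c] by simp

lemma trigpoly_product_formula:
  assumes "f1 \<in> trigpoly" "f2 \<in> trigpoly" "f3 \<in> trigpoly" "f4 \<in> trigpoly"
  shows "(\<lambda>z. (f1 z + f2 z + f3 z - f4 z) / 2) \<in> trigpoly"
proof -
  have "(\<lambda>z. (1 / 2) * (((f1 z + f2 z) + f3 z) + (- 1) * f4 z)) \<in> trigpoly"
    by (intro trigpoly.add trigpoly.scale assms)
  then show ?thesis by simp
qed

text \<open>The product formula is applied in the second variable with a spectator factor
  \<open>cas a\<close>, and then in the first, where it produces exactly such factors.\<close>

lemma trigpoly_mult_base: "(\<lambda>z. cas2 b z * cas2 b' z) \<in> trigpoly"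
proof -
  obtain k l k' l' where b: "b = (k, l)" "b' = (k', l')" by (metis surj_pair)
  have h: "(\<lambda>z. cas a (z 0) * (cas l (z 1) * cas l' (z 1))) \<in> trigpoly" for a
  proof -
    have "(\<lambda>z. cas a (z 0) * (cas l (z 1) * cas l' (z 1)))
        = (\<lambda>z. (cas2 (a, l - l') z + cas2 (a, l' - l) z + cas2 (a, l + l') z - cas2 (a, - l
            - l') z) / 2)"
      unfolding cas_mult[of l _ l'] cas2_def by (simp add: fun_eq_iff right_diff_distrib distrib_left)
    then show ?thesis by (simp only: trigpoly_product_formula trigpoly.cas2)
  qed
  have "(\<lambda>z. cas2 b z * cas2 b' z)
      = (\<lambda>z. (cas k (z 0) * cas k' (z 0)) * (cas l (z 1) * cas l' (z 1)))"
    by (simp add: b cas2_def fun_eq_iff)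
  also have "\<dots> = (\<lambda>z. (cas (k - k') (z 0) * (cas l (z 1) * cas l' (z 1)) + cas (k' - k) (z 0)
      * (cas l (z 1) * cas l' (z 1))
      + cas (k + k') (z 0) * (cas l (z 1) * cas l' (z 1)) - cas (- k - k') (z 0) * (cas l (z 1)
          * cas l' (z 1))) / 2)"
    unfolding cas_mult[of k] by (simp add: fun_eq_iff left_diff_distrib distrib_right)
  finally show ?thesis using trigpoly_product_formula[OF h h h h] by simp
qed

lemma trigpoly_mult:
  assumes f: "f \<in> trigpoly" and g: "g \<in> trigpoly"
  shows "(\<lambda>z. f z * g z) \<in> trigpoly"
  using f
proof induction
  case (cas2 b)
  show ?case using g
  proof induction
    case (cas2 b') then show ?case by (rule trigpoly_mult_base)
  next
    case (add f g)
    then show ?case using trigpoly.add[OF add.IH] by (simp add: distrib_left)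
  next
    case (scale f c)
    then show ?case using trigpoly.scale[OF scale.IH, of c] by (simp add: mult.left_commute)
  qed
next
  case (add f1 f2)
  then show ?case using trigpoly.add[OF add.IH] by (simp add: distrib_right)
next
  case (scale f1 c)
  then show ?case using trigpoly.scale[OF scale.IH, of c] by (simp add: mult.assoc)
qed

lemma continuous_on_cas2_tpair: "continuous_on UNIV (\<lambda>w. cas2 b (tpair w))"
  unfolding cas2_tpair by (intro continuous_intros)

lemma cas2_bound: "\<bar>cas2 b z\<bar> \<le> 4"
  using mult_mono[OF cas_bound[of "fst b" "z 0"] cas_bound[of "snd b" "z 1"]]
  by (simp add: cas2_def abs_mult)

lemma trigpoly_props:
  assumes "f \<in> trigpoly"
  shows "continuous_on UNIV (\<lambda>w. f (tpair w)) \<and> (\<exists>B. \<forall>z. \<bar>f z\<bar> \<le> B) \<and>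
    (\<exists>J c. finite J \<and> f = (\<lambda>z. \<Sum>b\<in>J. c b * cas2 b z))"
  using assms
proof induction
  case (cas2 b)
  show ?case
  proof (intro conjI)
    show "\<exists>B. \<forall>z. \<bar>cas2 b z\<bar> \<le> B" using cas2_bound[of b] by blast
    show "\<exists>J c. finite J \<and> cas2 b = (\<lambda>z. \<Sum>b\<in>J. c b * cas2 b z)"
      by (intro exI[of _ "{b}"] exI[of _ "\<lambda>_. 1"]) simp
  qed (rule continuous_on_cas2_tpair)
next
  case (add f g)
  then obtain B B' where "\<And>z. \<bar>f z\<bar> \<le> B" "\<And>z. \<bar>g z\<bar> \<le> B'" by auto
  then have "\<bar>f z + g z\<bar> \<le> B + B'" for z
      using abs_triangle_ineq[of "f z" "g z"] add_mono order_trans by blast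
  moreover obtain J c J' c' where J: "finite J" "f = (\<lambda>z. \<Sum>b\<in>J. c b * cas2 b z)"
    "finite J'" "g = (\<lambda>z. \<Sum>b\<in>J'. c' b * cas2 b z)" using add.IH by blast
  have "f z + g z = (\<Sum>b\<in>J \<union> J'. ((if b \<in> J then c b else 0) + (if b
      \<in> J' then c' b else 0)) * cas2 b z)" for z
  proof -
    have "f z = (\<Sum>b\<in>J \<union> J'. (if b \<in> J then c b else 0) * cas2 b z)"
      unfolding J using J by (intro sum.mono_neutral_cong_left) auto
    moreover have "g z = (\<Sum>b\<in>J \<union> J'. (if b \<in> J' then c' b else 0) * cas2 b z)"
      unfolding J using J by (intro sum.mono_neutral_cong_left) auto
    ultimately show ?thesis by (simp add: distrib_right sum.distrib)
  qed
  then have "\<exists>J c. finite J \<and> (\<lambda>z. f z + g z) = (\<lambda>z. \<Sum>b\<in>J. c b * cas2 b z)"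
    using J(1,3) by (intro exI[of _ "J \<union> J'"] exI[of _ "\<lambda>b. (if b \<in> J then c b else 0) + (if b
        \<in> J' then c' b else 0)"]) auto
  ultimately show ?case using add.IH by (auto intro: continuous_on_add)
next
  case (scale f c)
  then obtain B where "\<And>z. \<bar>f z\<bar> \<le> B" by auto
  then have "\<bar>c * f z\<bar> \<le> \<bar>c\<bar> * B" for z by (simp add: abs_mult mult_left_mono)
  moreover obtain J d where "finite J" "f = (\<lambda>z. \<Sum>b\<in>J. d b * cas2 b z)" using scale.IH by blast
  then have "\<exists>J d. finite J \<and> (\<lambda>z. c * f z) = (\<lambda>z. \<Sum>b\<in>J. d b * cas2 b z)"
    by (intro exI[of _ J] exI[of _ "\<lambda>b. c * d b"]) (simp add: sum_distrib_left mult.assoc)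
  ultimately show ?case using scale.IH by (auto intro: continuous_on_mult_left)
qed

lemma trigpoly_bounded:
  assumes "f \<in> trigpoly" obtains B where "\<And>z. \<bar>f z\<bar> \<le> B"
proof -
  from trigpoly_props[OF assms] have "\<exists>B. \<forall>z. \<bar>f z\<bar> \<le> B" by (elim conjE)
  then show ?thesis using that by auto
qed

lemma trigpoly_measurable: "f \<in> trigpoly \<Longrightarrow> f \<in> borel_measurable tborel"
  using trigpoly_props measurable_torus_lift by blast

lemma borel_measurable_tvol: "borel_measurable tvol = borel_measurable tborel"
  by (rule measurable_cong_sets) auto

interpretation tvol: l2_subspace tvol trigpoly
proof
  fix f assume f: "f \<in> trigpoly"
  then show m: "f \<in> borel_measurable tvol" by (simp add: borel_measurable_tvol trigpoly_measurable)
  obtain B where B: "\<And>z. \<bar>f z\<bar> \<le> B" using trigpoly_bounded[OF f] by blast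
  have "(f z)\<^sup>2 \<le> B\<^sup>2" for z using B[of z] by (metis abs_ge_zero power2_abs power_mono)
  then show "integrable tvol (\<lambda>x. (f x)\<^sup>2)"
    using m by (intro tvol.integrable_const_bound[where B = "B\<^sup>2"]) auto
qed (auto intro: trigpoly_const trigpoly.add trigpoly.scale)

text \<open>A real linear functional of the embedding is a combination of cosines and sines of the
  two angles, hence of Hartley functions of index 1 and -1; sums and products follow from
  closure.\<close>

lemma real_polynomial_trigpoly:
  assumes "real_polynomial_function g"
  shows "(\<lambda>z. g (temb z)) \<in> trigpoly"
  using assms
proof induction
  case (linear f)
  interpret f: bounded_linear f by fact
  have cs: "(\<lambda>z. c * cos (2 * pi * z i)) \<in> trigpoly" "(\<lambda>z. c * sin (2 * pi * z i)) \<in> trigpoly"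
    if "i < 2" for c i
  proof -
    \<comment> \<open>Index 1 and index -1 in the variable i: half the sum is the cosine, half the
      difference is the sine.\<close>
    let ?p = "if i = 0 then (1, 0) else (0, 1) :: int \<times> int"
        and ?m = "if i = 0 then (- 1, 0) else (0, - 1) :: int \<times> int"
    have t: "cas2 ?p z = cos (2 * pi * z i) + sin (2 * pi * z i)" "cas2 ?m z
        = cos (2 * pi * z i) - sin (2 * pi * z i)" for z
      using that by (auto simp: cas2_def cas_def less_two_cases)
    have "(\<lambda>z. (c / 2) * (cas2 ?p z + cas2 ?m z))
        \<in> trigpoly" "(\<lambda>z. (c / 2) * (cas2 ?p z + (- 1) * cas2 ?m z)) \<in> trigpoly"
      by (intro trigpoly.intros)+
    then show "(\<lambda>z. c * cos (2 * pi * z i)) \<in> trigpoly" "(\<lambda>z. c * sin (2 * pi * z i)) \<in> trigpoly"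
      by (simp_all only: t) (simp_all add: field_simps)
  qed
  have "f (temb z) = ((f (1, 0) * cos (2 * pi * z 0) + f (\<i>, 0) * sin (2 * pi * z 0))
      + (f (0, 1) * cos (2 * pi * z 1) + f (0, \<i>) * sin (2 * pi * z 1)))" for z
  proof -
    have "temb z = cos (2 * pi * z 0) *\<^sub>R (1, 0) + sin (2 * pi * z 0) *\<^sub>R (\<i>, 0)
      + (cos (2 * pi * z 1) *\<^sub>R (0, 1) + sin (2 * pi * z 1) *\<^sub>R (0, \<i>))"
      by (simp add: temb_def complex_eq_iff)
    then show ?thesis by (simp only: f.add f.scaleR) simp
  qed
  moreover have "(\<lambda>z. ((f (1, 0) * cos (2 * pi * z 0) + f (\<i>, 0) * sin (2 * pi * z 0))
      + (f (0, 1) * cos (2 * pi * z 1) + f (0, \<i>) * sin (2 * pi * z 1)))) \<in> trigpoly"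
    by (intro trigpoly.add cs) auto
  ultimately show ?case by simp
qed (auto intro: trigpoly_const trigpoly.add trigpoly_mult)

lemma temb_tpair: "temb (tpair w) = (cis (2 * pi * fst w), cis (2 * pi * snd w))"
  by (simp add: tpair_def temb_tq)

lemma measure_tvol: "measure tvol tpts = 1"
proof -
  have "measure tvol (space tvol) = measure usquare (tpair -` tpts \<inter> space usquare)"
    unfolding tvol_def by (subst measure_distr) (auto simp: sets.top[of tborel, simplified])
  also have "tpair -` tpts \<inter> space usquare = UNIV" by (auto simp: tpair_def)
  finally show ?thesis by (simp add: measure_usquare_UNIV)
qed

text \<open>Stone-Weierstrass on the compact image of the embedding gives uniform approximation
  within sqrt (\<epsilon>/2); as the torus has volume 1, the integrated square error is at most
  \<epsilon>/2.\<close>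

lemma approx_continuous:
  assumes h: "continuous_on UNIV h"
  shows "tvol.approx (\<lambda>p. h (temb p))"
proof -
  have "continuous_on UNIV (\<lambda>w :: real \<times> real. (cis (2 * pi * fst w), cis (2 * pi * snd w)))"
    by (intro continuous_intros)
  then have c: "continuous_on UNIV (\<lambda>w. h (temb (tpair w)))"
    unfolding temb_tpair by (intro continuous_on_compose2[OF h]) auto
  have comp: "compact tset" by (intro compact_Times compact_sphere)
  have cont: "continuous_on tset h" using h continuous_on_subset by blast
  have m: "(\<lambda>p. h (temb p)) \<in> borel_measurable tvol"
    using measurable_torus_lift[OF c] by (simp add: borel_measurable_tvol)
  have "compact (h ` tset)" using compact_continuous_image[OF cont comp] .
  then obtain B where "\<And>x. x \<in> h ` tset \<Longrightarrow> norm x \<le> B" using compact_imp_bounded bounded_iff by metis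
  then have sq: "tvol.sq_int (\<lambda>p. h (temb p))"
    using temb_image by (intro tvol.sq_int_bounded[OF m, of B]) auto
  show ?thesis
  proof (rule tvol.approx_limit[OF sq])
    fix \<epsilon> :: real assume e: "\<epsilon> > 0"
    then have "sqrt (\<epsilon> / 2) > 0" by simp
    then obtain g where g: "real_polynomial_function g" "\<And>x. x \<in> tset \<Longrightarrow> \<bar>h x - g x\<bar> < sqrt (\<epsilon> / 2)"
      using Stone_Weierstrass_real_polynomial_function[OF comp cont] by metis
    have a: "tvol.approx (\<lambda>p. g (temb p))" by (rule tvol.approx_W[OF real_polynomial_trigpoly[OF g(1)]])
    then have "tvol.sq_int (\<lambda>p. h (temb p) - g (temb p))"
      using sq by (intro tvol.sq_int_diff) (auto simp: tvol.approx_def)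
    then have int: "integrable tvol (\<lambda>p. (h (temb p) - g (temb p))\<^sup>2)" by (simp add: tvol.sq_int_def)
    have "(\<integral>p. (h (temb p) - g (temb p))\<^sup>2 \<partial>tvol) \<le> (\<integral>p. \<epsilon> / 2 \<partial>tvol)"
    proof (rule integral_mono[OF int])
      fix p assume "p \<in> space tvol"
      then have "temb p \<in> tset" using temb_image by auto
      from g(2)[OF this] have "\<bar>h (temb p) - g (temb p)\<bar> \<le> sqrt (\<epsilon> / 2)" by simp
      then have "\<bar>h (temb p) - g (temb p)\<bar>\<^sup>2 \<le> (sqrt (\<epsilon> / 2))\<^sup>2" by (intro power_mono) auto
      then show "(h (temb p) - g (temb p))\<^sup>2 \<le> \<epsilon> / 2" using e by simp
    qed simp
    also have "\<dots> < \<epsilon>" using e by (simp add: measure_tvol)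
    finally show "\<exists>g. tvol.approx g \<and> (\<integral>p. (h (temb p) - g p)\<^sup>2 \<partial>tvol) < \<epsilon>" using a by blast
  qed
qed

text \<open>Open sets form the intersection-stable generator. The indicator of an open set is the
  pointwise limit of the continuous functions min (1, n * distance to the complement), all with
  values in [0, 1].\<close>

theorem trigpoly_dense:
  assumes f: "tvol.sq_int f"
  shows "tvol.approx f"
proof (rule tvol.approx_dense[OF _ _ _ _ _ f])
  show "Int_stable {U. openin ttop U}" by (auto simp: Int_stable_def)
  show "{U. openin ttop U} \<subseteq> Pow (space tvol)" using opens_subset by simp
  show "sets tvol = sigma_sets (space tvol) {U. openin ttop U}" by (simp add: sets_tborel)
  have one: "tvol.approx (indicator tpts)"
  proof (rule tvol.approx_dominated[where s = "\<lambda>n p. 1" and w = "\<lambda>p. 0"])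
    show "tvol.approx (\<lambda>p. 1)" by (rule tvol.approx_W[OF trigpoly_const])
    show "tvol.sq_int (indicator tpts)" using sets.top[of tvol] by (intro tvol.sq_int_indicator) simp
    show "tvol.sq_int (\<lambda>p. 0)" by (rule tvol.sq_int_bounded[where B = 0]) auto
  qed auto
  then show "tvol.approx (indicator (space tvol))" by simp
  fix U assume "U \<in> {U. openin ttop U}"
  then have U: "openin ttop U" by simp
  then obtain V where V: "open V" "U = temb -` V \<inter> tpts"
      by (auto simp: ttop_def openin_pullback_topology)
  show "tvol.approx (indicator U)"
  \<comment> \<open>The distance \<open>infdist\<close> to the empty set is 0 by convention, so the
    cut-off functions would fail for the full space.\<close>
  proof (cases "V = UNIV")
    case True
    then show ?thesis using one V by simp
  next
    case False
    then have ne: "- V \<noteq> {}" by auto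
    have cl: "closed (- V)" using V(1) by (simp add: closed_Compl)
    let ?h = "\<lambda>(n::nat) w. min 1 (real n * infdist w (- V))"
    have lim: "(\<lambda>n. ?h n w) \<longlonglongrightarrow> indicator V w" for w
    proof (cases "w \<in> V")
      case True
      then have "infdist w (- V) > 0"
        using in_closed_iff_infdist_zero[OF cl ne, of w] infdist_nonneg[of w "- V"] by force
      then obtain N :: nat where N: "1 < real N * infdist w (- V)" using reals_Archimedean3 by blast
      have "?h n w = 1" if "n \<ge> N" for n
      proof -
        have "real N * infdist w (- V) \<le> real n * infdist w (- V)"
          using that infdist_nonneg by (intro mult_right_mono) auto
        then show ?thesis using N by simp
      qed
      then have "eventually (\<lambda>n. ?h n w = 1) sequentially" by (auto simp: eventually_sequentially)
      then show ?thesis using True by (simp add: tendsto_eventually)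
    next
      case False
      then have "infdist w (- V) = 0" by (simp add: infdist_zero)
      then show ?thesis using False by simp
    qed
    show ?thesis
    proof (rule tvol.approx_dominated[where s = "\<lambda>n p. ?h n (temb p)" and w = "\<lambda>p. 1"])
      show "tvol.approx (\<lambda>p. ?h n (temb p))" for n
        by (rule approx_continuous) (intro continuous_intros)
      show "tvol.sq_int (indicator U)" using openin_tborel[OF U] by (intro tvol.sq_int_indicator) simp
      show "tvol.sq_int (\<lambda>p. 1)" by (rule tvol.sq_int_bounded[where B = 1]) auto
      fix p n assume p: "p \<in> space tvol"
      have i: "indicator U p = (indicator V (temb p) :: real)" using p V by (auto simp: indicator_def)
      show "(\<lambda>n. ?h n (temb p)) \<longlonglongrightarrow> indicator U p" unfolding i by (rule lim)
      have "0 \<le> ?h n (temb p)" using infdist_nonneg[of "temb p" "- V"] by simp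
      then show "\<bar>indicator U p - ?h n (temb p)\<bar> \<le> \<bar>1\<bar>" by (auto simp: indicator_def abs_le_iff)
    qed
  qed
qed

corollary cas2_complete:
  assumes "f \<in> borel_measurable tborel" "integrable tvol (\<lambda>p. (f p)\<^sup>2)" "\<epsilon> > 0"
  obtains J c where "finite J" "(\<integral>p. (f p - (\<Sum>b\<in>J. c b * cas2 b p))\<^sup>2 \<partial>tvol) < \<epsilon>"
proof -
  have "tvol.approx f" using assms by (intro trigpoly_dense)
      (simp add: tvol.sq_int_def borel_measurable_tvol)
  then obtain g where g: "g \<in> trigpoly" "(\<integral>p. (f p - g p)\<^sup>2 \<partial>tvol) < \<epsilon>"
    using tvol.approxE assms(3) by blast
  then show ?thesis using that trigpoly_props[OF g(1)] by auto
qed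

lemma cas2_orthonormal: "(\<integral>p. cas2 b p * cas2 b' p \<partial>tvol) = (if b = b' then 1 else 0)"
proof -
  have m: "(\<lambda>p. cas2 b p * cas2 b' p) \<in> borel_measurable tborel"
    by (intro borel_measurable_times trigpoly_measurable trigpoly.cas2)
  let ?f = "\<lambda>w. (cas (fst b) (fst w) * cas (fst b') (fst w)) * (cas (snd b) (snd w)
      * cas (snd b') (snd w))"
  have bd: "\<bar>?f w\<bar> \<le> (2 * 2) * (2 * 2)" for w
    unfolding abs_mult by (intro mult_mono cas_bound) auto
  have "continuous_on UNIV ?f" by (intro continuous_intros)
  then have "integrable usquare ?f"
    by (intro integrable_usquare_bounded[OF _ bd] borel_measurable_continuous_onI)
  note it = integral_usquare_iterated(1)[OF this]
  have "(\<integral>p. cas2 b p * cas2 b' p \<partial>tvol) = (\<integral>w. ?f w \<partial>usquare)"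
    unfolding integral_tvol[OF m] cas2_tpair by (rule Bochner_Integration.integral_cong) auto
  also have "\<dots> = (if fst b = fst b' then 1 else 0) * (if snd b = snd b' then 1 else 0)"
    unfolding it by (simp add: cas_orthonormal)
  finally show ?thesis by (simp add: prod_eq_iff)
qed

section \<open>The measure of the counterexample\<close>

definition tmu :: "(nat \<Rightarrow> real) measure" where
  "tmu = distr usquare tborel (\<lambda>w. tpair (cantor (fst w), snd w))"

lemma cantor_pair_measurable [measurable]: "(\<lambda>w. tpair (cantor (fst w), snd w)) \<in> borel \<rightarrow>\<^sub>M tborel"
proof -
  have "(\<lambda>w :: real \<times> real. (cantor (fst w), snd w)) \<in> borel \<Otimes>\<^sub>M borel \<rightarrow>\<^sub>M borel \<Otimes>\<^sub>M borel" by measurable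
  then have "(\<lambda>w :: real \<times> real. (cantor (fst w), snd w)) \<in> borel \<rightarrow>\<^sub>M (borel :: (real \<times> real) measure)"
    unfolding borel_prod .
  then show ?thesis by (rule measurable_compose) (rule tpair_measurable)
qed

lemma sets_tmu [simp, measurable_cong]: "sets tmu = sets tborel"
  and space_tmu [simp]: "space tmu = tpts"
  by (simp_all add: tmu_def)

interpretation tmu: finite_measure tmu
  unfolding tmu_def by (rule usquare.finite_measure_distr) simp

lemma emeasure_tmu:
  "A \<in> sets tborel \<Longrightarrow> emeasure tmu A = emeasure usquare {w. tpair (cantor (fst w), snd w) \<in> A}"
  unfolding tmu_def by (subst emeasure_distr) (auto simp: vimage_def)

text \<open>Lebesgue measure in the second variable annihilates every index l other than 0. In the
  first variable cas = cos + sin turns the complex transform into the sum of its real and imaginary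
  parts.\<close>

lemma integral_tmu_cas2:
  "(\<integral>p. cas2 (k, l) p \<partial>tmu) = (if l = 0 then Re (cantor_ft k) + Im (cantor_ft k) else 0)"
proof -
  have m: "(\<lambda>w. cas k (cantor (fst w)) * cas l (snd w))
      \<in> borel_measurable (borel :: (real \<times> real) measure)"
  proof -
    have "(\<lambda>w. cas k (cantor (fst w)) * cas l (snd w)) \<in> borel_measurable (borel \<Otimes>\<^sub>M borel)"
        by measurable
    then show ?thesis by (simp add: borel_prod)
  qed
  have bd: "\<bar>cas k (cantor (fst w)) * cas l (snd w)\<bar> \<le> 2 * 2" for w
    unfolding abs_mult by (intro mult_mono cas_bound) auto
  have "(\<integral>p. cas2 (k, l) p \<partial>tmu) = (\<integral>w. cas k (cantor (fst w)) * cas l (snd w) \<partial>usquare)"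
    unfolding tmu_def by (subst integral_distr) (auto simp: cas2_tpair trigpoly_measurable trigpoly.cas2)
  also have "\<dots> = (\<integral>x. cas k (cantor x) \<partial>unit_leb) * (if l = 0 then 1 else 0)"
    using integral_usquare_iterated(1)[OF integrable_usquare_bounded[OF m bd]]
        by (simp add: integral_cas)
  also have "(\<integral>x. cas k (cantor x) \<partial>unit_leb) = Re (cantor_ft k) + Im (cantor_ft k)"
  proof -
    have int: "integrable unit_leb (\<lambda>x. cis (2 * pi * k * cantor x))"
      by (rule integrable_unit_leb_bounded[where B = 1]) (auto simp: cis_conv_exp)
    have "Re (cantor_ft k) = (\<integral>x. cos (2 * pi * k * cantor x) \<partial>unit_leb)"
      "Im (cantor_ft k) = (\<integral>x. sin (2 * pi * k * cantor x) \<partial>unit_leb)"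
      unfolding cantor_ft_def integral_Re[OF int, symmetric] integral_Im[OF int, symmetric] by simp_all
    moreover have "integrable unit_leb (\<lambda>x. cos (2 * pi * k
        * cantor x))" "integrable unit_leb (\<lambda>x. sin (2 * pi * k * cantor x))"
      by (rule integrable_unit_leb_bounded[where B = 1]; auto)+
    ultimately show ?thesis by (simp add: cas_def)
  qed
  finally show ?thesis by simp
qed

section \<open>Riemannian distance and Ahlfors--David regularity\<close>

lemma curve_length_trans:
  "curve_length M x y l \<Longrightarrow> curve_length M y z l' \<Longrightarrow> curve_length M x z (l + l')"
proof (induction rule: curve_length.induct)
  case (arc c \<gamma> v y l)
  then show ?case using curve_length.arc[OF arc.hyps(1) arc.IH[OF arc.prems]] by (simp add: add.assoc)
qed simp

lemma sum_metr_torus: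
  "(\<Sum>i<mdim torus. \<Sum>j<mdim torus. metr torus c p i j * u i * u j) = (u 0)\<^sup>2 + (u 1)\<^sup>2"
  by (simp add: lessThan_two power2_eq_square)

text \<open>Displacements below 1/2 keep the segment inside the unit box centred at p, so a single
  arc in a single chart suffices.\<close>

lemma curve_length_straight:
  assumes p: "p \<in> tpts" and d: "\<And>i. i < 2 \<Longrightarrow> \<bar>d i\<bar> < 1 / 2"
  shows "curve_length torus p (tq (\<lambda>i. p i + d i)) (sqrt ((d 0)\<^sup>2 + (d 1)\<^sup>2))"
proof -
  define a where "a = (\<lambda>i. p i - 1 / 2)"
  define \<gamma> where "\<gamma> = (\<lambda>t. tq (\<lambda>i\<in>{..<2}. p i + t * d i))"
  have box: "(\<lambda>i\<in>{..<2}. p i + t * d i) \<in> tbox a" if "t \<in> {0..1}" for t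
  proof -
    have "\<bar>t * d i\<bar> < 1 / 2" if "i < 2" for i
    proof -
      have "\<bar>t * d i\<bar> \<le> 1 * \<bar>d i\<bar>"
        unfolding abs_mult using \<open>t \<in> {0..1}\<close> by (intro mult_right_mono) auto
      then show ?thesis using d[OF that] by simp
    qed
    then have "p i + t * d i \<in> {a i<..<a i + 1}" if "i < 2" for i
    proof -
      have "\<bar>t * d i\<bar> < 1 / 2" using that \<open>\<And>i. i < 2 \<Longrightarrow> \<bar>t * d i\<bar> < 1 / 2\<close> by blast
      then have "- (1 / 2) < t * d i" "t * d i < 1 / 2" by linarith+
      then show ?thesis by (simp add: a_def)
    qed
    then show ?thesis by (auto simp: tbox_def)
  qed
  have arc: "C1_arc torus (tchart a) \<gamma> (\<lambda>t. d)"
    unfolding C1_arc_def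
  proof (intro conjI allI impI ballI)
    show "\<gamma> ` {0..1} \<subseteq> fst (tchart a)" using box by (auto simp: \<gamma>_def tchart_def)
    fix i t assume i: "i < mdim torus" and t: "t \<in> {0..1::real}"
    have "((\<lambda>\<tau>. p i + \<tau> * d i) has_real_derivative d i) (at t within {0..1})"
      by (auto intro!: derivative_eq_intros)
    then show "((\<lambda>\<tau>. snd (tchart a) (\<gamma> \<tau>) i) has_real_derivative d i) (at t within {0..1})"
    proof (rule has_field_derivative_transform_within[where d = 1])
      fix \<tau> :: real assume "\<tau> \<in> {0..1}"
      then show "p i + \<tau> * d i = snd (tchart a) (\<gamma> \<tau>) i"
        using i by (simp add: tchart_def \<gamma>_def tcoord_tq[OF box])
    qed (use t in auto)
  qed auto
  have "\<gamma> 0 = tq p" by (auto simp: \<gamma>_def tq_def fun_eq_iff)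
  then have "\<gamma> 0 = p" using tq_id[OF p] by simp
  moreover have "\<gamma> 1 = tq (\<lambda>i. p i + d i)"
    by (auto simp: \<gamma>_def tq_def fun_eq_iff)
  moreover have "arc_length torus (tchart a) \<gamma> (\<lambda>t. d) = sqrt ((d 0)\<^sup>2 + (d 1)\<^sup>2)"
    unfolding arc_length_def sum_metr_torus by simp
  moreover have "curve_length torus (\<gamma> 1) (\<gamma> 1) 0"
    by (rule curve_length.const) (simp add: \<gamma>_def)
  ultimately show ?thesis using curve_length.arc[OF arc, of "\<gamma> 1" 0] by simp
qed

text \<open>Coordinates of two points differ by less than 1, so two segments of half the
  displacement join them. This makes the set under the infimum in \<open>riem_dist\<close>
  nonempty.\<close>

lemma curve_length_exists:
  assumes p: "p \<in> tpts" and q: "q \<in> tpts"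
  shows "\<exists>l. curve_length torus p q l"
proof -
  define d where "d = (\<lambda>i. (q i - p i) / 2)"
  have d: "\<bar>d i\<bar> < 1 / 2" if "i < 2" for i
  proof -
    have "p i \<in> {0..<1}" "q i \<in> {0..<1}" using p q that by (auto simp: tpts_def PiE_iff)
    then show ?thesis by (auto simp: d_def)
  qed
  have "tq (\<lambda>i. tq (\<lambda>i. p i + d i) i + d i) = q"
  proof -
    have "frac (frac (p i + d i) + d i) = q i" if "i < 2" for i
    proof -
      have "frac (frac (p i + d i) + d i) = frac (p i + d i + d i)"
        using frac_frac_diff[of "p i + d i" "- d i"] by simp
      also have "p i + d i + d i = q i" by (simp add: d_def field_simps)
      also have "frac (q i) = q i" using q that by (auto simp: tpts_def PiE_iff)
      finally show ?thesis .
    qed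
    then show ?thesis using q by (auto simp: tq_def fun_eq_iff tpts_def PiE_iff extensional_def)
  qed
  then show ?thesis
    using curve_length_trans[OF curve_length_straight[OF p, of d] curve_length_straight[OF
        tq_in_tpts, of d "\<lambda>i. p i + d i"]] d
    by auto
qed

text \<open>Within a chart the change of one coordinate is the integral of its velocity, hence
  bounded by the length of the arc. Passing between charts shifts coordinates by integers, which the
  integer k absorbs. The upper bound for the mass of balls rests on this.\<close>

lemma curve_length_lower:
  assumes "curve_length torus x y l"
  shows "i < 2 \<Longrightarrow> \<exists>k::int. \<bar>y i - x i - k\<bar> \<le> l"
  using assms
proof (induction rule: curve_length.induct)
  case (const x)
  then show ?case by (intro exI[of _ 0]) simp
next
  case (arc c \<gamma> v y l)
  obtain a where c: "c = tchart a" using arc.hyps(1) by (auto simp: C1_arc_def)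
  have v: "continuous_on {0..1} (\<lambda>t. v t j)"
    and der: "\<And>t. t \<in> {0..1} \<Longrightarrow> ((\<lambda>\<tau>. snd c (\<gamma> \<tau>) j) has_real_derivative v t j) (at t within {0..1})"
    if "j < 2" for j
    using arc.hyps(1) that by (auto simp: C1_arc_def)
  let ?s = "\<lambda>t. sqrt ((v t 0)\<^sup>2 + (v t 1)\<^sup>2)"
  have "((\<lambda>t. v t i) has_integral (snd c (\<gamma> 1) i - snd c (\<gamma> 0) i)) {0..1}"
    using der[OF arc.prems]
    by (intro fundamental_theorem_of_calculus) (auto simp: has_real_derivative_iff_has_vector_derivative)
  then have I: "integral {0..1} (\<lambda>t. v t i) = snd c (\<gamma> 1) i - snd c (\<gamma> 0) i" by (rule integral_unique)
  have "norm (integral {0..1} (\<lambda>t. v t i)) \<le> integral {0..1} ?s"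
  proof (rule integral_norm_bound_integral)
    show "(\<lambda>t. v t i) integrable_on {0..1}" by (intro integrable_continuous_real v arc.prems)
    show "?s integrable_on {0..1}" by (intro integrable_continuous_real continuous_intros v) auto
    show "norm (v t i) \<le> ?s t" for t
      using arc.prems by (auto simp: less_two_cases)
  qed
  then have len: "\<bar>snd c (\<gamma> 1) i - snd c (\<gamma> 0) i\<bar> \<le> arc_length torus c \<gamma> v"
    unfolding arc_length_def sum_metr_torus I by simp
  \<comment> \<open>Chart coordinates differ from the representatives in the unit interval by
    integers only.\<close>
  have coord: "\<exists>n::int. snd c p i = p i + n" for p
  proof
    show "snd c p i = p i + of_int (- \<lfloor>p i - a i\<rfloor>)"
      using arc.prems by (simp add: c tchart_def tcoord_def frac_def)
  qed
  obtain n0 n1 :: int where "snd c (\<gamma> 0) i = \<gamma> 0 i + n0" "snd c (\<gamma> 1) i = \<gamma> 1 i + n1" using coord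
      by metis
  moreover obtain k :: int where "\<bar>y i - \<gamma> 1 i - k\<bar> \<le> l" using arc.IH arc.prems by blast
  ultimately have "\<bar>y i - \<gamma> 0 i - of_int (k + n0 - n1)\<bar> \<le> arc_length torus c \<gamma> v + l"
    using len by simp
  then show ?case by blast
qed

lemma curve_length_nonneg: "curve_length torus x y l \<Longrightarrow> 0 \<le> l"
proof -
  assume "curve_length torus x y l"
  then obtain k :: int where "\<bar>y 0 - x 0 - k\<bar> \<le> l" using curve_length_lower[of x y l 0] by auto
  then show "0 \<le> l" by linarith
qed

lemma riem_dist_le: "curve_length torus x y l \<Longrightarrow> riem_dist torus x y \<le> l"
  unfolding riem_dist_def by (rule cInf_lower) (auto intro!: bdd_belowI[of _ 0] curve_length_nonneg)

lemma riem_dist_lessE: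
  assumes "x \<in> tpts" "y \<in> tpts" "riem_dist torus x y < r"
  obtains l where "curve_length torus x y l" "l < r"
proof -
  have "{l. curve_length torus x y l} \<noteq> {}" using curve_length_exists[OF assms(1,2)] by simp
  then have "\<exists>l\<in>{l. curve_length torus x y l}. l < r"
    using assms(3) unfolding riem_dist_def by (rule cInf_lessD)
  then show ?thesis using that by auto
qed

text \<open>Squares replace geodesic balls in computations: their preimage under
  \<open>tpair\<close> is a product of two arcs, whose mass splits into factors.\<close>

definition tsquare :: "(nat \<Rightarrow> real) \<Rightarrow> real \<Rightarrow> (nat \<Rightarrow> real) set" where
  "tsquare p r = tq ` (\<Pi>\<^sub>E i\<in>{..<2}. {p i - r<..<p i + r})"

lemma tsquare_subset: "tsquare p r \<subseteq> tpts"
  unfolding tsquare_def by (rule image_subsetI) (rule tq_in_tpts)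

lemma mem_tsquare: "p \<in> tpts \<Longrightarrow> r > 0 \<Longrightarrow> p \<in> tsquare p r"
proof -
  assume p: "p \<in> tpts" and r: "r > 0"
  then have "p \<in> (\<Pi>\<^sub>E i\<in>{..<2}. {p i - r<..<p i + r})" by (simp add: tpts_def PiE_iff)
  then show "p \<in> tsquare p r" unfolding tsquare_def by (rule image_eqI[rotated]) (simp add: tq_id[OF p])
qed

lemma openin_tsquare:
  assumes "r \<le> 1 / 2"
  shows "openin ttop (tsquare p r)"
proof -
  define a where "a = (\<lambda>i. p i - 1 / 2)"
  let ?B = "\<Pi>\<^sub>E i\<in>{..<2}. {p i - r<..<p i + r}"
  have "{p i - r<..<p i + r} \<subseteq> {a i<..<a i + 1}" for i using assms by (auto simp: a_def)
  then have sub: "?B \<subseteq> tbox a" unfolding tbox_def by (intro PiE_mono)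
  have "openin (powertop_real {..<2}) ?B" by (subst openin_PiE) auto
  then have "openin (subtopology ttop (tq ` tbox a)) {q
      \<in> topspace (subtopology ttop (tq ` tbox a)). tcoord a q \<in> ?B}"
    by (intro openin_continuous_map_preimage[OF continuous_map_into_fulltopology[OF
        continuous_map_tcoord]])
  moreover have "{q \<in> topspace (subtopology ttop (tq ` tbox a)). tcoord a q \<in> ?B} = tsquare p r"
  proof (intro Set.set_eqI iffI)
    fix q assume "q \<in> {q \<in> topspace (subtopology ttop (tq ` tbox a)). tcoord a q \<in> ?B}"
    then obtain z where "z \<in> tbox a" "q = tq z" "tcoord a q \<in> ?B" by auto
    then show "q \<in> tsquare p r" unfolding tsquare_def by (auto simp: tcoord_tq)
  next
    fix q assume "q \<in> tsquare p r"
    then obtain z where z: "z \<in> ?B" "q = tq z" by (auto simp: tsquare_def)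
    then have "z \<in> tbox a" using sub by blast
    then show "q \<in> {q \<in> topspace (subtopology ttop (tq ` tbox a)). tcoord a q \<in> ?B}"
      using z by (auto simp: tcoord_tq)
  qed
  ultimately have "openin (subtopology ttop (tq ` tbox a)) (tsquare p r)" by simp
  then show ?thesis by (simp add: openin_open_subtopology[OF openin_chart])
qed

lemma tsquare_curve:
  assumes p: "p \<in> tpts" and r: "r \<le> 1 / 2" and q: "q \<in> tsquare p r"
  obtains l where "curve_length torus p q l" "l < 2 * r"
proof -
  obtain z where z: "z \<in> (\<Pi>\<^sub>E i\<in>{..<2}. {p i - r<..<p i + r})" "q = tq z" using q
      by (auto simp: tsquare_def)
  have d: "\<bar>z i - p i\<bar> < r" if "i < 2" for i
    using PiE_mem[OF z(1), of i] that by (simp add: abs_less_iff)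
  then have d2: "\<bar>z i - p i\<bar> < 1 / 2" if "i < 2" for i using that r by force
  have "sqrt ((z 0 - p 0)\<^sup>2 + (z 1 - p 1)\<^sup>2) \<le> \<bar>z 0 - p 0\<bar> + \<bar>z 1 - p 1\<bar>"
    by (rule sqrt_sum_squares_le_sum_abs)
  also have "\<dots> < 2 * r" using d[of 0] d[of 1] by simp
  finally show ?thesis using that curve_length_straight[OF p, of "\<lambda>i. z i - p i"] d2 z(2) by simp
qed

lemma tsquare_subset_ball:
  assumes "p \<in> tpts" "0 < r" "r \<le> 1"
  shows "tsquare p (r / 2) \<subseteq> geod_ball torus p r"
proof
  fix q assume q: "q \<in> tsquare p (r / 2)"
  have "r / 2 \<le> 1 / 2" using assms by simp
  then obtain l where "curve_length torus p q l" "l < r" using tsquare_curve[OF assms(1) _ q] by auto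
  then show "q \<in> geod_ball torus p r"
    using riem_dist_le[of p q l] q tsquare_subset by (auto simp: geod_ball_def)
qed

text \<open>A curve of length below r leaves room for a small square around its end point, by
  concatenation. Openness is what makes the ball measurable, without which \<open>measure\<close>
  would default to 0.\<close>

lemma openin_geod_ball:
  assumes p: "p \<in> tpts"
  shows "openin ttop (geod_ball torus p r)"
proof (subst openin_subopen, intro ballI)
  fix q assume "q \<in> geod_ball torus p r"
  then have q: "q \<in> tpts" "riem_dist torus p q < r" by (auto simp: geod_ball_def)
  obtain l where l: "curve_length torus p q l" "l < r" using riem_dist_lessE[OF p q] .
  define e where "e = min ((r - l) / 2) (1 / 2)"
  have e: "e > 0" "e \<le> 1 / 2" "2 * e \<le> r - l" using l by (auto simp: e_def min_def)
  have "tsquare q e \<subseteq> geod_ball torus p r"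
  proof
    fix u assume u: "u \<in> tsquare q e"
    obtain l' where l': "curve_length torus q u l'" "l' < 2 * e" using tsquare_curve[OF q(1) e(2) u] .
    have "riem_dist torus p u \<le> l + l'" by (rule riem_dist_le[OF curve_length_trans[OF l(1) l'(1)]])
    then show "u \<in> geod_ball torus p r" using u tsquare_subset l' e by (auto simp: geod_ball_def)
  qed
  then show "\<exists>T. openin ttop T \<and> q \<in> T \<and> T \<subseteq> geod_ball torus p r"
    using openin_tsquare[OF e(2)] mem_tsquare[OF q(1) e(1)] by blast
qed

lemma circ_arc_frac: "frac x \<in> circ_arc t r \<longleftrightarrow> x \<in> circ_arc t r"
proof -
  have "(\<exists>k::int. \<bar>frac x - t - k\<bar> < r) \<longleftrightarrow> (\<exists>k::int. \<bar>x - t - k\<bar> < r)"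
  proof
    assume "\<exists>k::int. \<bar>frac x - t - k\<bar> < r"
    then obtain k :: int where "\<bar>frac x - t - k\<bar> < r" by blast
    then have "\<bar>x - t - of_int (k + \<lfloor>x\<rfloor>)\<bar> < r" by (simp add: frac_def algebra_simps)
    then show "\<exists>k::int. \<bar>x - t - k\<bar> < r" by blast
  next
    assume "\<exists>k::int. \<bar>x - t - k\<bar> < r"
    then obtain k :: int where "\<bar>x - t - k\<bar> < r" by blast
    then have "\<bar>frac x - t - of_int (k - \<lfloor>x\<rfloor>)\<bar> < r" by (simp add: frac_def algebra_simps)
    then show "\<exists>k::int. \<bar>frac x - t - k\<bar> < r" by blast
  qed
  then show ?thesis by (simp add: circ_arc_def)
qed

lemma tpair_coord: "tpair w 0 = frac (fst w)" "tpair w (Suc 0) = frac (snd w)"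
  by (simp_all add: tpair_def tq_def)

lemma geod_ball_coord:
  assumes "p \<in> tpts" "q \<in> geod_ball torus p r" "i < 2"
  shows "q i \<in> circ_arc (p i) r"
proof -
  have "q \<in> tpts" "riem_dist torus p q < r" using assms by (auto simp: geod_ball_def)
  then obtain l where l: "curve_length torus p q l" "l < r" using riem_dist_lessE[OF assms(1)] by blast
  then obtain k :: int where "\<bar>q i - p i - k\<bar> \<le> l" using curve_length_lower[OF l(1) assms(3)] by blast
  then have "\<bar>q i - p i - k\<bar> < r" using l(2) by simp
  then show ?thesis unfolding circ_arc_def by blast
qed

lemma tpair_mem_tsquare:
  assumes "p \<in> tpts"
  shows "tpair w \<in> tsquare p r \<longleftrightarrow> fst w \<in> circ_arc (p 0) r \<and> snd w \<in> circ_arc (p 1) r"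
proof
  assume "tpair w \<in> tsquare p r"
  then obtain z where z: "z \<in> (\<Pi>\<^sub>E i\<in>{..<2}. {p i - r<..<p i + r})" "tpair w = tq z"
      by (auto simp: tsquare_def)
  have "z i \<in> circ_arc (p i) r" if "i < 2" for i
  proof -
    have "\<bar>z i - p i - of_int 0\<bar> < r" using PiE_mem[OF z(1), of i] that by (simp add: abs_less_iff)
    then show ?thesis unfolding circ_arc_def by blast
  qed
  then have "tq z i \<in> circ_arc (p i) r" if "i < 2" for i using that by (simp add: tq_def circ_arc_frac)
  from this[of 0] this[of 1] show "fst w \<in> circ_arc (p 0) r \<and> snd w \<in> circ_arc (p 1) r"
    unfolding z(2)[symmetric] by (simp add: tpair_coord circ_arc_frac)
next
  assume "fst w \<in> circ_arc (p 0) r \<and> snd w \<in> circ_arc (p 1) r"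
  then obtain k0 k1 :: int where k: "\<bar>fst w - p 0 - k0\<bar> < r" "\<bar>snd w - p 1 - k1\<bar> < r"
    by (auto simp: circ_arc_def)
  let ?z = "vec2 (fst w - k0, snd w - k1)"
  have "?z \<in> (\<Pi>\<^sub>E i\<in>{..<2}. {p i - r<..<p i + r})"
  proof -
    have "?z \<in> extensional {..<2}" by (simp add: vec2_def)
    then show ?thesis using k by (auto simp: PiE_iff lessThan_two abs_less_iff)
  qed
  moreover have "tpair w = tq ?z"
    using frac_add_int[of "fst w" "- k0"] frac_add_int[of "snd w" "- k1"]
    by (auto simp: tpair_def tq_def vec2_def fun_eq_iff)
  ultimately show "tpair w \<in> tsquare p r" unfolding tsquare_def by blast
qed

section \<open>Upper and lower bounds for the mass of balls\<close>

lemma measure_tmu: "A \<in> sets tborel \<Longrightarrow> measure tmu A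
    = measure usquare {w. tpair (cantor (fst w), snd w) \<in> A}"
  by (simp add: measure_def emeasure_tmu)

lemma measure_circ_arc_upper:
  assumes t: "t \<in> {0..<1}" and r: "0 < r" "r \<le> 1 / 3"
  shows "measure unit_leb (circ_arc t r) \<le> 6 * r"
proof -
  let ?U = "{t - r<..<t + r} \<union> {t - 1 - r<..<t - 1 + r} \<union> {t + 1 - r<..<t + 1 + r}"
  have sub: "circ_arc t r \<inter> {0..<1} \<subseteq> ?U"
  proof
    fix s assume s: "s \<in> circ_arc t r \<inter> {0..<1}"
    then obtain k :: int where k: "\<bar>s - t - k\<bar> < r" by (auto simp: circ_arc_def)
    \<comment> \<open>Both s and t lie in one period, so |k| < 1 + 1/3. The three windings -1, 0, 1
      give three intervals of length 2r, hence the constant 6.\<close>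
    have "\<bar>real_of_int k\<bar> < 2" using k s t r by auto
    then have "\<bar>k\<bar> < 2" by linarith
    then have "k = 0 \<or> k = 1 \<or> k = -1" by linarith
    then show "s \<in> ?U" using k by (auto simp: abs_less_iff)
  qed
  have "emeasure unit_leb (circ_arc t r) \<le> emeasure lborel ?U"
    unfolding emeasure_unit_leb[OF circ_arc_measurable] using sub by (intro emeasure_mono) auto
  also have "\<dots> \<le> (emeasure lborel {t - r<..<t + r} + emeasure lborel {t - 1 - r<..<t - 1 + r})
      + emeasure lborel {t + 1 - r<..<t + 1 + r}"
    by (intro order_trans[OF emeasure_subadditive] add_mono order_refl emeasure_subadditive) auto
  also have "\<dots> = ennreal (6 * r)" using r by (simp add: ennreal_plus[symmetric] del: ennreal_plus)
  finally show ?thesis unfolding measure_def using r by (simp add: enn2real_leI)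
qed

lemma measure_circ_arc_lower:
  assumes t: "t \<in> {0..<1}" and r: "0 < r" "r \<le> 1 / 3"
  shows "r \<le> measure unit_leb (circ_arc t r)"
proof -
  \<comment> \<open>One half of the arc is kept, on the side of t that stays within the unit
    interval; r \<le> 1/3 makes it fit.\<close>
  define u where "u = (if t \<le> 1 / 2 then t else t - r)"
  have sub: "{u<..<u + r} \<subseteq> circ_arc t r \<inter> {0..<1}"
  proof
    fix s assume s: "s \<in> {u<..<u + r}"
    then have "\<bar>s - t - of_int 0\<bar> < r" by (auto simp: u_def abs_less_iff split: if_splits)
    moreover have "s \<in> {0..<1}" using s t r by (auto simp: u_def split: if_splits)
    ultimately show "s \<in> circ_arc t r \<inter> {0..<1}" unfolding circ_arc_def by blast
  qed
  have "ennreal r = emeasure lborel {u<..<u + r}" using r by simp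
  also have "\<dots> \<le> emeasure unit_leb (circ_arc t r)"
    unfolding emeasure_unit_leb[OF circ_arc_measurable] using sub by (intro emeasure_mono) auto
  finally have "ennreal r \<le> ennreal (measure unit_leb (circ_arc t r))"
    by (simp add: unit_leb.emeasure_eq_measure)
  then show ?thesis by simp
qed

lemma powr_three_halves: "0 < r \<Longrightarrow> r powr (3 / 2) = r * sqrt r"
  using powr_add[of r 1 "1 / 2"] by (simp add: powr_half_sqrt)

lemma tmu_ball_upper:
  assumes p: "p \<in> tpts" and r: "0 < r" "r \<le> 1 / 3"
  shows "measure tmu (geod_ball torus p r) \<le> 24 * r powr (3 / 2)"
proof -
  let ?B = "geod_ball torus p r"
  have sub: "{w. tpair (cantor (fst w), snd w) \<in> ?B} \<subseteq> {x. cantor x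
      \<in> circ_arc (p 0) r} \<times> circ_arc (p 1) r"
  proof safe
    fix x y assume "tpair (cantor (fst (x, y)), snd (x, y)) \<in> ?B"
    then have "tpair (cantor x, y) i \<in> circ_arc (p i) r" if "i < 2" for i
      using geod_ball_coord[OF p _ that] by simp
    from this[of 0] this[of 1] show "cantor x \<in> circ_arc (p 0) r" "y \<in> circ_arc (p 1) r"
      by (simp_all add: tpair_coord circ_arc_frac)
  qed
  have "measure tmu ?B = measure usquare {w. tpair (cantor (fst w), snd w) \<in> ?B}"
    by (rule measure_tmu[OF openin_tborel[OF openin_geod_ball[OF p]]])
  also have "\<dots> \<le> measure usquare ({x. cantor x \<in> circ_arc (p 0) r} \<times> circ_arc (p 1) r)"
    by (rule usquare.finite_measure_mono[OF sub]) (simp add: borel_Times)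
  also have "\<dots> = measure unit_leb {x. cantor x \<in> circ_arc (p 0) r} * measure unit_leb (circ_arc (p 1) r)"
    by (rule measure_usquare_Times) auto
  also have "\<dots> \<le> (4 * sqrt r) * (6 * r)"
    using p r by (intro mult_mono cantor_arc_upper measure_circ_arc_upper) (auto simp: tpts_def PiE_iff)
  also have "\<dots> = 24 * r powr (3 / 2)" using r by (simp add: powr_three_halves)
  finally show ?thesis .
qed

lemma circ_arc_add:
  assumes "u \<in> circ_arc t r" "s \<in> circ_arc u r'"
  shows "s \<in> circ_arc t (r + r')"
proof -
  obtain k k' :: int where "\<bar>u - t - k\<bar> < r" "\<bar>s - u - k'\<bar> < r'" using assms by (auto simp: circ_arc_def)
  then have "\<bar>s - t - of_int (k + k')\<bar> < r + r'" by simp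
  then show ?thesis unfolding circ_arc_def by blast
qed

text \<open>Avoids identifying the support: small squares around p have positive mass, and this
  already yields a parameter x whose image is close to \<open>p 0\<close>.\<close>

lemma msupp_tmu_point:
  assumes p: "p \<in> msupp torus tmu" and r: "0 < r" "r \<le> 1 / 2"
  obtains x where "x \<in> {0..<1}" "cantor x \<in> circ_arc (p 0) r"
proof -
  have pt: "p \<in> tpts" using p by (simp add: msupp_def)
  have "emeasure tmu (tsquare p r) > 0"
    using p openin_tsquare[OF r(2)] mem_tsquare[OF pt r(1)] by (auto simp: msupp_def)
  moreover have "emeasure tmu (tsquare p r) \<le> emeasure usquare ({x. cantor x \<in> circ_arc (p 0) r} \<times> UNIV)"
    unfolding emeasure_tmu[OF openin_tborel[OF openin_tsquare[OF r(2)]]] tpair_mem_tsquare[OF pt]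
    by (rule emeasure_mono) (auto intro: borel_Times)
  moreover have "emeasure usquare ({x. cantor x \<in> circ_arc (p 0) r} \<times> UNIV)
      = emeasure unit_leb {x. cantor x \<in> circ_arc (p 0) r}"
    unfolding usquare_def by (subst unit_leb.emeasure_pair_measure_Times)
        (auto simp: emeasure_unit_leb_UNIV)
  ultimately have "emeasure lborel ({x. cantor x \<in> circ_arc (p 0) r} \<inter> {0..<1}) > 0"
    by (simp add: emeasure_unit_leb)
  then have "{x. cantor x \<in> circ_arc (p 0) r} \<inter> {0..<1} \<noteq> {}" by (metis emeasure_empty less_irrefl)
  then show ?thesis using that by blast
qed

text \<open>The arc of radius r/4 around a nearby image point lies in the arc of radius r/2 around
  \<open>p 0\<close>, and the square of half-side r/2 lies in the ball. The constant is (sqrt (r/4)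
  / 2) * (r/2) = r^(3/2) / 8.\<close>

lemma tmu_ball_lower:
  assumes p: "p \<in> msupp torus tmu" and r: "0 < r" "r \<le> 1 / 3"
  shows "r powr (3 / 2) / 8 \<le> measure tmu (geod_ball torus p r)"
proof -
  have pt: "p \<in> tpts" using p by (simp add: msupp_def)
  have p01: "p 1 \<in> {0..<1}" using pt by (auto simp: tpts_def PiE_iff)
  obtain x where x: "x \<in> {0..<1}" "cantor x \<in> circ_arc (p 0) (r / 4)"
    using msupp_tmu_point[OF p, of "r / 4"] r by auto
  have "r powr (3 / 2) / 8 = (sqrt (r / 4) / 2) * (r / 2)"
    using r by (simp add: powr_three_halves real_sqrt_divide)
  also have "\<dots> \<le> measure unit_leb {y. cantor y
      \<in> circ_arc (p 0) (r / 2)} * measure unit_leb (circ_arc (p 1) (r / 2))"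
  proof (rule mult_mono)
    have "sqrt (r / 4) / 2 \<le> measure unit_leb {y. cantor y \<in> circ_arc (cantor x) (r / 4)}"
      using r x(1) by (intro cantor_arc_lower) auto
    also have "\<dots> \<le> measure unit_leb {y. cantor y \<in> circ_arc (p 0) (r / 2)}"
      using circ_arc_add[OF x(2), of _ "r / 4"] by (intro unit_leb.finite_measure_mono) auto
    finally show "sqrt (r / 4) / 2 \<le> measure unit_leb {y. cantor y \<in> circ_arc (p 0) (r / 2)}" .
    show "r / 2 \<le> measure unit_leb (circ_arc (p 1) (r / 2))"
      using r p01 by (intro measure_circ_arc_lower) auto
  qed (use r in auto)
  also have "\<dots> = measure usquare ({y. cantor y \<in> circ_arc (p 0) (r / 2)} \<times> circ_arc (p 1) (r / 2))"
    by (rule measure_usquare_Times[symmetric]) auto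
  also have "\<dots> \<le> measure usquare {w. tpair (cantor (fst w), snd w) \<in> tsquare p (r / 2)}"
  proof (rule usquare.finite_measure_mono)
    have "tsquare p (r / 2) \<in> sets tborel" using r by (intro openin_tborel openin_tsquare) auto
    then have "(\<lambda>w. tpair (cantor (fst w), snd w)) -` tsquare p (r / 2) \<inter> space borel \<in> sets borel"
      by (rule measurable_sets[OF cantor_pair_measurable])
    then show "{w. tpair (cantor (fst w), snd w) \<in> tsquare p (r / 2)} \<in> sets usquare"
        by (simp add: vimage_def)
  qed (auto simp: tpair_mem_tsquare[OF pt])
  also have "\<dots> = measure tmu (tsquare p (r / 2))"
    using r by (intro measure_tmu[symmetric] openin_tborel openin_tsquare) auto
  also have "\<dots> \<le> measure tmu (geod_ball torus p r)"
    using r pt openin_tborel[OF openin_geod_ball[OF pt]]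
    by (intro tmu.finite_measure_mono tsquare_subset_ball) auto
  finally show ?thesis .
qed

lemma AD_regular_tmu: "AD_regular torus (3 / 2) tmu"
  unfolding AD_regular_def
proof (rule exI[of _ "1 / 8"], rule exI[of _ 24], rule exI[of _ "1 / 3"], intro conjI ballI allI impI)
  fix p r assume "p \<in> msupp torus tmu" "0 < r \<and> r \<le> (1 / 3 :: real)"
  then show "1 / 8 * r powr (3 / 2) \<le> measure tmu (geod_ball torus p r)"
    and "measure tmu (geod_ball torus p r) \<le> 24 * r powr (3 / 2)"
    using tmu_ball_lower[of p r] tmu_ball_upper[of p r] by (auto simp: msupp_def)
qed auto

lemma finite_borel_measure_tmu: "finite_borel_measure torus tmu"
  by (simp add: finite_borel_measure_def tmu.finite_measure_axioms)

section \<open>Eigenfunctions of the torus\<close>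

text \<open>Continuity expressed through the lift to the plane, where boundedness, measurability and
  calculus are directly available.\<close>

definition tcont :: "((nat \<Rightarrow> real) \<Rightarrow> real) \<Rightarrow> bool" where
  "tcont f \<longleftrightarrow> continuous_on UNIV (\<lambda>w. f (tpair w))"

lemma tcont_cas2: "tcont (cas2 b)"
  by (simp add: tcont_def continuous_on_cas2_tpair)

lemma tcont_const: "tcont (\<lambda>p. c)"
  by (simp add: tcont_def)

lemma tcont_mult: "tcont f \<Longrightarrow> tcont g \<Longrightarrow> tcont (\<lambda>p. f p * g p)"
  and tcont_diff: "tcont f \<Longrightarrow> tcont g \<Longrightarrow> tcont (\<lambda>p. f p - g p)"
  by (auto simp: tcont_def intro: continuous_on_mult continuous_on_diff)

lemma tcont_sum: "(\<And>i. i \<in> J \<Longrightarrow> tcont (f i)) \<Longrightarrow> tcont (\<lambda>p. \<Sum>i\<in>J. f i p)"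
  by (auto simp: tcont_def intro: continuous_on_sum)

lemma tcont_cmult: "tcont f \<Longrightarrow> tcont (\<lambda>p. c * f p)"
  by (intro tcont_mult tcont_const)

lemma tcont_power2: "tcont f \<Longrightarrow> tcont (\<lambda>p. (f p)\<^sup>2)"
  unfolding power2_eq_square by (intro tcont_mult)

lemma tcont_measurable: "tcont f \<Longrightarrow> f \<in> borel_measurable tborel"
  by (simp add: tcont_def measurable_torus_lift)

lemma tpts_tpair: "p \<in> tpts \<Longrightarrow> \<exists>w. w \<in> {0..<1} \<times> {0..<1} \<and> p = tpair w"
  using tpair_eta[of p] tq_id[of p]
  by (intro exI[of _ "(p 0, p 1)"]) (auto simp: tpts_def PiE_iff)

lemma tcont_bounded:
  assumes "tcont f"
  obtains B where "\<And>p. p \<in> tpts \<Longrightarrow> \<bar>f p\<bar> \<le> B"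
proof -
  have "compact ({0..1::real} \<times> {0..1::real})" by (intro compact_Times) auto
  moreover have "continuous_on ({0..1} \<times> {0..1}) (\<lambda>w. f (tpair w))"
    using assms unfolding tcont_def by (rule continuous_on_subset) simp
  ultimately have "bounded ((\<lambda>w. f (tpair w)) ` ({0..1} \<times> {0..1}))"
    by (intro compact_imp_bounded compact_continuous_image)
  then obtain B where B: "\<And>w. w \<in> {0..1} \<times> {0..1} \<Longrightarrow> \<bar>f (tpair w)\<bar> \<le> B"
    by (auto simp: bounded_iff)
  have "\<bar>f p\<bar> \<le> B" if "p \<in> tpts" for p
  proof -
    obtain w where "w \<in> {0..<1} \<times> {0..<1}" "p = tpair w" using tpts_tpair[OF \<open>p \<in> tpts\<close>] by blast
    then show ?thesis using B[of w] by auto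
  qed
  then show ?thesis using that by blast
qed

lemma tcont_integrable:
  assumes f: "tcont f" and M: "finite_measure M" "sets M = sets tborel"
  shows "integrable M f"
proof -
  interpret finite_measure M by fact
  obtain B where B: "\<And>p. p \<in> tpts \<Longrightarrow> \<bar>f p\<bar> \<le> B" using tcont_bounded[OF f] by blast
  have "space M = tpts" using sets_eq_imp_space_eq[OF M(2)] by simp
  moreover have "f \<in> borel_measurable M"
    using tcont_measurable[OF f] measurable_cong_sets[OF M(2) refl] by blast
  ultimately show ?thesis using B by (intro integrable_const_bound[where B = B] AE_I2) auto
qed

lemma tcont_integrable_tvol: "tcont f \<Longrightarrow> integrable tvol f"
  by (simp add: tcont_integrable tvol.finite_measure_axioms)

text \<open>A nonzero value persists on an open rectangle of positive mass. The conclusion holds at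
  every point, as needed for integration against measures singular to the volume.\<close>

lemma tcont_eq_zero:
  assumes g: "tcont g" and zero: "(\<integral>p. (g p)\<^sup>2 \<partial>tvol) = 0" and p: "p \<in> tpts"
  shows "g p = 0"
proof (rule ccontr)
  assume "g p \<noteq> 0"
  obtain w where w: "w \<in> {0..<1} \<times> {0..<1}" "p = tpair w" using tpts_tpair[OF p] by blast
  let ?G = "\<lambda>w. (g (tpair w))\<^sup>2"
  have cont: "continuous_on UNIV ?G" using tcont_power2[OF g] by (simp add: tcont_def)
  have int: "integrable usquare ?G"
  proof -
    obtain B where B: "\<And>p. p \<in> tpts \<Longrightarrow> \<bar>(g p)\<^sup>2\<bar> \<le> B" using tcont_bounded[OF tcont_power2[OF g]] by blast
    have "tpair v \<in> tpts" for v by (simp add: tpair_def)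
    then show ?thesis using B
      by (intro integrable_usquare_bounded[where B = B] borel_measurable_continuous_onI[OF cont]) auto
  qed
  have "(\<integral>w. ?G w \<partial>usquare) = 0"
    using zero integral_tvol[OF tcont_measurable[OF tcont_power2[OF g]]] by simp
  then have AE: "AE w in usquare. ?G w = 0" using integral_nonneg_eq_0_iff_AE[OF int] by simp
  have "open ((\<lambda>w. g (tpair w)) -` (- {0}))"
    using g by (intro open_vimage) (auto simp: tcont_def)
  moreover have "(fst w, snd w) \<in> (\<lambda>w. g (tpair w)) -` (- {0})" using w \<open>g p \<noteq> 0\<close> by simp
  ultimately obtain A B where AB: "open A" "open B" "fst w \<in> A" "snd w \<in> B"
    "A \<times> B \<subseteq> (\<lambda>w. g (tpair w)) -` (- {0})"
    by (rule open_prod_elim) auto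
  \<comment> \<open>Going to the right of x by at most 1 - x stays inside the interval that carries
    \<open>unit_leb\<close>, and also works at x = 0.\<close>
  have pos: "measure unit_leb A > 0" if A: "open A" and x: "x \<in> A" "x \<in> {0..<1}" for A x
  proof -
    obtain e where e: "e > 0" "ball x e \<subseteq> A" using A x(1) by (auto simp: open_contains_ball)
    define d where "d = min e (1 - x)"
    have d: "d > 0" "d \<le> e" "x + d \<le> 1" using e x by (auto simp: d_def)
    have "{x..<x + d} \<subseteq> A \<inter> {0..<1}" using e(2) d x(2) by (auto simp: ball_def dist_real_def)
    then have "emeasure lborel {x..<x + d} \<le> emeasure unit_leb A"
      using A by (simp add: emeasure_unit_leb emeasure_mono)
    then have "ennreal d \<le> ennreal (measure unit_leb A)" using d
        by (simp add: unit_leb.emeasure_eq_measure)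
    then show ?thesis using d(1) by simp
  qed
  have "measure usquare (A \<times> B) = measure unit_leb A * measure unit_leb B"
    using AB by (intro measure_usquare_Times) auto
  also have "\<dots> > 0" using pos[OF AB(1,3)] pos[OF AB(2,4)] w(1) by (auto simp: mem_Times_iff)
  finally have "measure usquare (A \<times> B) > 0" .
  moreover have "measure usquare (A \<times> B) \<le> measure usquare {}"
    using AE AB(5) by (intro usquare.finite_measure_mono_AE) (auto elim!: eventually_mono)
  ultimately show False by simp
qed

text \<open>The remainder \<open>g\<close> is orthogonal to every \<open>e k\<close>, so subtracting
  a finite combination can only increase its norm; completeness makes the norm 0 and continuity
  makes \<open>g\<close> vanish everywhere. The index type is general because the expansion is used
  in both directions, of eigenfunctions in \<open>cas2\<close> and of \<open>cas2\<close> in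
  eigenfunctions.\<close>

lemma orthonormal_expansion:
  fixes e :: "'i \<Rightarrow> (nat \<Rightarrow> real) \<Rightarrow> real"
  assumes e: "\<And>i. tcont (e i)"
    and on: "\<And>i k. (\<integral>p. e i p * e k p \<partial>tvol) = (if i = k then 1 else 0)"
    and complete: "\<And>f \<epsilon>. tcont f \<Longrightarrow> \<epsilon> > 0 \<Longrightarrow>
      \<exists>J c. finite J \<and> (\<integral>p. (f p - (\<Sum>i\<in>J. c i * e i p))\<^sup>2 \<partial>tvol) < \<epsilon>"
    and f: "tcont f" and A: "finite A" "\<And>i. i \<notin> A \<Longrightarrow> (\<integral>p. f p * e i p \<partial>tvol) = 0"
    and p: "p \<in> tpts"
  shows "f p = (\<Sum>i\<in>A. (\<integral>p. f p * e i p \<partial>tvol) * e i p)"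
proof -
  define a where "a i = (\<integral>p. f p * e i p \<partial>tvol)" for i
  define g where "g p = f p - (\<Sum>i\<in>A. a i * e i p)" for p
  have g: "tcont g" unfolding g_def[abs_def] by (intro tcont_diff tcont_sum tcont_cmult e f)
  have lin: "(\<integral>p. (\<Sum>i\<in>J. c i * e i p) * e k p \<partial>tvol) = (if k \<in> J then c k else 0)"
    if "finite J" for J c k
  proof -
    have "(\<integral>p. (\<Sum>i\<in>J. c i * e i p) * e k p \<partial>tvol) = (\<integral>p. (\<Sum>i\<in>J. c i * (e i p * e k p)) \<partial>tvol)"
      by (simp add: sum_distrib_right mult.assoc)
    also have "\<dots> = (\<Sum>i\<in>J. \<integral>p. c i * (e i p * e k p) \<partial>tvol)"
      by (intro Bochner_Integration.integral_sum tcont_integrable_tvol tcont_cmult tcont_mult e)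
    also have "\<dots> = (\<Sum>i\<in>J. if i = k then c k else 0)" by (intro sum.cong) (auto simp: on)
    finally show ?thesis using that by simp
  qed
  have ge: "(\<integral>p. g p * e k p \<partial>tvol) = 0" for k
  proof -
    have "(\<integral>p. g p * e k p \<partial>tvol) = (\<integral>p. f p * e k p - (\<Sum>i\<in>A. a i * e i p) * e k p \<partial>tvol)"
      by (simp add: g_def left_diff_distrib)
    also have "\<dots> = a k - (if k \<in> A then a k else 0)"
    proof -
      have "integrable tvol (\<lambda>p. f p * e k p)" "integrable tvol (\<lambda>p. (\<Sum>i\<in>A. a i * e i p) * e k p)"
        by (intro tcont_integrable_tvol tcont_mult tcont_sum tcont_cmult e f)+
      then show ?thesis by (simp add: lin[OF A(1)] a_def[of k])
    qed
    finally show ?thesis using A(2)[of k] by (simp add: a_def)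
  qed
  have "(\<integral>p. (g p)\<^sup>2 \<partial>tvol) \<le> \<epsilon>" if \<epsilon>: "\<epsilon> > 0" for \<epsilon>
  proof -
    obtain J c where J: "finite J" "(\<integral>p. (g p - (\<Sum>i\<in>J. c i * e i p))\<^sup>2 \<partial>tvol) < \<epsilon>"
      using complete[OF g \<epsilon>] by blast
    define h where "h p = (\<Sum>i\<in>J. c i * e i p)" for p
    have h: "tcont h" unfolding h_def[abs_def] by (intro tcont_sum tcont_cmult e)
    have "(\<integral>p. g p * h p \<partial>tvol) = (\<integral>p. (\<Sum>i\<in>J. c i * (g p * e i p)) \<partial>tvol)"
      by (simp add: h_def sum_distrib_left mult.left_commute)
    also have "\<dots> = (\<Sum>i\<in>J. \<integral>p. c i * (g p * e i p) \<partial>tvol)"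
      by (intro Bochner_Integration.integral_sum tcont_integrable_tvol tcont_cmult tcont_mult e g)
    also have "\<dots> = 0" by (simp add: ge)
    finally have gh: "(\<integral>p. g p * h p \<partial>tvol) = 0" .
    have i: "integrable tvol (\<lambda>p. (g p)\<^sup>2)" "integrable tvol (\<lambda>p. 2 * (g p
        * h p))" "integrable tvol (\<lambda>p. (h p)\<^sup>2)"
      by (intro tcont_integrable_tvol tcont_power2 tcont_mult tcont_cmult g h)+
    have "(\<integral>p. (g p - h p)\<^sup>2 \<partial>tvol) = (\<integral>p. ((g p)\<^sup>2 - 2 * (g p * h p)) + (h p)\<^sup>2 \<partial>tvol)"
      by (intro Bochner_Integration.integral_cong refl) (simp add: power2_eq_square algebra_simps)
    also have "\<dots> = (\<integral>p. (g p)\<^sup>2 \<partial>tvol) - (\<integral>p. 2 * (g p * h p) \<partial>tvol) + (\<integral>p. (h p)\<^sup>2 \<partial>tvol)"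
      using i by simp
    also have "\<dots> \<ge> (\<integral>p. (g p)\<^sup>2 \<partial>tvol)" by (simp add: gh)
    finally show ?thesis using J(2) by (simp add: h_def)
  qed
  then have "(\<integral>p. (g p)\<^sup>2 \<partial>tvol) \<le> 0" by (rule field_le_epsilon) simp
  moreover have "0 \<le> (\<integral>p. (g p)\<^sup>2 \<partial>tvol)" by simp
  ultimately have "g p = 0" by (intro tcont_eq_zero[OF g _ p]) linarith
  then show ?thesis by (simp add: g_def a_def)
qed

section \<open>Orthogonality across different eigenvalues\<close>

lemma AE_usquare: "AE w in usquare. w \<in> {0..1} \<times> {0..1}"
proof -
  have z: "measure unit_leb (- {0..1}) = 0"
  proof -
    have "- {0..1} \<inter> {0..<1} = ({} :: real set)" by auto
    then show ?thesis by (simp add: measure_def emeasure_unit_leb)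
  qed
  have "emeasure usquare ((- {0..1}) \<times> UNIV) = 0" "emeasure usquare (UNIV \<times> (- {0..1})) = 0"
    using measure_usquare_Times[of "- {0..1}" UNIV] measure_usquare_Times[of UNIV "- {0..1}"]
    by (simp_all add: z usquare.emeasure_eq_measure)
  then have "(- {0..1}) \<times> UNIV \<union> UNIV \<times> (- {0..1}) \<in> null_sets usquare"
    by (intro null_sets.Un null_setsI) (auto intro: borel_Times)
  then show ?thesis by (rule AE_I') auto
qed

lemma integrable_usquare_continuous:
  fixes F :: "real \<times> real \<Rightarrow> real"
  assumes "continuous_on UNIV F"
  shows "integrable usquare F"
proof -
  have "compact ({0..1::real} \<times> {0..1::real})" by (intro compact_Times) auto
  then have "bounded (F ` ({0..1} \<times> {0..1}))"
    using assms by (intro compact_imp_bounded compact_continuous_image)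
        (auto intro: continuous_on_subset)
  then obtain B where B: "\<And>w. w \<in> {0..1} \<times> {0..1} \<Longrightarrow> \<bar>F w\<bar> \<le> B" by (auto simp: bounded_iff)
  have "AE w in usquare. norm (F w) \<le> B" using AE_usquare by eventually_elim (use B in auto)
  then show ?thesis
    using borel_measurable_continuous_onI[OF assms]
        by (intro usquare.integrable_const_bound[where B = B]) auto
qed

lemma integrable_unit_leb_continuous:
  fixes f :: "real \<Rightarrow> real"
  assumes "continuous_on UNIV f"
  shows "integrable unit_leb f"
proof -
  have "bounded (f ` {0..1})"
    using assms by (intro compact_imp_bounded compact_continuous_image)
        (auto intro: continuous_on_subset)
  then obtain B where "\<forall>x\<in>f ` {0..1}. norm x \<le> B" by (auto simp only: bounded_iff)
  then have B: "\<bar>f x\<bar> \<le> B" if "x \<in> {0..1}" for x using that by auto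
  have "AE x in unit_leb. norm (f x) \<le> B" using AE_unit_leb by eventually_elim (use B in auto)
  then show ?thesis
    using borel_measurable_continuous_onI[OF assms]
        by (intro unit_leb.integrable_const_bound[where B = B]) auto
qed

text \<open>Integration by parts twice, in the form of Green's identity: the antiderivative h' * cas
  - h * cas' takes equal values at 0 and 1 by periodicity.\<close>

lemma integral_second_derivative_cas:
  fixes h h' h'' :: "real \<Rightarrow> real"
  assumes h: "\<And>x. (h has_real_derivative h' x) (at x)" "\<And>x. (h' has_real_derivative h'' x) (at x)"
    and cont: "continuous_on UNIV h''" and per: "h 1 = h 0" "h' 1 = h' 0"
  shows "(\<integral>x. h'' x * cas k x \<partial>unit_leb) = - (2 * pi * k)\<^sup>2 * (\<integral>x. h x * cas k x \<partial>unit_leb)"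
proof -
  let ?\<Phi> = "\<lambda>x. h' x * cas k x - h x * (2 * pi * k * cas (- k) x)"
  let ?\<phi> = "\<lambda>x. h'' x * cas k x + (2 * pi * k)\<^sup>2 * (h x * cas k x)"
  have ch: "continuous_on UNIV h"
    using h(1) by (meson DERIV_isCont continuous_at_imp_continuous_on)
  have c: "continuous_on UNIV (\<lambda>x. h'' x * cas k x)" "continuous_on UNIV (\<lambda>x. h x * cas k x)"
    by (intro continuous_intros cont ch)+
  have cphi: "continuous_on UNIV ?\<phi>" by (intro continuous_intros c)
  have "(\<integral>x. ?\<phi> x \<partial>unit_leb) = ?\<Phi> 1 - ?\<Phi> 0"
  proof (rule integral_unit_leb_FTC)
    show "(?\<Phi> has_real_derivative ?\<phi> x) (at x)" for x
      by (auto intro!: derivative_eq_intros h simp: power2_eq_square algebra_simps)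
    show "continuous_on {0..1} ?\<phi>" using cphi continuous_on_subset by blast
    show "?\<phi> \<in> borel_measurable borel" using cphi by (rule borel_measurable_continuous_onI)
  qed
  also have "\<dots> = 0"
    using per cas_periodic[of k 0 1] cas_periodic[of "- k" 0 1] by simp
  finally have "(\<integral>x. h'' x * cas k x \<partial>unit_leb) + (2 * pi * k)\<^sup>2 * (\<integral>x. h x * cas k x \<partial>unit_leb) = 0"
    using integrable_unit_leb_continuous[OF c(1)] integrable_unit_leb_continuous[OF c(2)] by simp
  then show ?thesis by simp
qed

lemma vec2_upd: "(vec2 (x, y))(0 := t) = vec2 (t, y)" "(vec2 (x, y))(1 := t) = vec2 (x, t)"
  by (auto simp: vec2_def fun_eq_iff)

lemma vec2_box: "vec2 (x, y) \<in> tbox (\<lambda>i. vec2 (x, y) i - 1 / 2)"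
  by (simp add: vec2_mem_tbox)

lemma smooth_lift_continuous:
  assumes s: "\<And>a. smooth_on 2 (tbox a) g" and js: "set js \<subseteq> {..<2}"
  shows "continuous_on UNIV (\<lambda>w. fold pdiff js g (vec2 w))"
proof (rule continuous_at_imp_continuous_on, rule ballI)
  fix w :: "real \<times> real"
  define a where "a = (\<lambda>i. vec2 w i - 1 / 2)"
  let ?O = "{v \<in> topspace euclidean. vec2 v \<in> tbox a}"
  have o: "open ?O"
    using openin_continuous_map_preimage[OF continuous_map_vec2 openin_tbox[of a]] by simp
  have "continuous_map (subtopology euclidean ?O) (subtopology (powertop_real {..<2}) (tbox a)) vec2"
    by (intro continuous_map_into_subtopology continuous_map_from_subtopology continuous_map_vec2) auto
  moreover have "continuous_map (subtopology (powertop_real {..<2}) (tbox a))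
      euclideanreal (fold pdiff js g)"
    using s[of a] js by (simp add: smooth_on_def)
  ultimately have "continuous_map (subtopology euclidean ?O) euclideanreal (fold pdiff js g \<circ> vec2)"
    by (rule continuous_map_compose)
  then have "continuous_on ?O (\<lambda>w. fold pdiff js g (vec2 w))" by (simp add: o_def)
  moreover have "w \<in> ?O" using vec2_box[of "fst w" "snd w"] by (simp add: a_def)
  ultimately show "isCont (\<lambda>w. fold pdiff js g (vec2 w)) w"
    using o continuous_on_eq_continuous_at by blast
qed

lemma smooth_lift_derivative:
  assumes s: "\<And>a. smooth_on 2 (tbox a) g" and js: "set js \<subseteq> {..<2}"
  shows "((\<lambda>t. fold pdiff js g (vec2 (t, y)))
      has_real_derivative pdiff 0 (fold pdiff js g) (vec2 (x, y))) (at x)"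
    and "((\<lambda>t. fold pdiff js g (vec2 (x, t)))
        has_real_derivative pdiff 1 (fold pdiff js g) (vec2 (x, y))) (at y)"
proof -
  have d: "((\<lambda>t. fold pdiff js g ((vec2 (x, y))(i := t)))
      has_real_derivative pdiff i (fold pdiff js g) (vec2 (x, y))) (at (vec2 (x, y) i))"
    if "i < 2" for i
  proof -
    have "(\<lambda>t. fold pdiff js g ((vec2 (x, y))(i := t))) differentiable (at (vec2 (x, y) i))"
      using s[of "\<lambda>i. vec2 (x, y) i - 1 / 2"] js that vec2_box[of x y] unfolding smooth_on_def by blast
    then show ?thesis unfolding pdiff_def
      by (simp add: DERIV_deriv_iff_real_differentiable)
  qed
  show "((\<lambda>t. fold pdiff js g (vec2 (t, y)))
      has_real_derivative pdiff 0 (fold pdiff js g) (vec2 (x, y))) (at x)"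
    using d[of 0] unfolding vec2_upd by simp
  show "((\<lambda>t. fold pdiff js g (vec2 (x, t)))
      has_real_derivative pdiff 1 (fold pdiff js g) (vec2 (x, y))) (at y)"
    using d[of 1] unfolding vec2_upd by simp
qed

lemma periodic_derivative:
  fixes h :: "real \<Rightarrow> real"
  assumes "\<And>x. (h has_real_derivative h' x) (at x)" "\<And>x. h (x + 1) = h x"
  shows "h' 1 = h' 0"
proof -
  have "((\<lambda>x. h (x + 1)) has_real_derivative h' (0 + 1)) (at 0)"
    using assms(1)[of "0 + 1"] by (subst DERIV_shift[symmetric])
  then have "(h has_real_derivative h' 1) (at 0)" by (simp add: assms(2))
  then show ?thesis using assms(1)[of 0] DERIV_unique by blast
qed

lemma eigenfunction_tcont:
  assumes "laplace_eigenfunction torus r f"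
  shows "tcont f"
proof -
  have "\<And>a. smooth_on 2 (tbox a) (\<lambda>z. f (tq z))"
    using assms unfolding laplace_eigenfunction_torus_iff by blast
  from smooth_lift_continuous[OF this, of "[]"] show ?thesis by (simp add: tcont_def tpair_def)
qed

text \<open>The Laplacian is symmetric: moving it from f to \<open>cas2\<close> multiplies the
  integral by a different eigenvalue, which forces the integral to be 0.\<close>

lemma eigenfunction_orthogonal:
  assumes eig: "laplace_eigenfunction torus r f"
    and ne: "r\<^sup>2 \<noteq> (2 * pi)\<^sup>2 * of_int (k\<^sup>2 + l\<^sup>2)"
  shows "(\<integral>p. f p * cas2 (k, l) p \<partial>tvol) = 0"
proof -
  define g where "g = (\<lambda>z. f (tq z))"
  have s: "\<And>a. smooth_on 2 (tbox a) g"
    and eq: "\<And>a z. z \<in> tbox a \<Longrightarrow> - (pdiff 0 (pdiff 0 g) z + pdiff 1 (pdiff 1 g) z) = r\<^sup>2 * g z"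
    using eig unfolding laplace_eigenfunction_torus_iff g_def by blast+
  let ?F = "\<lambda>w. g (vec2 w)" and ?Fx = "\<lambda>w. pdiff 0 (pdiff 0 g) (vec2 w)"
      and ?Fy = "\<lambda>w. pdiff 1 (pdiff 1 g) (vec2 w)"
  let ?\<phi> = "\<lambda>w. cas k (fst w) * cas l (snd w)"
  have c: "continuous_on UNIV ?F" "continuous_on UNIV ?Fx" "continuous_on UNIV ?Fy"
    using smooth_lift_continuous[OF s, of "[]"] smooth_lift_continuous[OF s, of "[0, 0]"]
      smooth_lift_continuous[OF s, of "[1, 1]"] by simp_all
  have c1: "continuous_on UNIV (\<lambda>w. ?F w * ?\<phi> w)" "continuous_on UNIV (\<lambda>w. ?Fx w
      * ?\<phi> w)" "continuous_on UNIV (\<lambda>w. ?Fy w * ?\<phi> w)"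
    by (intro continuous_intros c)+
  note int = c1[THEN integrable_usquare_continuous]
  have sec: "continuous_on UNIV (\<lambda>x. H (x, y))" "continuous_on UNIV (\<lambda>x. H (y, x))"
    if "continuous_on UNIV H" for H :: "real \<times> real \<Rightarrow> real" and y
    by (rule continuous_on_compose2[OF that]; auto intro!: continuous_intros)+
  have per: "g (vec2 (x + 1, y)) = g (vec2 (x, y))" "g (vec2 (x, y + 1)) = g (vec2 (x, y))" for x y
    using tpair_shift[of x y] by (simp_all add: g_def tpair_def)
  \<comment> \<open>The order of integration is chosen so that the differentiated variable is the
    inner one; the y-derivatives below use the other order.\<close>
  have "(\<integral>w. ?Fx w * ?\<phi> w \<partial>usquare) = (\<integral>y. (\<integral>x. ?Fx (x, y) * cas k x \<partial>unit_leb) * cas l y \<partial>unit_leb)"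
    unfolding integral_usquare_iterated(2)[OF int(2)] by (simp add: mult.assoc[symmetric])
  also have "\<dots> = (\<integral>y. - (2 * pi * k)\<^sup>2 * (\<integral>x. ?F (x, y) * cas k x \<partial>unit_leb) * cas l y \<partial>unit_leb)"
  proof -
    have "(\<integral>x. ?Fx (x, y) * cas k x \<partial>unit_leb)
        = - (2 * pi * k)\<^sup>2 * (\<integral>x. ?F (x, y) * cas k x \<partial>unit_leb)" for y
    proof -
      have d0: "((\<lambda>x. g (vec2 (x, y))) has_real_derivative pdiff 0 g (vec2 (x, y))) (at x)" for x
        using smooth_lift_derivative(1)[OF s, of "[]"] by simp
      have d1: "((\<lambda>x. pdiff 0 g (vec2 (x, y))) has_real_derivative ?Fx (x, y)) (at x)" for x
        using smooth_lift_derivative(1)[OF s, of "[0]"] by simp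
      have "pdiff 0 g (vec2 (1, y)) = pdiff 0 g (vec2 (0, y))" "g (vec2 (1, y)) = g (vec2 (0, y))"
        using periodic_derivative[OF d0 per(1)] per(1)[of 0 y] by simp_all
      then show ?thesis by (intro integral_second_derivative_cas[OF d0 d1 sec(1)[OF c(2)]])
    qed
    then show ?thesis by simp
  qed
  also have "\<dots> = - (2 * pi * k)\<^sup>2 * (\<integral>w. ?F w * ?\<phi> w \<partial>usquare)"
  proof -
    have "(\<integral>w. ?F w * ?\<phi> w \<partial>usquare) = (\<integral>y. (\<integral>x. ?F (x, y) * cas k x \<partial>unit_leb) * cas l y \<partial>unit_leb)"
      unfolding integral_usquare_iterated(2)[OF int(1)] by (simp add: mult.assoc[symmetric])
    then show ?thesis by (simp only: mult.assoc integral_mult_right_zero)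
  qed
  finally have I0: "(\<integral>w. ?Fx w * ?\<phi> w \<partial>usquare) = - (2 * pi * k)\<^sup>2 * (\<integral>w. ?F w * ?\<phi> w \<partial>usquare)" .
  have swap: "u * (cas k x * v) = (u * v) * cas k x" for u v x by simp
  have "(\<integral>w. ?Fy w * ?\<phi> w \<partial>usquare) = (\<integral>x. (\<integral>y. ?Fy (x, y) * cas l y \<partial>unit_leb) * cas k x \<partial>unit_leb)"
    unfolding integral_usquare_iterated(1)[OF int(3)]
    by (simp add: swap)
  also have "\<dots> = (\<integral>x. - (2 * pi * l)\<^sup>2 * (\<integral>y. ?F (x, y) * cas l y \<partial>unit_leb) * cas k x \<partial>unit_leb)"
  proof -
    have "(\<integral>y. ?Fy (x, y) * cas l y \<partial>unit_leb)
        = - (2 * pi * l)\<^sup>2 * (\<integral>y. ?F (x, y) * cas l y \<partial>unit_leb)" for x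
    proof -
      have d0: "((\<lambda>y. g (vec2 (x, y))) has_real_derivative pdiff 1 g (vec2 (x, y))) (at y)" for y
        using smooth_lift_derivative(2)[OF s, of "[]"] by simp
      have d1: "((\<lambda>y. pdiff 1 g (vec2 (x, y))) has_real_derivative ?Fy (x, y)) (at y)" for y
        using smooth_lift_derivative(2)[OF s, of "[1]"] by simp
      have "pdiff 1 g (vec2 (x, 1)) = pdiff 1 g (vec2 (x, 0))" "g (vec2 (x, 1)) = g (vec2 (x, 0))"
        using periodic_derivative[OF d0 per(2)] per(2)[of x 0] by simp_all
      then show ?thesis by (intro integral_second_derivative_cas[OF d0 d1 sec(2)[OF c(3)]])
    qed
    then show ?thesis by simp
  qed
  also have "\<dots> = - (2 * pi * l)\<^sup>2 * (\<integral>w. ?F w * ?\<phi> w \<partial>usquare)"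
  proof -
    have "(\<integral>w. ?F w * ?\<phi> w \<partial>usquare) = (\<integral>x. (\<integral>y. ?F (x, y) * cas l y \<partial>unit_leb) * cas k x \<partial>unit_leb)"
      unfolding integral_usquare_iterated(1)[OF int(1)] by (simp add: swap)
    then show ?thesis by (simp only: mult.assoc integral_mult_right_zero)
  qed
  finally have I1: "(\<integral>w. ?Fy w * ?\<phi> w \<partial>usquare) = - (2 * pi * l)\<^sup>2 * (\<integral>w. ?F w * ?\<phi> w \<partial>usquare)" .
  have "r\<^sup>2 * (\<integral>w. ?F w * ?\<phi> w \<partial>usquare) = (\<integral>w. - (?Fx w * ?\<phi> w + ?Fy w * ?\<phi> w) \<partial>usquare)"
  proof -
    have "r\<^sup>2 * (?F w * ?\<phi> w) = - (?Fx w * ?\<phi> w + ?Fy w * ?\<phi> w)" for w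
    proof -
      have "r\<^sup>2 * (?F w * ?\<phi> w) = (r\<^sup>2 * ?F w) * ?\<phi> w" by simp
      also have "r\<^sup>2 * ?F w = - (?Fx w + ?Fy w)" using eq[OF vec2_box[of "fst w" "snd w"]] by simp
      finally show ?thesis by (simp only: distrib_right minus_mult_left[symmetric])
    qed
    then show ?thesis by (simp only: integral_mult_right_zero[symmetric])
  qed
  also have "\<dots> = - ((\<integral>w. ?Fx w * ?\<phi> w \<partial>usquare) + (\<integral>w. ?Fy w * ?\<phi> w \<partial>usquare))"
    using int(2,3) by simp
  also have "\<dots> = (2 * pi)\<^sup>2 * of_int (k\<^sup>2 + l\<^sup>2) * (\<integral>w. ?F w * ?\<phi> w \<partial>usquare)"
    unfolding I0 I1 by (simp add: power_mult_distrib algebra_simps)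
  finally have "(\<integral>w. ?F w * ?\<phi> w \<partial>usquare) = 0" using ne by simp
  moreover have "(\<integral>p. f p * cas2 (k, l) p \<partial>tvol) = (\<integral>w. f (tpair w) * cas2 (k, l) (tpair w) \<partial>usquare)"
    by (rule integral_tvol) (intro tcont_measurable tcont_mult tcont_cas2 eigenfunction_tcont[OF eig])
  moreover have "(\<integral>w. f (tpair w) * cas2 (k, l) (tpair w) \<partial>usquare) = (\<integral>w. ?F w * ?\<phi> w \<partial>usquare)"
    unfolding cas2_tpair by (simp add: g_def tpair_def)
  ultimately show ?thesis by simp
qed

section \<open>Kuznecov sums on the torus\<close>

definition freq :: "int \<times> int \<Rightarrow> nat" where
  "freq b = nat ((fst b)\<^sup>2 + (snd b)\<^sup>2)"

lemma int_freq: "int (freq b) = (fst b)\<^sup>2 + (snd b)\<^sup>2"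
  by (simp add: freq_def)

lemma abs_le_freq: "\<bar>fst b\<bar> \<le> int (freq b)" "\<bar>snd b\<bar> \<le> int (freq b)"
proof -
  have sq: "\<bar>x\<bar> \<le> x\<^sup>2" for x :: int
  proof (cases "x = 0")
    case False
    then have "\<bar>x\<bar> * 1 \<le> \<bar>x\<bar> * \<bar>x\<bar>" by (intro mult_left_mono) auto
    then show ?thesis by (simp add: power2_eq_square abs_mult_self_eq)
  qed simp
  show "\<bar>fst b\<bar> \<le> int (freq b)" unfolding int_freq using sq[of "fst b"] zero_le_power2[of "snd b"]
      by linarith
  show "\<bar>snd b\<bar> \<le> int (freq b)" unfolding int_freq using sq[of "snd b"] zero_le_power2[of "fst b"]
      by linarith
qed

lemma freq_eq_0_iff: "freq b = 0 \<longleftrightarrow> b = (0, 0)"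
  using abs_le_freq[of b] by (auto simp: freq_def prod_eq_iff)

lemma finite_freq_le: "finite {b. freq b \<le> n}"
proof (rule finite_subset)
  show "{b. freq b \<le> n} \<subseteq> {- int n..int n} \<times> {- int n..int n}"
  proof
    fix b assume "b \<in> {b. freq b \<le> n}"
    then show "b \<in> {- int n..int n} \<times> {- int n..int n}"
      using abs_le_freq[of b] by (auto simp: mem_Times_iff)
  qed
qed simp

text \<open>Ordering by \<open>N\<close>, with ties broken inside the finite level sets, is a strict
  total order with finitely many predecessors for each element. The number of predecessors is a
  bijection onto the naturals, and its inverse is the enumeration.\<close>

lemma sorted_enumeration:
  fixes N :: "'a \<Rightarrow> nat"
  assumes fin: "\<And>n. finite {b. N b \<le> n}" and inf: "infinite (UNIV :: 'a set)"
  obtains \<sigma> :: "nat \<Rightarrow> 'a" where "bij \<sigma>" "\<And>i j. i \<le> j \<Longrightarrow> N (\<sigma> i) \<le> N (\<sigma> j)"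
proof -
  have fine: "finite {b. N b = n}" for n by (rule finite_subset[OF _ fin[of n]]) auto
  have "\<exists>h :: 'a \<Rightarrow> nat. inj_on h {b. N b = n}" for n
    using finite_imp_inj_to_nat_seg[OF fine[of n]] by blast
  then obtain h :: "nat \<Rightarrow> 'a \<Rightarrow> nat" where h: "\<And>n. inj_on (h n) {b. N b = n}" by metis
  define less where "less a b \<longleftrightarrow> N a < N b \<or> N a = N b \<and> h (N a) a < h (N b) b" for a b
  have tot: "less a b \<or> a = b \<or> less b a" for a b
  proof (cases "N a = N b \<and> h (N b) a = h (N b) b")
    case True
    then show ?thesis using inj_onD[OF h[of "N b"], of a b] by simp
  next
    case False
    then show ?thesis unfolding less_def by (metis linorder_neqE_nat)
  qed
  have irr: "\<not> less a a" for a by (simp add: less_def)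
  have tr: "less a b \<Longrightarrow> less b c \<Longrightarrow> less a c" for a b c by (auto simp: less_def)
  have finl: "finite {a. less a b}" for b
      by (rule finite_subset[OF _ fin[of "N b"]]) (auto simp: less_def)
  define r where "r b = card {a. less a b}" for b
  have mono: "r a < r b" if "less a b" for a b
    unfolding r_def using that irr tr by (intro psubset_card_mono finl psubsetI) blast+
  have inj: "inj r" by (rule injI) (metis mono tot less_irrefl)
  \<comment> \<open>The ranks form an initial segment: the predecessor of b with the largest rank
    has rank \<open>r b - 1\<close>, so every smaller number is reached by descent.\<close>
  have down: "\<exists>a. r a = m" if "m < r b" for m b
    using that
  proof (induction "r b" arbitrary: b rule: less_induct)
    case less
    have ne: "{a. less a b} \<noteq> {}"
    proof
      assume "{a. less a b} = {}"
      then show False using less.prems by (simp only: r_def card.empty)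
    qed
    have "Max (r ` {a. less a b}) \<in> r ` {a. less a b}"
      by (rule Max_in) (simp_all only: finite_imageI finl ne image_is_empty not_False_eq_True)
    then obtain a where a: "less a b" "r a = Max (r ` {a. less a b})" by auto
    have top: "c = a \<or> less c a" if "less c b" for c
    proof -
      have "r c \<le> r a"
        unfolding a(2) by (rule Max_ge) (use that in \<open>auto intro: finite_imageI finl\<close>)
      then have "\<not> less a c" using mono[of a c] by auto
      then show ?thesis using tot[of c a] by blast
    qed
    have "{c. less c b} = insert a {c. less c a}" using a(1) top tr by blast
    then have "r b = Suc (r a)" using finl irr by (simp add: r_def)
    then have "m = r a \<or> m < r a" using less.prems by auto
    then show ?case using less.hyps[of a] mono[OF a(1)] by blast
  qed
  have "surj r"
    unfolding surj_def
  proof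
    fix m
    have "infinite (range r)" using inf inj finite_image_iff by blast
    then obtain b where "m < r b" using finite_nat_set_iff_bounded_le[of "range r"] not_le by blast
    then show "\<exists>x. m = r x" using down by metis
  qed
  then have bij: "bij r" using inj by (simp add: bij_def)
  let ?i = "inv_into UNIV r"
  show ?thesis
  proof
    show "bij ?i" by (rule bij_imp_bij_inv[OF bij])
    fix i j :: nat assume "i \<le> j"
    then have "r (?i i) \<le> r (?i j)" using bij by (simp add: bij_def surj_f_inv_f)
    then show "N (?i i) \<le> N (?i j)"
      using mono[of "?i j" "?i i"] by (force simp: less_def not_less[symmetric])
  qed
qed

section \<open>An explicit eigenbasis\<close>

definition tfreq :: "int \<times> int \<Rightarrow> real" where
  "tfreq b = 2 * pi * sqrt (real (freq b))"

lemma tfreq_nonneg: "0 \<le> tfreq b"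
  by (simp add: tfreq_def)

lemma tfreq_sq: "(tfreq b)\<^sup>2 = (2 * pi)\<^sup>2 * of_int ((fst b)\<^sup>2 + (snd b)\<^sup>2)"
proof -
  have "real (freq b) = of_int (int (freq b))" by simp
  then show ?thesis unfolding tfreq_def int_freq[symmetric] by (simp add: power_mult_distrib)
qed

lemma laplace_eigenfunction_tfreq: "laplace_eigenfunction torus (tfreq b) (cas2 b)"
proof -
  have "real (freq b) = of_int (int (freq b))" by simp
  then show ?thesis
    using laplace_eigenfunction_cas2[of "fst b" "snd b"] unfolding tfreq_def int_freq[symmetric] by simp
qed

text \<open>Keeps the claim about all eigenbases from being vacuous. Only (0, 0) has frequency 0, so
  it comes first in the sorted enumeration and the next eigenvalue is positive.\<close>

lemma laplace_eigenbasis_exists: "\<exists>e lam. laplace_eigenbasis torus e lam"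
proof -
  have "infinite (UNIV :: (int \<times> int) set)" by (simp add: finite_prod)
  then obtain \<sigma> :: "nat \<Rightarrow> int \<times> int" where \<sigma>: "bij \<sigma>" "\<And>i j. i \<le> j \<Longrightarrow> freq (\<sigma> i) \<le> freq (\<sigma> j)"
    using sorted_enumeration[of freq] finite_freq_le by blast
  have inj: "\<sigma> i = \<sigma> j \<longleftrightarrow> i = j" for i j using \<sigma>(1) by (simp add: bij_def inj_eq)
  obtain j0 where "\<sigma> j0 = (0, 0)" using \<sigma>(1) by (metis bij_pointE)
  then have "freq (\<sigma> 0) = 0" using \<sigma>(2)[of 0 j0] freq_eq_0_iff[of "(0, 0)"] by simp
  then have s0: "\<sigma> 0 = (0, 0)" by (simp add: freq_eq_0_iff)
  then have s1: "freq (\<sigma> 1) \<noteq> 0" unfolding freq_eq_0_iff using inj[of 1 0] by simp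
  have "laplace_eigenbasis torus (\<lambda>j. cas2 (\<sigma> j)) (\<lambda>j. tfreq (\<sigma> j))"
    unfolding laplace_eigenbasis_def riem_vol_torus
  proof (intro conjI allI impI ballI)
    show "laplace_eigenfunction torus (tfreq (\<sigma> j)) (cas2 (\<sigma> j))" for j
      by (rule laplace_eigenfunction_tfreq)
    show "tfreq (\<sigma> 0) = 0" using s0 by (simp add: tfreq_def freq_def)
    show "0 < tfreq (\<sigma> 1)" using s1 by (simp add: tfreq_def)
    show "tfreq (\<sigma> j) \<le> tfreq (\<sigma> (Suc j))" for j using \<sigma>(2)[of j "Suc j"] by (simp add: tfreq_def)
    show "integrable tvol (\<lambda>x. cas2 (\<sigma> j) x * cas2 (\<sigma> k) x)" for j k
      by (intro tcont_integrable_tvol tcont_mult tcont_cas2)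
    show "(\<integral>x. cas2 (\<sigma> j) x * cas2 (\<sigma> k) x \<partial>tvol) = (if j = k then 1 else 0)" for j k
      by (simp add: cas2_orthonormal inj)
    fix f :: "(nat \<Rightarrow> real) \<Rightarrow> real" and \<epsilon> :: real
    assume f: "f \<in> borel_measurable tvol" "integrable tvol (\<lambda>x. (f x)\<^sup>2)" and e: "0 < \<epsilon>"
    obtain J c where J: "finite J" "(\<integral>p. (f p - (\<Sum>b\<in>J. c b * cas2 b p))\<^sup>2 \<partial>tvol) < \<epsilon>"
      using cas2_complete[of f \<epsilon>] f e by (auto simp: borel_measurable_tvol)
    \<comment> \<open>Completeness is stated for initial segments of the basis, so the finite index
      set is pulled back along \<sigma> and padded with zero coefficients.\<close>
    let ?I = "\<sigma> -` J"
    have I: "finite ?I" using J(1) \<sigma>(1) by (intro finite_vimageI) (auto simp: bij_def)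
    have im: "\<sigma> ` ?I = J" using \<sigma>(1) by (simp add: bij_def surj_image_vimage_eq)
    obtain K where K: "?I \<subseteq> {..<K}" using I finite_nat_iff_bounded by blast
    have "(\<Sum>b\<in>J. c b * cas2 b p) = (\<Sum>j<K. (if \<sigma> j \<in> J then c (\<sigma> j) else 0) * cas2 (\<sigma> j) p)" for p
    proof -
      have "inj_on \<sigma> ?I" using inj by (auto intro: inj_onI)
      then have "(\<Sum>b\<in>\<sigma> ` ?I. c b * cas2 b p) = (\<Sum>j\<in>?I. c (\<sigma> j) * cas2 (\<sigma> j) p)"
        by (subst sum.reindex) simp_all
      then have "(\<Sum>b\<in>J. c b * cas2 b p) = (\<Sum>j\<in>?I. c (\<sigma> j) * cas2 (\<sigma> j) p)"
        by (simp only: im)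
      also have "\<dots> = (\<Sum>j<K. (if \<sigma> j \<in> J then c (\<sigma> j) else 0) * cas2 (\<sigma> j) p)"
        using K by (intro sum.mono_neutral_cong_left) auto
      finally show ?thesis .
    qed
    then show "\<exists>N a. (\<integral>x. (f x - (\<Sum>j<N. a j * cas2 (\<sigma> j) x))\<^sup>2 \<partial>tvol) < \<epsilon>"
      using J(2) by (intro exI[of _ K] exI[of _ "\<lambda>j. if \<sigma> j \<in> J then c (\<sigma> j) else 0"]) simp
  qed
  then show ?thesis by blast
qed

lemma finite_tfreq_le: "finite {b. tfreq b \<le> l}"
proof (rule finite_subset[OF _ finite_freq_le])
  show "{b. tfreq b \<le> l} \<subseteq> {b. freq b \<le> nat \<lceil>(l / (2 * pi))\<^sup>2\<rceil>}"
  proof safe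
    fix k m assume "tfreq (k, m) \<le> l"
    then have "sqrt (real (freq (k, m))) \<le> l / (2 * pi)"
        by (simp add: tfreq_def pos_le_divide_eq mult.commute)
    then have "(sqrt (real (freq (k, m))))\<^sup>2 \<le> (l / (2 * pi))\<^sup>2" by (intro power_mono) auto
    then have "real (freq (k, m)) \<le> (l / (2 * pi))\<^sup>2" by simp
    then show "freq (k, m) \<le> nat \<lceil>(l / (2 * pi))\<^sup>2\<rceil>" by linarith
  qed
qed

text \<open>Both systems diagonalise the Laplacian, so below any level each is a finite linear combination
  of the other, with mutually transposed coefficient matrices.\<close>

lemma kuznecov_sum_torus:
  assumes basis: "laplace_eigenbasis torus e lam" and \<mu>: "finite_measure \<mu>" "sets \<mu> = sets tborel"
  shows "kuznecov_sum e lam \<mu> l = (\<Sum>b | tfreq b \<le> l. (\<integral>p. cas2 b p \<partial>\<mu>)\<^sup>2)"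
proof -
  note B = basis[unfolded laplace_eigenbasis_def riem_vol_torus]
  have eig: "laplace_eigenfunction torus (lam j) (e j)" for j using B by blast
  have e: "tcont (e j)" for j using eigenfunction_tcont[OF eig] .
  have on: "(\<integral>x. e j x * e k x \<partial>tvol) = (if j = k then 1 else 0)" for j k using B by blast
  have lam_nonneg: "0 \<le> lam j" for j
  proof -
    have "lam 1 \<le> lam (Suc n)" for n
      by (induction n) (use B in \<open>auto intro: order_trans\<close>)
    then show ?thesis using B by (cases j) (auto intro: order_trans less_imp_le)
  qed
  define a where "a j b = (\<integral>p. e j p * cas2 b p \<partial>tvol)" for j b
  \<comment> \<open>Coefficients survive only between equal eigenvalues, so the cut at level l is
    compatible for the two systems.\<close>
  have zero: "a j b = 0" if "lam j \<noteq> tfreq b" for j b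
  proof -
    have "(lam j)\<^sup>2 \<noteq> (tfreq b)\<^sup>2" using that lam_nonneg[of j] tfreq_nonneg[of b]
        by (simp add: power2_eq_iff_nonneg)
    then show ?thesis
      using eigenfunction_orthogonal[OF eig[of j], of "fst b" "snd b"] by (simp add: a_def tfreq_sq)
  qed
  define BB where "BB = {b. tfreq b \<le> l}"
  define A where "A = {j. lam j \<le> l}"
  have BB: "finite BB" unfolding BB_def by (rule finite_tfreq_le)
  have comp_cas2: "\<exists>J c. finite J \<and> (\<integral>p. (f p - (\<Sum>i\<in>J. c i * cas2 i p))\<^sup>2 \<partial>tvol) < \<epsilon>"
    if f: "tcont f" and "\<epsilon> > 0" for f \<epsilon>
    using cas2_complete[OF tcont_measurable[OF f] tcont_integrable_tvol[OF tcont_power2[OF f]] \<open>\<epsilon> >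
        0\<close>] by blast
  have comp_e: "\<exists>J c. finite J \<and> (\<integral>p. (f p - (\<Sum>i\<in>J. c i * e i p))\<^sup>2 \<partial>tvol) < \<epsilon>"
    if f: "tcont f" and "\<epsilon> > 0" for f \<epsilon>
  proof -
    have "f \<in> borel_measurable tvol" "integrable tvol (\<lambda>x. (f x)\<^sup>2)"
      using tcont_measurable[OF f] tcont_integrable_tvol[OF tcont_power2[OF f]]
          by (auto simp: borel_measurable_tvol)
    moreover have "\<forall>f\<in>borel_measurable tvol. integrable tvol (\<lambda>x. (f x)\<^sup>2) \<longrightarrow>
        (\<forall>\<epsilon>>0. \<exists>N (a :: nat \<Rightarrow> real). (\<integral>x. (f x - (\<Sum>j<N. a j * e j x))\<^sup>2 \<partial>tvol) < \<epsilon>)"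
      using B by (elim conjE)
    ultimately obtain N c where "(\<integral>x. (f x - (\<Sum>j<N. c j * e j x))\<^sup>2 \<partial>tvol) < \<epsilon>"
      using \<open>\<epsilon> > 0\<close> by blast
    then show ?thesis by (intro exI[of _ "{..<N::nat}"] exI[of _ c]) auto
  qed
  have e_exp: "e j p = (\<Sum>b\<in>BB. a j b * cas2 b p)" if "j \<in> A" "p \<in> tpts" for j p
    unfolding a_def
  proof (rule orthonormal_expansion[OF tcont_cas2 cas2_orthonormal comp_cas2 e BB _ that(2)])
    fix b assume "b \<notin> BB"
    then show "(\<integral>p. e j p * cas2 b p \<partial>tvol) = 0" using zero[of j b] that(1)
        by (auto simp: BB_def A_def a_def)
  qed
  \<comment> \<open>Finiteness of \<open>A\<close> has to be proved, since a sum over an infinite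
    set is 0 by convention. The squared coefficients sum to 1 along each row, as \<open>e j\<close>
    expands within \<open>BB\<close>, and to at most 1 along each column, so the rows cannot
    outnumber the columns.\<close>
  have card: "card A' \<le> card BB" if A': "finite A'" "A' \<subseteq> A" for A'
  proof -
    have row: "(\<Sum>b\<in>BB. (a j b)\<^sup>2) = 1" if "j \<in> A" for j
    proof -
      have "1 = (\<integral>p. e j p * e j p \<partial>tvol)" by (simp add: on)
      also have "\<dots> = (\<integral>p. (\<Sum>b\<in>BB. a j b * (e j p * cas2 b p)) \<partial>tvol)"
      proof (rule Bochner_Integration.integral_cong[OF refl])
        fix p assume "p \<in> space tvol"
        then have "e j p * e j p = e j p * (\<Sum>b\<in>BB. a j b * cas2 b p)" using e_exp[OF that, of p] by simp
        then show "e j p * e j p = (\<Sum>b\<in>BB. a j b * (e j p * cas2 b p))"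
          by (simp add: sum_distrib_left mult.left_commute)
      qed
      also have "\<dots> = (\<Sum>b\<in>BB. \<integral>p. a j b * (e j p * cas2 b p) \<partial>tvol)"
        by (intro Bochner_Integration.integral_sum tcont_integrable_tvol tcont_cmult tcont_mult e
            tcont_cas2)
      also have "\<dots> = (\<Sum>b\<in>BB. (a j b)\<^sup>2)" by (simp add: a_def power2_eq_square)
      finally show ?thesis by simp
    qed
    have col: "(\<Sum>j\<in>A'. (a j b)\<^sup>2) \<le> 1" for b
    proof -
      \<comment> \<open>The projection of \<open>cas2 b\<close> to the span of finitely many
        \<open>e j\<close>; nonnegativity of the squared distance is Bessel's inequality.\<close>
      define s where "s p = (\<Sum>j\<in>A'. a j b * e j p)" for p
      have s: "tcont s" unfolding s_def[abs_def] by (intro tcont_sum tcont_cmult e)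
      have st: "(\<integral>p. s p * h p \<partial>tvol) = (\<Sum>j\<in>A'. a j b * (\<integral>p. e j p * h p \<partial>tvol))" if h: "tcont h" for h
      proof -
        have "(\<integral>p. s p * h p \<partial>tvol) = (\<integral>p. (\<Sum>j\<in>A'. a j b * (e j p * h p)) \<partial>tvol)"
          by (simp add: s_def sum_distrib_right mult.assoc)
        also have "\<dots> = (\<Sum>j\<in>A'. \<integral>p. a j b * (e j p * h p) \<partial>tvol)"
          by (intro Bochner_Integration.integral_sum tcont_integrable_tvol tcont_cmult tcont_mult e h)
        finally show ?thesis by simp
      qed
      have se: "(\<integral>p. e j p * s p \<partial>tvol) = a j b" if "j \<in> A'" for j
      proof -
        have "(\<integral>p. e j p * s p \<partial>tvol) = (\<integral>p. s p * e j p \<partial>tvol)" by (simp add: mult.commute)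
        also have "\<dots> = (\<Sum>i\<in>A'. if i = j then a j b else 0)" unfolding st[OF e]
            by (intro sum.cong) (auto simp: on)
        finally show ?thesis using that A'(1) by simp
      qed
      have "(\<integral>p. s p * s p \<partial>tvol) = (\<Sum>j\<in>A'. (a j b)\<^sup>2)" unfolding st[OF s]
          by (simp add: se power2_eq_square)
      moreover have "(\<integral>p. s p * cas2 b p \<partial>tvol) = (\<Sum>j\<in>A'. (a j b)\<^sup>2)"
        unfolding st[OF tcont_cas2] by (simp add: a_def power2_eq_square)
      moreover have "0 \<le> (\<integral>p. (cas2 b p - s p)\<^sup>2 \<partial>tvol)" by simp
      moreover have "(\<integral>p. (cas2 b p - s p)\<^sup>2 \<partial>tvol)
          = (\<integral>p. (cas2 b p * cas2 b p - 2 * (s p * cas2 b p)) + s p * s p \<partial>tvol)"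
        by (intro Bochner_Integration.integral_cong refl) (simp add: power2_eq_square algebra_simps)
      moreover have "\<dots> = (\<integral>p. cas2 b p * cas2 b p \<partial>tvol) - 2 * (\<integral>p. s p * cas2 b p \<partial>tvol) + (\<integral>p. s p
          * s p \<partial>tvol)"
      proof -
        have "integrable tvol (\<lambda>p. cas2 b p * cas2 b p)" "integrable tvol (\<lambda>p. s p
            * cas2 b p)" "integrable tvol (\<lambda>p. s p * s p)"
          by (intro tcont_integrable_tvol tcont_mult s tcont_cas2)+
        then show ?thesis by simp
      qed
      ultimately show ?thesis by (simp add: cas2_orthonormal)
    qed
    have "real (card A') = (\<Sum>j\<in>A'. \<Sum>b\<in>BB. (a j b)\<^sup>2)" using row A'(2) by (simp add: subset_iff)
    also have "\<dots> = (\<Sum>b\<in>BB. \<Sum>j\<in>A'. (a j b)\<^sup>2)" by (rule sum.swap)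
    also have "\<dots> \<le> (\<Sum>b\<in>BB. 1)" by (intro sum_mono col)
    finally show ?thesis by simp
  qed
  have A: "finite A"
  proof (rule ccontr)
    assume "infinite A"
    then obtain A' where "A' \<subseteq> A" "finite A'" "card A' = Suc (card BB)"
      using infinite_arbitrarily_large by blast
    then show False using card[of A'] by simp
  qed
  have cas2_exp: "cas2 b p = (\<Sum>j\<in>A. a j b * e j p)" if "b \<in> BB" "p \<in> tpts" for b p
  proof -
    have "cas2 b p = (\<Sum>j\<in>A. (\<integral>p. cas2 b p * e j p \<partial>tvol) * e j p)"
    proof (rule orthonormal_expansion[OF e on comp_e tcont_cas2 A _ that(2)])
      fix j assume "j \<notin> A"
      then show "(\<integral>p. cas2 b p * e j p \<partial>tvol) = 0"
        using zero[of j b] that(1) by (auto simp: BB_def A_def a_def mult.commute)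
    qed
    then show ?thesis by (simp add: a_def mult.commute)
  qed
  have space: "space \<mu> = tpts" using sets_eq_imp_space_eq[OF \<mu>(2)] by simp
  have int: "integrable \<mu> f" if "tcont f" for f using tcont_integrable[OF that \<mu>] .
  have me: "(\<integral>p. e j p \<partial>\<mu>) = (\<Sum>b\<in>BB. a j b * (\<integral>p. cas2 b p \<partial>\<mu>))" if "j \<in> A" for j
  proof -
    have "(\<integral>p. e j p \<partial>\<mu>) = (\<integral>p. (\<Sum>b\<in>BB. a j b * cas2 b p) \<partial>\<mu>)"
      using e_exp[OF that] space by (intro Bochner_Integration.integral_cong) auto
    also have "\<dots> = (\<Sum>b\<in>BB. \<integral>p. a j b * cas2 b p \<partial>\<mu>)"
      by (intro Bochner_Integration.integral_sum int tcont_cmult tcont_cas2)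
    finally show ?thesis by simp
  qed
  have mt: "(\<integral>p. cas2 b p \<partial>\<mu>) = (\<Sum>j\<in>A. a j b * (\<integral>p. e j p \<partial>\<mu>))" if "b \<in> BB" for b
  proof -
    have "(\<integral>p. cas2 b p \<partial>\<mu>) = (\<integral>p. (\<Sum>j\<in>A. a j b * e j p) \<partial>\<mu>)"
      using cas2_exp[OF that] space by (intro Bochner_Integration.integral_cong) auto
    also have "\<dots> = (\<Sum>j\<in>A. \<integral>p. a j b * e j p \<partial>\<mu>)"
      by (intro Bochner_Integration.integral_sum int tcont_cmult e)
    finally show ?thesis by simp
  qed
  have "kuznecov_sum e lam \<mu> l = (\<Sum>j\<in>A. (\<integral>p. e j p \<partial>\<mu>) * (\<integral>p. e j p \<partial>\<mu>))"
    by (simp add: kuznecov_sum_def A_def power2_eq_square)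
  also have "\<dots> = (\<Sum>j\<in>A. \<Sum>b\<in>BB. (\<integral>p. e j p \<partial>\<mu>) * (a j b * (\<integral>p. cas2 b p \<partial>\<mu>)))"
    by (intro sum.cong refl) (simp only: sum_distrib_left[symmetric] me)
  also have "\<dots> = (\<Sum>b\<in>BB. \<Sum>j\<in>A. (\<integral>p. e j p \<partial>\<mu>) * (a j b * (\<integral>p. cas2 b p \<partial>\<mu>)))"
    by (rule sum.swap)
  also have "\<dots> = (\<Sum>b\<in>BB. (\<Sum>j\<in>A. a j b * (\<integral>p. e j p \<partial>\<mu>)) * (\<integral>p. cas2 b p \<partial>\<mu>))"
    by (simp add: sum_distrib_left sum_distrib_right mult_ac)
  also have "\<dots> = (\<Sum>b\<in>BB. (\<integral>p. cas2 b p \<partial>\<mu>) * (\<integral>p. cas2 b p \<partial>\<mu>))"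
    by (intro sum.cong refl) (simp only: mt[symmetric])
  finally show ?thesis by (simp add: BB_def power2_eq_square)
qed

text \<open>Hartley coefficients give (Re + Im)^2 instead of the squared modulus, so the equality
  holds for the sum over a symmetric range and not term by term.\<close>

lemma kuznecov_sum_tmu:
  assumes "laplace_eigenbasis torus e lam"
  shows "kuznecov_sum e lam tmu (2 * pi * real K) = ft_energy K"
proof -
  let ?R = "\<lambda>k::int. Re (cantor_ft k)" and ?I = "\<lambda>k::int. Im (cantor_ft k)"
  let ?K = "{- int K..int K}"
  have ev: "tfreq (k, 0) \<le> 2 * pi * real K \<longleftrightarrow> k \<in> ?K" for k
  proof -
    have "sqrt (real (freq (k, 0))) = of_int \<bar>k\<bar>" by (simp add: freq_def)
    then have "tfreq (k, 0) \<le> 2 * pi * real K \<longleftrightarrow> of_int \<bar>k\<bar> \<le> real K" by (simp add: tfreq_def)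
    also have "\<dots> \<longleftrightarrow> \<bar>k\<bar> \<le> int K" by linarith
    finally show ?thesis by auto
  qed
  have "kuznecov_sum e lam tmu (2 * pi * real K) = (\<Sum>b | tfreq b
      \<le> 2 * pi * real K. (\<integral>p. cas2 b p \<partial>tmu)\<^sup>2)"
    by (rule kuznecov_sum_torus[OF assms tmu.finite_measure_axioms sets_tmu])
  also have "\<dots> = (\<Sum>b\<in>(\<lambda>k. (k, 0)) ` ?K. (\<integral>p. cas2 b p \<partial>tmu)\<^sup>2)"
  proof (rule sum.mono_neutral_right[OF finite_tfreq_le])
    show "\<forall>b\<in>{b. tfreq b \<le> 2 * pi * real K} - (\<lambda>k. (k, 0)) ` ?K. (\<integral>p. cas2 b p \<partial>tmu)\<^sup>2 = 0"
    proof
      fix b assume "b \<in> {b. tfreq b \<le> 2 * pi * real K} - (\<lambda>k. (k, 0)) ` ?K"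
      then have "tfreq b \<le> 2 * pi * real K" "b \<notin> (\<lambda>k. (k, 0)) ` ?K" by simp_all
      then have "snd b \<noteq> 0" using ev[of "fst b"] by (metis image_eqI prod.collapse)
      then show "(\<integral>p. cas2 b p \<partial>tmu)\<^sup>2 = 0" using integral_tmu_cas2[of "fst b" "snd b"] by simp
    qed
    show "(\<lambda>k. (k, 0)) ` ?K \<subseteq> {b. tfreq b \<le> 2 * pi * real K}"
    proof
      fix b :: "int \<times> int" assume "b \<in> (\<lambda>k. (k, 0)) ` ?K"
      then obtain k where "k \<in> ?K" "b = (k, 0)" by (rule imageE)
      then show "b \<in> {b. tfreq b \<le> 2 * pi * real K}" using ev[of k] by simp
    qed
  qed
  also have "\<dots> = (\<Sum>k\<in>?K. (?R k + ?I k)\<^sup>2)"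
    by (subst sum.reindex) (auto simp: inj_on_def integral_tmu_cas2)
  finally have S: "kuznecov_sum e lam tmu (2 * pi * real K) = (\<Sum>k\<in>?K. (?R k + ?I k)\<^sup>2)" .
  \<comment> \<open>Replacing k by -k conjugates the transform; adding both forms cancels the mixed
    terms and leaves twice the squared modulus.\<close>
  have "(\<Sum>k\<in>?K. (?R k + ?I k)\<^sup>2) = (\<Sum>k\<in>?K. (?R (- k) + ?I (- k))\<^sup>2)"
    by (rule sum.reindex_bij_witness[where i = uminus and j = uminus]) auto
  also have "\<dots> = (\<Sum>k\<in>?K. (?R k - ?I k)\<^sup>2)" by (simp add: cantor_ft_cnj)
  finally have "2 * (\<Sum>k\<in>?K. (?R k + ?I k)\<^sup>2) = (\<Sum>k\<in>?K. (?R k + ?I k)\<^sup>2 + (?R k - ?I k)\<^sup>2)"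
    by (simp add: sum.distrib)
  also have "\<dots> = 2 * ft_energy K"
    unfolding ft_energy_def sum_distrib_left
    by (intro sum.cong refl) (simp only: cmod_power2, simp add: power2_eq_square algebra_simps)
  finally show ?thesis using S by simp
qed

lemma kuznecov_sum_tmu_not_convergent:
  assumes "laplace_eigenbasis torus e lam"
  shows "\<not> (\<exists>L :: real. ((\<lambda>l. kuznecov_sum e lam tmu l / l powr (1 / 2)) \<longlongrightarrow> L) at_top)"
proof
  assume "\<exists>L :: real. ((\<lambda>l. kuznecov_sum e lam tmu l / l powr (1 / 2)) \<longlongrightarrow> L) at_top"
  then obtain L where L: "((\<lambda>l. kuznecov_sum e lam tmu l / l powr (1 / 2)) \<longlongrightarrow> L) at_top" by blast
  have "filterlim (\<lambda>K. 2 * pi * real K) at_top sequentially"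
    by (intro filterlim_tendsto_pos_mult_at_top[OF tendsto_const] filterlim_real_sequentially) auto
  from filterlim_compose[OF L this]
  have "(\<lambda>K. ft_energy K / (2 * pi * real K) powr (1 / 2) * sqrt (2 * pi)) \<longlonglongrightarrow> L * sqrt (2 * pi)"
    by (intro tendsto_mult tendsto_const) (simp add: kuznecov_sum_tmu[OF assms])
  moreover have "ft_energy K / (2 * pi * real K) powr (1 / 2) * sqrt (2 * pi)
      = ft_energy K / sqrt (real K)" for K
    by (simp add: powr_half_sqrt real_sqrt_mult)
  ultimately show False using ft_energy_not_convergent by auto
qed

theorem proposition1p7:
  shows "\<exists>(M :: (nat \<Rightarrow> real) riem_data) (s :: real) (\<mu> :: (nat \<Rightarrow> real) measure).
    riemannian_manifold M \<and> compact_space (mtop M) \<and> connected_space (mtop M) \<and> mdim M \<ge> 2 \<and>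
    0 < s \<and> s < real (mdim M) \<and>
    finite_borel_measure M \<mu> \<and> AD_regular M s \<mu> \<and>
    (\<exists>e lam. laplace_eigenbasis M e lam) \<and>
    (\<forall>e lam. laplace_eigenbasis M e lam \<longrightarrow>
       \<not> (\<exists>L :: real.
            ((\<lambda>l. kuznecov_sum e lam \<mu> l / l powr (real (mdim M) - s)) \<longlongrightarrow> L) at_top))"
proof (rule exI[of _ torus], rule exI[of _ "3 / 2"], rule exI[of _ tmu], intro conjI allI impI)
  have "real (mdim torus) - 3 / 2 = 1 / 2" by simp
  then show "\<not> (\<exists>L :: real. ((\<lambda>l. kuznecov_sum e lam tmu l / l powr (real (mdim torus)
      - 3 / 2)) \<longlongrightarrow> L) at_top)"
    if "laplace_eigenbasis torus e lam" for e lam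
    using kuznecov_sum_tmu_not_convergent[OF that] by simp
qed (simp_all add: riemannian_manifold_torus ttop_compact ttop_connected finite_borel_measure_tmu
    AD_regular_tmu laplace_eigenbasis_exists)

end
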